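(* Let $M$ be a smooth $n$-dimensional hypersurface of $\mathbb{R}^{n+1}$ with $n\geq 3$. Then for every $\varphi\in C^1_c(M)$, \[ \frac{(n-2)^2}{4}\int_M\frac{\varphi^2}{|x|^2}\,dV+\frac{n^2-4}{4}\int_M\left(\frac{x}{|x|}\cdot\nu_M\right)^2\frac{\varphi^2}{|x|^2}\,dV \leq \int_M\left(|\nabla_T\varphi|^2+\frac{n-2}{2}\,\frac{|H|\varphi^2}{|x|}\right)dV. \]
   Context: $x$ denotes the position vector in $\mathbb{R}^{n+1}$ and $|x|$ its Euclidean norm; $dV$ is the $n$-dimensional volume measure on $M$. $\nu_M$ is a unit normal vector field to $M$. $C^1_c(M)$ is the space of $C^1$ functions with compact support on $M$. The tangential gradient is $\nabla_T\varphi=\nabla\varphi-(\nabla\varphi\cdot\nu_M)\nu_M$. $H$ is the mean curvature of $M$, the sum of the principal curvatures, i.e. $H=\operatorname{div}_T\nu_M$. *)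

theory Defs
  imports "HOL-Analysis.Analysis"
begin

definition pderiv_dir :: "'a::euclidean_space \<Rightarrow> ('a \<Rightarrow> 'b::real_normed_vector) \<Rightarrow> 'a \<Rightarrow> 'b" where
  "pderiv_dir b f = (\<lambda>x. frechet_derivative f (at x) b)"

definition smooth_on :: "'a::euclidean_space set \<Rightarrow> ('a \<Rightarrow> 'b::real_normed_vector) \<Rightarrow> bool" where
  "smooth_on U f \<longleftrightarrow> open U \<and>
     (\<forall>ds. set ds \<subseteq> Basis \<longrightarrow> (\<forall>x\<in>U. foldr pderiv_dir ds f differentiable (at x)))"

definition smooth_hypersurface :: "'a::euclidean_space set \<Rightarrow> bool" where
  "smooth_hypersurface M \<longleftrightarrow>
     (\<forall>p\<in>M. \<exists>U F. p \<in> U \<and> smooth_on U (F :: 'a \<Rightarrow> real) \<and>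
        M \<inter> U = {x\<in>U. F x = 0} \<and>
        (\<forall>x\<in>M \<inter> U. frechet_derivative F (at x) \<noteq> (\<lambda>v. 0)))"

definition tangent_space :: "'a::euclidean_space set \<Rightarrow> 'a \<Rightarrow> 'a set" where
  "tangent_space M x = {v. \<exists>\<gamma> e. e > 0 \<and> \<gamma> ` {-e<..<e} \<subseteq> M \<and> \<gamma> 0 = x \<and>
                                 (\<gamma> has_vector_derivative v) (at 0)}"

definition unit_normal_field :: "'a::euclidean_space set \<Rightarrow> ('a \<Rightarrow> 'a) \<Rightarrow> bool" where
  "unit_normal_field M \<nu> \<longleftrightarrow>
     (\<forall>x\<in>M. norm (\<nu> x) = 1 \<and> (\<forall>v\<in>tangent_space M x. \<nu> x \<bullet> v = 0)) \<and>
     (\<exists>U \<nu>'. M \<subseteq> U \<and> smooth_on U \<nu>' \<and> (\<forall>x\<in>M. \<nu>' x = \<nu> x))"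

text \<open>The tangential gradient: the unique tangent vector representing the derivative of
  f along M (equal to the tangential part of the gradient of any C1 extension).\<close>
definition tgrad :: "'a::euclidean_space set \<Rightarrow> ('a \<Rightarrow> real) \<Rightarrow> 'a \<Rightarrow> 'a" where
  "tgrad M f x = (THE g. g \<in> tangent_space M x \<and> (f has_derivative (\<lambda>v. g \<bullet> v)) (at x within M))"

definition tdiv :: "'a::euclidean_space set \<Rightarrow> ('a \<Rightarrow> 'a) \<Rightarrow> 'a \<Rightarrow> real" where
  "tdiv M X x = (\<Sum>b\<in>Basis. b \<bullet> tgrad M (\<lambda>y. X y \<bullet> b) x)"

text \<open>Mean curvature = sum of principal curvatures = div_T \<nu>.\<close>
definition mean_curv :: "'a::euclidean_space set \<Rightarrow> ('a \<Rightarrow> 'a) \<Rightarrow> 'a \<Rightarrow> real" where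
  "mean_curv M \<nu> x = tdiv M \<nu> x"

definition C1c_on :: "'a::euclidean_space set \<Rightarrow> ('a \<Rightarrow> real) \<Rightarrow> bool" where
  "C1c_on M \<phi> \<longleftrightarrow>
     (\<exists>U \<psi> g. open U \<and> M \<subseteq> U \<and> continuous_on U g \<and>
        (\<forall>x\<in>U. (\<psi> has_derivative (\<lambda>v. g x \<bullet> v)) (at x)) \<and> (\<forall>x\<in>M. \<psi> x = \<phi> x)) \<and>
     compact (M \<inter> closure {x\<in>M. \<phi> x \<noteq> 0})"

definition hausdorff_delta :: "real \<Rightarrow> real \<Rightarrow> 'a::euclidean_space set \<Rightarrow> ennreal" where
  "hausdorff_delta s \<delta> A =
     (INF C \<in> {C :: nat \<Rightarrow> 'a set. A \<subseteq> (\<Union>i. C i) \<and> (\<forall>i. bounded (C i) \<and> diameter (C i) < \<delta>)}.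
        (\<Sum>i. ennreal (unit_ball_vol s * (diameter (C i) / 2) powr s)))"

definition hausdorff_outer :: "real \<Rightarrow> 'a::euclidean_space set \<Rightarrow> ennreal" where
  "hausdorff_outer s A = (SUP \<delta> \<in> {0<..}. hausdorff_delta s \<delta> A)"

definition hausdorff_measure :: "real \<Rightarrow> 'a::euclidean_space measure" where
  "hausdorff_measure s = measure_of UNIV (sets borel) (hausdorff_outer s)"

end

theory Submission
  imports Defs
begin

text \<open>Let \<open>a = (n - 2) / 2\<close> and, for \<open>\<epsilon> > 0\<close>, \<open>X = \<phi>\<^sup>2 x / (\<bar>x\<bar>\<^sup>2 + \<epsilon>)\<close>. The divergence
  theorem gives \<open>\<integral>\<^sub>M (div\<^sub>T X - H X \<bullet> \<nu>) = 0\<close>; multiplying by \<open>a\<close>, bounding the term with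
  \<open>\<nabla>\<^sub>T\<phi>\<close> by completing a square and letting \<open>\<epsilon> \<rightarrow> 0\<close> (Fatou) yields the inequality. The field
  is continuously differentiable, so the singularity at the origin needs no separate treatment.

  The divergence theorem for the Hausdorff measure is proved in graph charts. Translation
  invariance makes the Hausdorff measure of a hyperplane a multiple of Lebesgue measure (whose
  value is irrelevant here), and since \<open>M\<close> is almost isometric to its tangent planes at small
  scales, projecting along a coordinate direction \<open>b\<close> turns \<open>\<bar>\<nu> \<bullet> b\<bar> dV\<close> into that multiple of
  Lebesgue measure. The theorem then becomes the vanishing of the integral of the ordinary
  divergence of \<open>(X - (X \<bullet> \<nu>) \<nu>) / (\<nu> \<bullet> b)\<close>, extended constantly along \<open>b\<close>; the mean curvature
  enters through the symmetry of the Weingarten map.\<close>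

section \<open>Hausdorff measure and Lipschitz maps\<close>

text \<open>The constants come from one optimisation. Multiplied by a free parameter a and with the
  square completed, the divergence identity leaves, as \<epsilon> tends to 0, the coefficient a (n -
  2 - a) on the Hardy term and a (a + 2) on the normal term. The first is largest at a = (n - 2) /
  2, where the two are (n - 2)^2 / 4 and (n^2 - 4) / 4. The curvature term is estimated by |x
  \<bullet> \<nu>| \<le> |x| alone. The obstacle is that the Hausdorff measure is given by coverings
  only; what is extracted from them is its behaviour under Lipschitz maps and isometries. Lebesgue
  integrals are all taken in the ambient space: the n-dimensional measure of a set in the hyperplane
  orthogonal to b is the volume of the part of the slab |x \<bullet> b| \<le> 1/2 lying over it, and
  functions constant along b are integrated over that slab. The quotient by \<nu> \<bullet> b
  matches the area element of the graph, which is 1 / |\<nu> \<bullet> b| times Lebesgue measure: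
  the coordinate divergence of the quotient is the tangential divergence times that density, up to
  sign.\<close>

lemma hausdorff_delta_lipschitz:
  fixes f :: "'a::euclidean_space \<Rightarrow> 'b::euclidean_space"
  assumes L: "L > 0" and s: "s \<ge> 0"
    and lip: "\<And>x y. x \<in> A \<Longrightarrow> y \<in> A \<Longrightarrow> dist (f x) (f y) \<le> L * dist x y"
  shows "hausdorff_delta s (L * \<delta>) (f ` A) \<le> ennreal (L powr s) * hausdorff_delta s \<delta> A"
proof -
  \<comment> \<open>With the factor moved to the left, the right side is a bare infimum and each
    cover can be treated separately. The factor is positive and finite, so the division is undone at
    the end.\<close>
  have "hausdorff_delta s (L * \<delta>) (f ` A) / ennreal (L powr s) \<le> hausdorff_delta s \<delta> A"
    unfolding hausdorff_delta_def[of s \<delta> A]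
  proof (rule INF_greatest)
    fix C :: "nat \<Rightarrow> 'a set"
    assume "C \<in> {C. A \<subseteq> (\<Union>i. C i) \<and> (\<forall>i. bounded (C i) \<and> diameter (C i) < \<delta>)}"
    then have C: "A \<subseteq> (\<Union>i. C i)" "\<And>i. bounded (C i)" "\<And>i. diameter (C i) < \<delta>"
      by auto
    \<comment> \<open>\<open>f\<close> is controlled on \<open>A\<close> only, so each covering set
      is cut down to \<open>A\<close> before it is mapped.\<close>
    define C' where "C' i = f ` (C i \<inter> A)" for i
    have d: "dist u v \<le> L * diameter (C i)" if uv: "u \<in> C' i" "v \<in> C' i" for i u v
    proof -
      obtain x y where xy: "x \<in> C i \<inter> A" "y \<in> C i \<inter> A" "u = f x" "v = f y"
        using uv unfolding C'_def by blast
      have "dist u v \<le> L * dist x y"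
        using lip xy by auto
      also have "\<dots> \<le> L * diameter (C i)"
        using diameter_bounded_bound[OF C(2)] xy L by auto
      finally show ?thesis .
    qed
    have ge0: "0 \<le> L * diameter (C i)" for i
      using L diameter_ge_0[OF C(2)] by simp
    have bd: "bounded (C' i)" for i
      unfolding bounded_two_points using d by blast
    have dia: "diameter (C' i) \<le> L * diameter (C i)" for i
      using d ge0 by (intro diameter_le) (auto simp: dist_norm)
    have "hausdorff_delta s (L * \<delta>) (f ` A) \<le>
        (\<Sum>i. ennreal (unit_ball_vol s * (diameter (C' i) / 2) powr s))"
      unfolding hausdorff_delta_def
    proof (rule INF_lower, safe)
      show "f x \<in> (\<Union>i. C' i)" if "x \<in> A" for x
        using C(1) that unfolding C'_def by blast
      show "bounded (C' i)" "diameter (C' i) < L * \<delta>" for i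
        using bd dia[of i] C(3)[of i] L by (auto intro: le_less_trans)
    qed
    also have "\<dots> \<le> (\<Sum>i. ennreal (unit_ball_vol s * (diameter (C i) / 2) powr s) * ennreal (L powr s))"
    proof (rule suminf_le)
      fix i
      have "(diameter (C' i) / 2) powr s \<le> (L * (diameter (C i) / 2)) powr s"
        using dia[of i] bd s by (intro powr_mono2) (auto simp: diameter_ge_0)
      also have "\<dots> = L powr s * (diameter (C i) / 2) powr s"
        using L C(2) by (subst powr_mult) (auto simp: diameter_ge_0)
      finally show "ennreal (unit_ball_vol s * (diameter (C' i) / 2) powr s) \<le>
          ennreal (unit_ball_vol s * (diameter (C i) / 2) powr s) * ennreal (L powr s)"
        using s by (subst ennreal_mult[symmetric])
          (auto intro!: ennreal_leI mult_left_mono simp: algebra_simps unit_ball_vol_nonneg)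
    qed auto
    also have "\<dots> = (\<Sum>i. ennreal (unit_ball_vol s * (diameter (C i) / 2) powr s)) * ennreal (L powr s)"
      by (rule ennreal_suminf_multc)
    finally show "hausdorff_delta s (L * \<delta>) (f ` A) / ennreal (L powr s) \<le>
        (\<Sum>i. ennreal (unit_ball_vol s * (diameter (C i) / 2) powr s))"
      using L by (intro divide_le_posI_ennreal) (auto simp: mult.commute)
  qed
  then have "hausdorff_delta s (L * \<delta>) (f ` A) / ennreal (L powr s) * ennreal (L powr s)
      \<le> hausdorff_delta s \<delta> A * ennreal (L powr s)"
    by (rule mult_right_mono) auto
  moreover have "x / ennreal (L powr s) * ennreal (L powr s) = x" for x
    using L by (subst ennreal_divide_times) (simp add: ennreal_divide_self)
  ultimately show ?thesis
    by (simp only: mult.commute[of "ennreal (L powr s)"])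
qed

lemma hausdorff_outer_lipschitz:
  fixes f :: "'a::euclidean_space \<Rightarrow> 'b::euclidean_space"
  assumes L: "L > 0" and s: "s \<ge> 0"
    and lip: "\<And>x y. x \<in> A \<Longrightarrow> y \<in> A \<Longrightarrow> dist (f x) (f y) \<le> L * dist x y"
  shows "hausdorff_outer s (f ` A) \<le> ennreal (L powr s) * hausdorff_outer s A"
  unfolding hausdorff_outer_def[of s "f ` A"]
proof (rule SUP_least)
  fix \<delta> :: real assume "\<delta> \<in> {0<..}"
  then have "hausdorff_delta s (\<delta> / L) A \<le> hausdorff_outer s A"
    unfolding hausdorff_outer_def using L by (intro SUP_upper) auto
  then have "ennreal (L powr s) * hausdorff_delta s (\<delta> / L) A \<le> ennreal (L powr s) * hausdorff_outer s A"
    by (rule mult_left_mono) auto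
  with hausdorff_delta_lipschitz[OF L s lip, of A "\<delta> / L"] L
  show "hausdorff_delta s \<delta> (f ` A) \<le> ennreal (L powr s) * hausdorff_outer s A"
    by simp
qed

lemma hausdorff_outer_isometry:
  fixes f :: "'a::euclidean_space \<Rightarrow> 'b::euclidean_space"
  assumes s: "s \<ge> 0"
    and iso: "\<And>x y. x \<in> A \<Longrightarrow> y \<in> A \<Longrightarrow> dist (f x) (f y) = dist x y"
  shows "hausdorff_outer s (f ` A) = hausdorff_outer s A"
proof (rule antisym)
  show "hausdorff_outer s (f ` A) \<le> hausdorff_outer s A"
    using hausdorff_outer_lipschitz[of 1 s A f] s iso by simp
  have inj: "inj_on f A"
    using iso by (metis dist_eq_0_iff inj_onI)
  have "inv_into A f ` f ` A = A"
    using inj by (simp add: image_comp)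
  then show "hausdorff_outer s A \<le> hausdorff_outer s (f ` A)"
    using hausdorff_outer_lipschitz[of 1 s "f ` A" "inv_into A f"] s
    by (force simp: iso inv_into_f_f[OF inj])
qed

lemma hausdorff_outer_mono: "A \<subseteq> B \<Longrightarrow> hausdorff_outer s A \<le> hausdorff_outer s B"
  unfolding hausdorff_outer_def hausdorff_delta_def
  by (intro SUP_mono' INF_superset_mono) auto

text \<open>Unit cube of the hyperplane orthogonal to \<open>b\<close>; its Hausdorff measure is the
  factor between Hausdorff and Lebesgue measure on hyperplanes.\<close>

definition plane_cube :: "'a \<Rightarrow> 'a::euclidean_space set" where
  "plane_cube b = {y. y \<bullet> b = 0 \<and> (\<forall>i\<in>Basis - {b}. \<bar>y \<bullet> i\<bar> \<le> 1 / 2)}"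

text \<open>The cube splits into N^n cells of diameter at most d / N. The cover sum is then bounded
  by a multiple of N^n (d / (2 N))^n, which does not depend on N, so the bound is uniform in
  \<delta>. The crude \<open>d\<close> comes from bounding the norm by the sum of the
  coordinates.\<close>

lemma hausdorff_outer_plane_cube_finite:
  fixes b :: "'a::euclidean_space"
  assumes b: "b \<in> Basis" and n: "n = DIM('a) - 1" "n > 0"
  shows "hausdorff_outer (real n) (plane_cube b) < \<infinity>"
proof -
  define \<omega> where "\<omega> = unit_ball_vol (real n)"
  have \<omega>: "\<omega> \<ge> 0" by (simp add: \<omega>_def)
  define d where "d = real DIM('a)"
  have "hausdorff_delta (real n) \<delta> (plane_cube b) \<le> ennreal (\<omega> * (d / 2) ^ n)" if "\<delta> > 0" for \<delta>
  proof -
    obtain N0 :: nat where N0: "d / \<delta> < real N0"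
      using reals_Archimedean2 by blast
    define N where "N = Suc N0"
    have N: "N > 0" "d / real N < \<delta>"
    proof -
      show "N > 0" by (simp add: N_def)
      have "d / \<delta> < real N" using N0 by (simp add: N_def)
      then show "d / real N < \<delta>" using that by (simp add: N_def field_simps)
    qed
    define I where "I = PiE (Basis - {b}) (\<lambda>_. {..<N})"
    have fI: "finite I" unfolding I_def by (intro finite_PiE) auto
    have cI: "card I = N ^ n"
      unfolding I_def using b by (subst card_PiE) (auto simp: n)
    define cell where "cell k = {y::'a. y \<bullet> b = 0 \<and> (\<forall>i\<in>Basis - {b}. real (k i) / N \<le> y \<bullet> i + 1/2 \<and> y \<bullet> i + 1/2 \<le> (real (k i) + 1) / N)}" for k
    obtain e where e: "bij_betw e {0..<card I} I"
      using ex_bij_betw_nat_finite[OF fI] by blast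
    \<comment> \<open>Covers are indexed by all naturals; the empty sets past the last cell add 0 to
      the sum.\<close>
    define C where "C j = (if j < card I then cell (e j) else {})" for j
    have dist_cell: "norm (x - y) \<le> d / N" if "x \<in> cell k" "y \<in> cell k" for x y k
    proof -
      have "\<bar>(x - y) \<bullet> i\<bar> \<le> 1 / N" if "i \<in> Basis" for i
      proof (cases "i = b")
        case True
        then show ?thesis using \<open>x \<in> cell k\<close> \<open>y \<in> cell k\<close> by (simp add: cell_def inner_diff_left)
      next
        case False
        have "real (k i) / N \<le> x \<bullet> i + 1/2 \<and> x \<bullet> i + 1/2 \<le> real (k i) / N + 1 / N"
          "real (k i) / N \<le> y \<bullet> i + 1/2 \<and> y \<bullet> i + 1/2 \<le> real (k i) / N + 1 / N"
          using \<open>x \<in> cell k\<close> \<open>y \<in> cell k\<close> False that by (auto simp: cell_def add_divide_distrib)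
        then show ?thesis by (simp add: inner_diff_left abs_le_iff)
      qed
      then have "(\<Sum>i\<in>Basis. \<bar>(x - y) \<bullet> i\<bar>) \<le> (\<Sum>i\<in>(Basis::'a set). 1 / real N)"
        by (intro sum_mono) auto
      then show ?thesis
        using norm_le_l1[of "x - y"] by (simp add: d_def)
    qed
    have bdc: "bounded (C j)" for j
      unfolding bounded_two_points C_def using dist_cell by (auto simp: dist_norm)
    have dia: "diameter (C j) \<le> d / N" for j
    proof (rule diameter_le)
      show "C j \<noteq> {} \<or> 0 \<le> d / N" by (simp add: d_def)
      show "norm (x - y) \<le> d / N" if "x \<in> C j" "y \<in> C j" for x y
        using dist_cell[of x "e j" y] that by (auto simp: C_def split: if_splits)
    qed
    have cover: "plane_cube b \<subseteq> (\<Union>j. C j)"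
    proof
      fix y assume y: "y \<in> plane_cube b"
      \<comment> \<open>On the face \<open>y \<bullet> i = 1/2\<close> the floor equals
        \<open>N\<close>; the minimum puts such points into the last cell.\<close>
      define k where "k = restrict (\<lambda>i. min (N - 1) (nat \<lfloor>(y \<bullet> i + 1/2) * N\<rfloor>)) (Basis - {b})"
      have kI: "k \<in> I"
        using N by (auto simp: I_def k_def)
      have "y \<in> cell k"
        unfolding cell_def
      proof (safe)
        show "y \<bullet> b = 0" using y by (simp add: plane_cube_def)
        fix i :: 'a assume i: "i \<in> Basis" "i \<noteq> b"
        define t where "t = (y \<bullet> i + 1/2) * N"
        have t: "0 \<le> t" "t \<le> N"
        proof -
          have "\<bar>y \<bullet> i\<bar> \<le> 1 / 2" using y i by (auto simp: plane_cube_def)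
          then have *: "0 \<le> y \<bullet> i + 1 / 2" "y \<bullet> i + 1 / 2 \<le> 1" by linarith+
          show "0 \<le> t" using * by (simp add: t_def)
          have "(y \<bullet> i + 1 / 2) * N \<le> 1 * real N" using * by (intro mult_right_mono) auto
          then show "t \<le> N" by (simp add: t_def)
        qed
        have ki: "k i = min (N - 1) (nat \<lfloor>t\<rfloor>)"
          using i by (simp add: k_def t_def)
        have le: "real (k i) \<le> t"
        proof -
          have "real (k i) \<le> real (nat \<lfloor>t\<rfloor>)" by (simp add: ki)
          also have "\<dots> \<le> t" using t by simp
          finally show ?thesis .
        qed
        moreover have ge: "t \<le> real (k i) + 1"
        proof (cases "nat \<lfloor>t\<rfloor> \<le> N - 1")
          case True
          then have "k i = nat \<lfloor>t\<rfloor>" by (simp add: ki)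
          then show ?thesis using t by linarith
        next
          case False
          then have "k i = N - 1" by (simp add: ki)
          then show ?thesis using t N by (simp add: of_nat_diff)
        qed
        ultimately show "real (k i) / N \<le> y \<bullet> i + 1/2" "y \<bullet> i + 1/2 \<le> (real (k i) + 1) / N"
          using N by (auto simp: t_def divide_le_eq le_divide_eq)
      qed
      moreover obtain j where "j < card I" "e j = k"
        using e kI unfolding bij_betw_def by (metis atLeastLessThan_iff imageE)
      ultimately show "y \<in> (\<Union>j. C j)" by (auto simp: C_def)
    qed
    have "hausdorff_delta (real n) \<delta> (plane_cube b) \<le> (\<Sum>j. ennreal (\<omega> * (diameter (C j) / 2) powr n))"
      unfolding hausdorff_delta_def \<omega>_def
      using cover bdc dia N(2) by (intro INF_lower) (auto intro: le_less_trans)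
    also have "\<dots> = (\<Sum>j<card I. ennreal (\<omega> * (diameter (C j) / 2) powr n))"
      using n by (intro suminf_finite) (auto simp: C_def)
    also have "\<dots> \<le> (\<Sum>j<card I. ennreal (\<omega> * (d / (2 * N)) ^ n))"
    proof (intro sum_mono ennreal_leI mult_left_mono \<omega>)
      fix j
      have "(diameter (C j) / 2) powr n \<le> (d / (2 * N)) powr n"
        using dia[of j] bdc by (intro powr_mono2) (auto simp: diameter_ge_0)
      also have "\<dots> = (d / (2 * N)) ^ n"
        using N by (intro powr_realpow) (auto simp: d_def)
      finally show "(diameter (C j) / 2) powr n \<le> (d / (2 * N)) ^ n" .
    qed
    also have "\<dots> = ennreal (real (N ^ n) * (\<omega> * (d / (2 * N)) ^ n))"
      using cI \<omega> by (simp add: ennreal_of_nat_eq_real_of_nat ennreal_mult'' d_def)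
    also have "real (N ^ n) * (\<omega> * (d / (2 * N)) ^ n) = \<omega> * (d / 2) ^ n"
      using N by (simp add: power_divide power_mult_distrib)
    finally show ?thesis .
  qed
  then have "hausdorff_outer (real n) (plane_cube b) \<le> ennreal (\<omega> * (d / 2) ^ n)"
    unfolding hausdorff_outer_def by (intro SUP_least) auto
  then show ?thesis
    by (auto simp: less_top[symmetric] top_unique intro: le_less_trans)
qed

section \<open>Uniqueness of translation invariant measures\<close>

text \<open>Both sides equal the integral of \<open>1\<^sub>A(x) 1\<^sub>B(x + y)\<close> over the product measure.\<close>
lemma translation_invariant_measure_unique:
  fixes \<mu> \<kappa> :: "'a::euclidean_space measure"
  assumes [simp, measurable_cong]: "sets \<mu> = sets borel" "sets \<kappa> = sets borel"
    and sf: "sigma_finite_measure \<mu>" "sigma_finite_measure \<kappa>"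
    and inv\<mu>: "\<And>f v. f \<in> borel_measurable borel \<Longrightarrow> v \<in> G \<Longrightarrow> (\<integral>\<^sup>+x. f (x + v) \<partial>\<mu>) = (\<integral>\<^sup>+x. f x \<partial>\<mu>)"
    and inv\<kappa>: "\<And>f v. f \<in> borel_measurable borel \<Longrightarrow> v \<in> G \<Longrightarrow> (\<integral>\<^sup>+x. f (x + v) \<partial>\<kappa>) = (\<integral>\<^sup>+x. f x \<partial>\<kappa>)"
    and sym: "\<And>f. f \<in> borel_measurable borel \<Longrightarrow> (\<integral>\<^sup>+x. f (- x) \<partial>\<kappa>) = (\<integral>\<^sup>+x. f x \<partial>\<kappa>)"
    and AE\<mu>: "AE x in \<mu>. x \<in> G" and AE\<kappa>: "AE x in \<kappa>. x \<in> G"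
    and G: "\<And>v. v \<in> G \<Longrightarrow> - v \<in> G"
    and A[measurable]: "A \<in> sets borel" and B[measurable]: "B \<in> sets borel"
  shows "emeasure \<mu> A * emeasure \<kappa> B = emeasure \<mu> B * emeasure \<kappa> A"
proof -
  interpret P: pair_sigma_finite \<mu> \<kappa>
    using sf by (simp add: pair_sigma_finite_def)
  have [measurable]: "(\<lambda>x. x + v) \<in> borel \<rightarrow>\<^sub>M borel" for v :: 'a by measurable
  have "emeasure \<mu> A * emeasure \<kappa> B = (\<integral>\<^sup>+x. (\<integral>\<^sup>+y. indicator A x * indicator B y \<partial>\<kappa>) \<partial>\<mu>)"
    by (simp add: nn_integral_cmult nn_integral_multc)
  \<comment> \<open>\<mu> is concentrated on \<open>G\<close>, so almost every x is a translation
    under which \<kappa> is invariant.\<close>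
  also have "\<dots> = (\<integral>\<^sup>+x. (\<integral>\<^sup>+y. indicator A x * indicator B (y + x) \<partial>\<kappa>) \<partial>\<mu>)"
  proof (intro nn_integral_cong_AE, use AE\<mu> in eventually_elim)
    fix x assume "x \<in> G"
    then show "(\<integral>\<^sup>+y. indicator A x * indicator B y \<partial>\<kappa>) = (\<integral>\<^sup>+y. indicator A x * indicator B (y + x) \<partial>\<kappa>)"
      by (subst inv\<kappa>[where f = "\<lambda>y. indicator A x * indicator B y"]) auto
  qed
  also have "\<dots> = (\<integral>\<^sup>+y. (\<integral>\<^sup>+x. indicator A x * indicator B (y + x) \<partial>\<mu>) \<partial>\<kappa>)"
    by (rule P.Fubini'[symmetric]) measurable
  also have "\<dots> = (\<integral>\<^sup>+y. (\<integral>\<^sup>+x. indicator A (x + - y) * indicator B x \<partial>\<mu>) \<partial>\<kappa>)"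
  proof (intro nn_integral_cong_AE, use AE\<kappa> in eventually_elim)
    fix y assume "y \<in> G"
    then show "(\<integral>\<^sup>+x. indicator A x * indicator B (y + x) \<partial>\<mu>) =
        (\<integral>\<^sup>+x. indicator A (x + - y) * indicator B x \<partial>\<mu>)"
      using inv\<mu>[of "\<lambda>x. indicator A x * indicator B (y + x)" "- y"] G
      by (simp add: add.commute[of y])
  qed
  also have "\<dots> = (\<integral>\<^sup>+x. (\<integral>\<^sup>+y. indicator A (x + - y) * indicator B x \<partial>\<kappa>) \<partial>\<mu>)"
    by (rule P.Fubini') measurable
  also have "\<dots> = (\<integral>\<^sup>+x. emeasure \<kappa> A * indicator B x \<partial>\<mu>)"
  proof (intro nn_integral_cong_AE, use AE\<mu> in eventually_elim)
    fix x assume "x \<in> G"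
    \<comment> \<open>Here \<open>A\<close> is evaluated at x - y. The symmetry of \<kappa> turns
      this into x + y, after which translation invariance applies.\<close>
    have "(\<integral>\<^sup>+y. indicator A (x + - y) * indicator B x \<partial>\<kappa>) =
        (\<integral>\<^sup>+y. indicator A (y + x) * indicator B x \<partial>\<kappa>)"
      using sym[of "\<lambda>y. indicator A (y + x) * indicator B x"] by (simp add: add.commute)
    also have "\<dots> = (\<integral>\<^sup>+y. indicator A y * indicator B x \<partial>\<kappa>)"
      using inv\<kappa>[OF _ \<open>x \<in> G\<close>, of "\<lambda>y. indicator A y * indicator B x"] by simp
    also have "\<dots> = emeasure \<kappa> A * indicator B x"
      by (simp add: nn_integral_multc)
    finally show "(\<integral>\<^sup>+y. indicator A (x + - y) * indicator B x \<partial>\<kappa>) = emeasure \<kappa> A * indicator B x" .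
  qed
  also have "\<dots> = emeasure \<mu> B * emeasure \<kappa> A"
    by (subst nn_integral_cmult) (auto simp: mult.commute)
  finally show ?thesis .
qed

lemma sigma_finite_measure_cballI:
  fixes M :: "'a::euclidean_space measure"
  assumes [simp]: "sets M = sets borel" and fin: "\<And>k::nat. emeasure M (cball 0 (real k)) < \<infinity>"
  shows "sigma_finite_measure M"
proof
  have sp: "space M = UNIV" using sets_eq_imp_space_eq[OF assms(1)] by simp
  show "\<exists>A. countable A \<and> A \<subseteq> sets M \<and> \<Union>A = space M \<and> (\<forall>a\<in>A. emeasure M a \<noteq> \<infinity>)"
  proof (intro exI[of _ "range (\<lambda>k::nat. cball 0 (real k))"] conjI ballI)
    show "\<Union>(range (\<lambda>k::nat. cball 0 (real k))) = space M"
      unfolding sp by (auto intro: real_arch_simple)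
  qed (use fin in \<open>auto simp: less_top\<close>)
qed

section \<open>Lebesgue measure under translations, reflections and stretches\<close>

lemma nn_integral_lborel_translate:
  fixes f :: "'a::euclidean_space \<Rightarrow> ennreal"
  assumes [measurable]: "f \<in> borel_measurable borel"
  shows "(\<integral>\<^sup>+x. f (x + v) \<partial>lborel) = (\<integral>\<^sup>+x. f x \<partial>lborel)"
proof -
  have "(\<integral>\<^sup>+x. f x \<partial>lborel) = (\<integral>\<^sup>+x. f x \<partial>distr lborel borel ((+) v))"
    by (simp add: lborel_distr_plus)
  also have "\<dots> = (\<integral>\<^sup>+x. f (x + v) \<partial>lborel)"
    by (subst nn_integral_distr) (auto simp: add.commute)
  finally show ?thesis ..
qed

lemma nn_integral_lborel_uminus:
  fixes f :: "'a::euclidean_space \<Rightarrow> ennreal"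
  assumes [measurable]: "f \<in> borel_measurable borel"
  shows "(\<integral>\<^sup>+x. f (- x) \<partial>lborel) = (\<integral>\<^sup>+x. f x \<partial>lborel)"
proof -
  have "(lborel :: 'a measure) = density (distr lborel borel (\<lambda>x. 0 + (-1) *\<^sub>R x)) (\<lambda>_. \<bar>-1::real\<bar> ^ DIM('a))"
    by (rule lborel_affine) simp
  then have eq: "(lborel :: 'a measure) = distr lborel borel uminus"
    by (simp add: density_1)
  have "(\<integral>\<^sup>+x. f x \<partial>lborel) = (\<integral>\<^sup>+x. f x \<partial>distr lborel borel uminus)"
    using eq by simp
  also have "\<dots> = (\<integral>\<^sup>+x. f (- x) \<partial>lborel)"
    by (subst nn_integral_distr) auto
  finally show ?thesis ..
qed

text \<open>For \<open>w = 0\<close> this is the identity, since \<open>x / 0 = 0\<close>.\<close>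
definition reflect :: "'a::euclidean_space \<Rightarrow> 'a \<Rightarrow> 'a" where
  "reflect w x = x - (2 * (x \<bullet> w) / (w \<bullet> w)) *\<^sub>R w"

lemma reflect_reflect [simp]: "reflect w (reflect w x) = x"
  by (cases "w = 0") (simp_all add: reflect_def inner_diff_left inner_diff_right field_simps)

lemma inner_reflect_left: "reflect w x \<bullet> y = x \<bullet> reflect w y"
  by (simp add: reflect_def inner_diff_left inner_diff_right inner_commute)

lemma reflect_add: "reflect w (x + y) = reflect w x + reflect w y"
  by (simp add: reflect_def inner_add_left algebra_simps add_divide_distrib)

lemma reflect_diff: "reflect w (x - y) = reflect w x - reflect w y"
  by (simp add: reflect_def inner_diff_left algebra_simps diff_divide_distrib)

lemma reflect_scaleR: "reflect w (c *\<^sub>R x) = c *\<^sub>R reflect w x"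
  by (simp add: reflect_def algebra_simps)

lemma norm_reflect [simp]: "norm (reflect w x) = norm x"
  by (metis inner_reflect_left norm_eq_sqrt_inner reflect_reflect)

lemma continuous_reflect [continuous_intros]: "continuous_on S (reflect w)"
  unfolding reflect_def by (cases "w = 0") (auto intro!: continuous_intros)

lemma measurable_reflect [measurable]: "reflect w \<in> borel \<rightarrow>\<^sub>M borel"
  by (intro borel_measurable_continuous_onI continuous_reflect)

text \<open>For unit vectors, the hyperplane orthogonal to e - b bisects them: b \<bullet> (e - b)
  is minus half of |e - b|^2. This moves an arbitrary unit direction onto a basis vector without
  constructing a rotation.\<close>

lemma reflect_swap:
  assumes "norm e = 1" "norm b = 1"
  shows "reflect (e - b) b = e"
proof (cases "e = b")
  case False
  have 1: "e \<bullet> e = 1" "b \<bullet> b = 1"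
    using assms by (simp_all add: norm_eq_1)
  have "(e - b) \<bullet> (e - b) = 2 - 2 * (e \<bullet> b)" "b \<bullet> (e - b) = e \<bullet> b - 1"
    by (simp_all add: inner_diff_left inner_diff_right 1 inner_commute)
  moreover have "(e - b) \<bullet> (e - b) \<noteq> 0" using False by simp
  ultimately have "2 * (b \<bullet> (e - b)) / ((e - b) \<bullet> (e - b)) = -1"
    by (simp add: field_simps)
  then show ?thesis by (simp add: reflect_def)
qed (simp add: reflect_def)

text \<open>The image measure is again translation invariant, hence a multiple of Lebesgue measure.
  The reflection preserves the unit ball, whose volume is positive and finite, so the multiple is
  1.\<close>

lemma nn_integral_lborel_reflect:
  fixes f :: "'a::euclidean_space \<Rightarrow> ennreal"
  assumes [measurable]: "f \<in> borel_measurable borel"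
  shows "(\<integral>\<^sup>+x. f (reflect w x) \<partial>lborel) = (\<integral>\<^sup>+x. f x \<partial>lborel)"
proof -
  define \<mu> where "\<mu> = distr (lborel :: 'a measure) borel (reflect w)"
  have em: "emeasure \<mu> A = emeasure lborel {x. reflect w x \<in> A}" if "A \<in> sets borel" for A
    using that unfolding \<mu>_def by (subst emeasure_distr) (auto simp: vimage_def)
  have ball: "{x. reflect w x \<in> cball 0 r} = cball 0 r" for r
    by auto
  have "\<mu> = lborel"
  proof (rule measure_eqI)
    fix A assume "A \<in> sets \<mu>"
    then have A: "A \<in> sets borel" by (simp add: \<mu>_def)
    have "emeasure \<mu> A * emeasure lborel (cball (0::'a) 1) = emeasure \<mu> (cball 0 1) * emeasure lborel A"
    proof (rule translation_invariant_measure_unique[where G = UNIV])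
      show "sigma_finite_measure \<mu>"
      proof (rule sigma_finite_measure_cballI)
        show "emeasure \<mu> (cball 0 (real k)) < \<infinity>" for k
          unfolding em[OF borel_closed[OF closed_cball]] ball by (simp add: emeasure_cball)
      qed (simp add: \<mu>_def)
      show "(\<integral>\<^sup>+x. f (x + v) \<partial>\<mu>) = (\<integral>\<^sup>+x. f x \<partial>\<mu>)" if [measurable]: "f \<in> borel_measurable borel" for f v
      proof -
        have "(\<integral>\<^sup>+x. f (x + v) \<partial>\<mu>) = (\<integral>\<^sup>+x. f (reflect w (x + reflect w v)) \<partial>lborel)"
          unfolding \<mu>_def by (subst nn_integral_distr) (auto simp: reflect_add)
        also have "\<dots> = (\<integral>\<^sup>+x. f (reflect w x) \<partial>lborel)"
          by (rule nn_integral_lborel_translate) measurable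
        also have "\<dots> = (\<integral>\<^sup>+x. f x \<partial>\<mu>)"
          unfolding \<mu>_def by (subst nn_integral_distr) auto
        finally show ?thesis .
      qed
    qed (auto simp: \<mu>_def A nn_integral_lborel_translate nn_integral_lborel_uminus lborel.sigma_finite_measure_axioms)
    moreover have "emeasure \<mu> (cball 0 1) = emeasure lborel (cball (0::'a) 1)"
      by (simp only: em[OF borel_closed[OF closed_cball]] ball)
    moreover have "emeasure lborel (cball (0::'a) 1) \<noteq> 0" "emeasure lborel (cball (0::'a) 1) \<noteq> \<infinity>"
      using unit_ball_vol_pos[of "real DIM('a)"] by (auto simp: emeasure_cball simp del: unit_ball_vol_pos)
    ultimately show "emeasure \<mu> A = emeasure lborel A"
      by (metis ennreal_mult_cancel_left mult.commute infinity_ennreal_def)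
  qed (simp add: \<mu>_def)
  then have "(\<integral>\<^sup>+x. f x \<partial>lborel) = (\<integral>\<^sup>+x. f x \<partial>\<mu>)" by simp
  also have "\<dots> = (\<integral>\<^sup>+x. f (reflect w x) \<partial>lborel)"
    unfolding \<mu>_def by (subst nn_integral_distr) auto
  finally show ?thesis ..
qed

lemma nn_integral_lborel_stretch_Basis:
  fixes f :: "'a::euclidean_space \<Rightarrow> ennreal"
  assumes [measurable]: "f \<in> borel_measurable borel" and b: "b \<in> Basis" and t: "t \<noteq> 0"
  shows "(\<integral>\<^sup>+x. f x \<partial>lborel) = \<bar>t\<bar> * (\<integral>\<^sup>+x. f (x + ((t - 1) * (x \<bullet> b)) *\<^sub>R b) \<partial>lborel)"
proof -
  define T where "T x = (0::'a) + (\<Sum>j\<in>Basis. ((if j = b then t else 1) * (x \<bullet> j)) *\<^sub>R j)" for x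
  have T: "T x = x + ((t - 1) * (x \<bullet> b)) *\<^sub>R b" for x
  proof (rule euclidean_eqI)
    fix j :: 'a assume "j \<in> Basis"
    then show "T x \<bullet> j = (x + ((t - 1) * (x \<bullet> b)) *\<^sub>R b) \<bullet> j"
      using b by (simp add: T_def inner_sum_left_Basis inner_add_left inner_Basis algebra_simps)
  qed
  have [measurable]: "T \<in> borel \<rightarrow>\<^sub>M borel"
    unfolding T by measurable
  have "(lborel :: 'a measure) = density (distr lborel borel T) (\<lambda>_. (\<Prod>j\<in>Basis. \<bar>if j = b then t else 1\<bar>))"
    unfolding T_def by (rule lborel_affine_euclidean) (use t in auto)
  also have "(\<Prod>j\<in>(Basis::'a set). \<bar>if j = b then t else 1\<bar>) = \<bar>t\<bar>"
    using b by (subst prod.remove[of _ b]) auto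
  finally have eq: "(lborel :: 'a measure) = density (distr lborel borel T) (\<lambda>_. \<bar>t\<bar>)" .
  have "(\<integral>\<^sup>+x. f x \<partial>lborel) = (\<integral>\<^sup>+x. f x \<partial>density (distr lborel borel T) (\<lambda>_. \<bar>t\<bar>))"
    using eq by simp
  also have "\<dots> = \<bar>t\<bar> * (\<integral>\<^sup>+x. f (T x) \<partial>lborel)"
    by (simp add: nn_integral_density nn_integral_distr nn_integral_cmult)
  finally show ?thesis by (simp add: T)
qed

text \<open>The stretch along \<open>u\<close> is conjugate, by the reflection exchanging
  \<open>b\<close> and \<open>u\<close>, to a stretch along the basis vector
  \<open>b\<close>.\<close>

lemma nn_integral_lborel_stretch:
  fixes f :: "'a::euclidean_space \<Rightarrow> ennreal"
  assumes [measurable]: "f \<in> borel_measurable borel" and u: "norm u = 1" and t: "t \<noteq> 0"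
  shows "(\<integral>\<^sup>+x. f x \<partial>lborel) = \<bar>t\<bar> * (\<integral>\<^sup>+x. f (x + ((t - 1) * (x \<bullet> u)) *\<^sub>R u) \<partial>lborel)"
proof -
  obtain b :: 'a where b: "b \<in> Basis" using nonempty_Basis by blast
  define R where "R = reflect (u - b)"
  have [measurable]: "R \<in> borel \<rightarrow>\<^sub>M borel" by (simp add: R_def)
  have Rb: "R b = u" using u b by (simp add: R_def reflect_swap)
  have RT: "R (R x + ((t - 1) * (R x \<bullet> b)) *\<^sub>R b) = x + ((t - 1) * (x \<bullet> u)) *\<^sub>R u" for x
    using Rb by (simp add: R_def reflect_add reflect_scaleR inner_reflect_left)
  have "(\<integral>\<^sup>+x. f x \<partial>lborel) = (\<integral>\<^sup>+x. f (R x) \<partial>lborel)"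
    by (simp add: R_def nn_integral_lborel_reflect)
  also have "\<dots> = \<bar>t\<bar> * (\<integral>\<^sup>+x. f (R (x + ((t - 1) * (x \<bullet> b)) *\<^sub>R b)) \<partial>lborel)"
    using nn_integral_lborel_stretch_Basis[of "\<lambda>x. f (R x)" b t] b t by simp
  also have "(\<integral>\<^sup>+x. f (R (x + ((t - 1) * (x \<bullet> b)) *\<^sub>R b)) \<partial>lborel) =
      (\<integral>\<^sup>+x. f (R (R x + ((t - 1) * (R x \<bullet> b)) *\<^sub>R b)) \<partial>lborel)"
    unfolding R_def
    by (rule nn_integral_lborel_reflect[symmetric, where f = "\<lambda>x. f (reflect (u - b) (x + ((t - 1) * (x \<bullet> b)) *\<^sub>R b))"]) measurable
  finally show ?thesis by (simp add: RT)
qed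

section \<open>Hausdorff measure on hyperplanes\<close>

text \<open>Of thickness 1 in direction \<open>b\<close>, so that the volume of the part of the slab
  over a subset of the hyperplane orthogonal to \<open>b\<close> is the n-dimensional Lebesgue
  measure of that subset.\<close>

definition slab :: "'a::euclidean_space \<Rightarrow> 'a set" where
  "slab b = {x. \<bar>x \<bullet> b\<bar> \<le> 1 / 2}"

definition drop_coord :: "'a::euclidean_space \<Rightarrow> 'a \<Rightarrow> 'a" where
  "drop_coord b x = x - (x \<bullet> b) *\<^sub>R b"

lemma slab_borel [measurable]: "slab b \<in> sets borel"
  unfolding slab_def by measurable

lemma slab_add: "v \<bullet> b = 0 \<Longrightarrow> x + v \<in> slab b \<longleftrightarrow> x \<in> slab b"
  by (simp add: slab_def inner_add_left)

lemma drop_coord_measurable [measurable]: "drop_coord b \<in> borel \<rightarrow>\<^sub>M borel"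
  unfolding drop_coord_def by measurable

lemma continuous_on_drop_coord [continuous_intros]: "continuous_on S (drop_coord b)"
  unfolding drop_coord_def by (intro continuous_intros)

lemma inner_drop_coord [simp]: "b \<in> Basis \<Longrightarrow> drop_coord b x \<bullet> b = 0"
  by (simp add: drop_coord_def inner_diff_left)

lemma drop_coord_add: "drop_coord b (x + y) = drop_coord b x + drop_coord b y"
  by (simp add: drop_coord_def algebra_simps inner_add_left)

lemma drop_coord_scaleR: "drop_coord b (c *\<^sub>R x) = c *\<^sub>R drop_coord b x"
  by (simp add: drop_coord_def algebra_simps)

lemma drop_coord_idem: "x \<bullet> b = 0 \<Longrightarrow> drop_coord b x = x"
  by (simp add: drop_coord_def)

text \<open>The equation for \<open>emeasure\<close> isolates countable additivity of the outer
  measure on Borel sets; the final theorem splits on whether it holds.\<close>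

locale hausdorff_space =
  fixes h :: "'a::euclidean_space measure" and n :: nat
  assumes sets_h [simp, measurable_cong]: "sets h = sets borel"
    and emeasure_h: "\<And>A. A \<in> sets borel \<Longrightarrow> emeasure h A = hausdorff_outer (real n) A"
    and n_def: "n = DIM('a) - 1" and n_pos: "n > 0"
begin

lemma space_h [simp]: "space h = UNIV"
  using sets_eq_imp_space_eq[OF sets_h] by simp

lemma emeasure_h_lipschitz:
  assumes "A \<in> sets borel" "f ` A \<in> sets borel" "L > 0"
    and "\<And>x y. x \<in> A \<Longrightarrow> y \<in> A \<Longrightarrow> dist (f x) (f y) \<le> L * dist x y"
  shows "emeasure h (f ` A) \<le> ennreal (L ^ n) * emeasure h A"
  using hausdorff_outer_lipschitz[of L "real n" A f] assms by (simp add: emeasure_h powr_realpow)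

lemma emeasure_h_isometry:
  assumes "A \<in> sets borel" "f ` A \<in> sets borel"
    and "\<And>x y. x \<in> A \<Longrightarrow> y \<in> A \<Longrightarrow> dist (f x) (f y) = dist x y"
  shows "emeasure h (f ` A) = emeasure h A"
  using hausdorff_outer_isometry[of "real n" A f] assms by (simp add: emeasure_h)

lemma nn_integral_h_translate:
  assumes [measurable]: "f \<in> borel_measurable borel"
  shows "(\<integral>\<^sup>+x. f (x + v) \<partial>h) = (\<integral>\<^sup>+x. f x \<partial>h)"
proof -
  have "distr h borel (\<lambda>x. x + v) = h"
  proof (rule measure_eqI)
    fix A assume "A \<in> sets (distr h borel (\<lambda>x. x + v))"
    then have A[measurable]: "A \<in> sets borel" by simp
    have eq: "A = (\<lambda>x. x + v) ` {x. x + v \<in> A}"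
    proof safe
      fix x assume "x \<in> A"
      then have "x - v \<in> {x. x + v \<in> A}" by simp
      then have "(x - v) + v \<in> (\<lambda>x. x + v) ` {x. x + v \<in> A}" by (rule imageI)
      then show "x \<in> (\<lambda>x. x + v) ` {x. x + v \<in> A}" by simp
    qed
    have "emeasure h A = emeasure h {x. x + v \<in> A}"
      by (subst eq, rule emeasure_h_isometry) (auto simp: eq[symmetric])
    then show "emeasure (distr h borel (\<lambda>x. x + v)) A = emeasure h A"
      by (simp add: emeasure_distr vimage_def)
  qed simp
  then have "(\<integral>\<^sup>+x. f x \<partial>h) = (\<integral>\<^sup>+x. f x \<partial>distr h borel (\<lambda>x. x + v))" by simp
  also have "\<dots> = (\<integral>\<^sup>+x. f (x + v) \<partial>h)"
    by (subst nn_integral_distr) auto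
  finally show ?thesis ..
qed

lemma emeasure_h_plane_cube_finite:
  assumes "b \<in> Basis"
  shows "emeasure h (plane_cube b) < \<infinity>"
proof -
  have "plane_cube b \<in> sets borel"
    unfolding plane_cube_def by measurable
  then show ?thesis
    using hausdorff_outer_plane_cube_finite[OF assms n_def n_pos] by (simp add: emeasure_h)
qed

text \<open>The Hausdorff measure on the plane and the projected slab volume are both invariant
  under translations within the plane, hence proportional. The factor is read off from
  \<open>plane_cube b\<close>, over which the slab contains exactly a unit cube of the ambient
  space.\<close>

lemma emeasure_h_coord_plane:
  assumes b: "b \<in> Basis" and A: "A \<in> sets borel" "\<And>x. x \<in> A \<Longrightarrow> x \<bullet> b = 0"
  shows "emeasure h A = emeasure h (plane_cube b) * emeasure lborel {x \<in> slab b. drop_coord b x \<in> A}"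
proof -
  define G where "G = {x::'a. x \<bullet> b = 0}"
  have [measurable]: "G \<in> sets borel" unfolding G_def by measurable
  have Q[measurable]: "plane_cube b \<in> sets borel" unfolding plane_cube_def by measurable
  define \<mu> where "\<mu> = density h (indicator G)"
  define \<kappa> where "\<kappa> = distr (density lborel (indicator (slab b))) borel (drop_coord b)"
  have \<kappa>int: "(\<integral>\<^sup>+x. f x \<partial>\<kappa>) = (\<integral>\<^sup>+x. indicator (slab b) x * f (drop_coord b x) \<partial>lborel)"
    if [measurable]: "f \<in> borel_measurable borel" for f
    unfolding \<kappa>_def by (subst nn_integral_distr) (auto simp: nn_integral_density)
  have \<mu>int: "(\<integral>\<^sup>+x. f x \<partial>\<mu>) = (\<integral>\<^sup>+x. indicator G x * f x \<partial>h)"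
    if [measurable]: "f \<in> borel_measurable borel" for f
    unfolding \<mu>_def by (subst nn_integral_density) auto
  have \<kappa>em: "emeasure \<kappa> B = emeasure lborel {x \<in> slab b. drop_coord b x \<in> B}" if [measurable]: "B \<in> sets borel" for B
  proof -
    have "emeasure \<kappa> B = (\<integral>\<^sup>+x. indicator B x \<partial>\<kappa>)"
      by (simp add: \<kappa>_def)
    also have "\<dots> = (\<integral>\<^sup>+x. indicator {x \<in> slab b. drop_coord b x \<in> B} x \<partial>lborel)"
      unfolding \<kappa>int[OF borel_measurable_indicator[OF that]]
      by (rule nn_integral_cong) (auto split: split_indicator)
    finally show ?thesis by simp
  qed
  have \<mu>em: "emeasure \<mu> B = emeasure h (G \<inter> B)" if [measurable]: "B \<in> sets borel" for B
    unfolding \<mu>_def by (subst emeasure_density) (auto simp: indicator_inter_arith[symmetric])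
  have "emeasure \<mu> A * emeasure \<kappa> (plane_cube b) = emeasure \<mu> (plane_cube b) * emeasure \<kappa> A"
  proof (rule translation_invariant_measure_unique[where G = G])
    show "sigma_finite_measure \<mu>"
    proof (rule sigma_finite_measure_cballI)
      fix k :: nat
      define L where "L = 2 * (real k + 1)"
      have L: "L > 0" by (simp add: L_def)
      \<comment> \<open>A ball of the plane fits into the plane cube scaled by \<open>L\<close>, and
        scaling by \<open>L\<close> is a Lipschitz map, so finiteness is inherited from the
        cube.\<close>
      have "G \<inter> cball 0 (real k) \<subseteq> (\<lambda>x. L *\<^sub>R x) ` plane_cube b"
      proof
        fix x assume x: "x \<in> G \<inter> cball 0 (real k)"
        have "\<bar>x \<bullet> i\<bar> \<le> L / 2" if "i \<in> Basis" for i
        proof -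
          have "\<bar>x \<bullet> i\<bar> \<le> real k" using x Basis_le_norm[OF that, of x] by auto
          then show ?thesis by (simp add: L_def)
        qed
        then have "(1 / L) *\<^sub>R x \<in> plane_cube b"
          using x L by (auto simp: plane_cube_def G_def abs_mult field_simps)
        then have "L *\<^sub>R ((1 / L) *\<^sub>R x) \<in> (\<lambda>x. L *\<^sub>R x) ` plane_cube b" by (rule imageI)
        then show "x \<in> (\<lambda>x. L *\<^sub>R x) ` plane_cube b" using L by simp
      qed
      then have "hausdorff_outer (real n) (G \<inter> cball 0 (real k)) \<le> hausdorff_outer (real n) ((\<lambda>x. L *\<^sub>R x) ` plane_cube b)"
        by (rule hausdorff_outer_mono)
      also have "\<dots> \<le> ennreal (L powr n) * hausdorff_outer (real n) (plane_cube b)"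
        using L by (intro hausdorff_outer_lipschitz) (auto simp: dist_norm scaleR_diff_right[symmetric])
      also have "\<dots> < \<infinity>"
        using hausdorff_outer_plane_cube_finite[OF b n_def n_pos] by (simp add: ennreal_mult_less_top)
      finally show "emeasure \<mu> (cball 0 (real k)) < \<infinity>"
        by (simp add: \<mu>em emeasure_h)
    qed (simp add: \<mu>_def)
    show "sigma_finite_measure \<kappa>"
    proof (rule sigma_finite_measure_cballI)
      fix k :: nat
      \<comment> \<open>The slab bounds the coordinate that the projection forgets, so bounded sets
        have bounded preimages.\<close>
      have "{x \<in> slab b. drop_coord b x \<in> cball 0 (real k)} \<subseteq> cball 0 (real k + 1)"
      proof safe
        fix x assume x: "x \<in> slab b" "drop_coord b x \<in> cball 0 (real k)"
        have "norm x \<le> norm (drop_coord b x) + norm ((x \<bullet> b) *\<^sub>R b)"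
          by (metis drop_coord_def diff_add_cancel norm_triangle_ineq)
        also have "\<dots> \<le> real k + 1"
          using x b by (auto simp: slab_def)
        finally show "x \<in> cball 0 (real k + 1)" by simp
      qed
      then have "emeasure lborel {x \<in> slab b. drop_coord b x \<in> cball 0 (real k)} \<le> emeasure lborel (cball (0::'a) (real k + 1))"
        by (rule emeasure_mono) simp
      then show "emeasure \<kappa> (cball 0 (real k)) < \<infinity>"
        unfolding \<kappa>em[OF borel_closed[OF closed_cball]]
        by (rule le_less_trans) (simp add: emeasure_cball)
    qed (simp add: \<kappa>_def)
    show "(\<integral>\<^sup>+x. f (x + v) \<partial>\<mu>) = (\<integral>\<^sup>+x. f x \<partial>\<mu>)"
      if [measurable]: "f \<in> borel_measurable borel" and v: "v \<in> G" for f v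
    proof -
      have ind: "indicator G (x + v) = (indicator G x :: ennreal)" for x
        using v by (auto simp: G_def inner_add_left split: split_indicator)
      show ?thesis
        using nn_integral_h_translate[of "\<lambda>x. indicator G x * f x" v]
        by (simp add: \<mu>int ind)
    qed
    show "(\<integral>\<^sup>+x. f (x + v) \<partial>\<kappa>) = (\<integral>\<^sup>+x. f x \<partial>\<kappa>)"
      if [measurable]: "f \<in> borel_measurable borel" and v: "v \<in> G" for f v
    proof -
      have ind: "indicator (slab b) (x + v) = (indicator (slab b) x :: ennreal)" for x
        using v by (auto simp: G_def slab_add split: split_indicator)
      have "drop_coord b (x + v) = drop_coord b x + v" for x
        using v by (simp add: G_def drop_coord_add drop_coord_idem)
      then show ?thesis
        using nn_integral_lborel_translate[of "\<lambda>x. indicator (slab b) x * f (drop_coord b x)" v]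
        by (simp add: \<kappa>int ind)
    qed
    show "(\<integral>\<^sup>+x. f (- x) \<partial>\<kappa>) = (\<integral>\<^sup>+x. f x \<partial>\<kappa>)"
      if [measurable]: "f \<in> borel_measurable borel" for f
    proof -
      have ind: "indicator (slab b) (- x) = (indicator (slab b) x :: ennreal)" for x
        by (auto simp: slab_def split: split_indicator)
      have "drop_coord b (- x) = - drop_coord b x" for x
        by (simp add: drop_coord_def)
      then show ?thesis
        using nn_integral_lborel_uminus[of "\<lambda>x. indicator (slab b) x * f (drop_coord b x)"]
        by (simp add: \<kappa>int ind)
    qed
    show "AE x in \<mu>. x \<in> G"
      unfolding \<mu>_def by (subst AE_density) (auto simp: indicator_def)
    show "AE x in \<kappa>. x \<in> G"
      unfolding \<kappa>_def using b by (subst AE_distr_iff) (auto simp: G_def)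
  qed (auto simp: \<mu>_def \<kappa>_def G_def A)
  moreover have "emeasure \<mu> A = emeasure h A"
    using A by (auto simp: \<mu>em G_def intro!: arg_cong[where f = "emeasure h"])
  moreover have "emeasure \<mu> (plane_cube b) = emeasure h (plane_cube b)"
    by (auto simp: \<mu>em G_def plane_cube_def intro!: arg_cong[where f = "emeasure h"])
  moreover have "emeasure \<kappa> (plane_cube b) = 1"
  proof -
    have eq: "drop_coord b x \<bullet> i = x \<bullet> i" if "i \<in> Basis - {b}" for i x
      using that b by (auto simp: drop_coord_def inner_diff_left inner_Basis)
    define u :: 'a where "u = (\<Sum>i\<in>Basis. (1 / 2) *\<^sub>R i)"
    have u: "u \<bullet> i = 1 / 2" if "i \<in> Basis" for i
      using that by (simp add: u_def inner_sum_left_Basis)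
    have "{x \<in> slab b. drop_coord b x \<in> plane_cube b} = {x. \<forall>i\<in>Basis. \<bar>x \<bullet> i\<bar> \<le> 1 / 2}"
      using b eq by (auto simp: slab_def plane_cube_def)
    also have "\<dots> = cbox (- u) u"
    proof -
      have "\<bar>x \<bullet> i\<bar> \<le> 1 / 2 \<longleftrightarrow> - u \<bullet> i \<le> x \<bullet> i \<and> x \<bullet> i \<le> u \<bullet> i" if "i \<in> Basis" for i x
        using u[OF that] by (auto simp: abs_le_iff)
      then show ?thesis unfolding cbox_def by blast
    qed
    finally have "emeasure \<kappa> (plane_cube b) = emeasure lborel (cbox (- u) u)"
      by (simp add: \<kappa>em)
    also have "\<dots> = 1"
    proof (subst emeasure_lborel_cbox)
      show "- u \<bullet> i \<le> u \<bullet> i" if "i \<in> Basis" for i using u[OF that] by simp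
      have "(\<Prod>i\<in>Basis. (u - - u) \<bullet> i) = (\<Prod>i\<in>(Basis :: 'a set). 1)"
        by (rule prod.cong) (simp_all add: u inner_add_left)
      then show "ennreal (\<Prod>i\<in>Basis. (u - - u) \<bullet> i) = 1" by simp
    qed
    finally show ?thesis .
  qed
  ultimately show ?thesis
    using A by (simp add: \<kappa>em)
qed

text \<open>The right-hand side is the measure of the projection of \<open>A\<close> along \<open>b\<close>; it is compared with
  that of \<open>A\<close> after reflecting the plane onto the coordinate plane orthogonal to \<open>b\<close>.\<close>
lemma emeasure_h_plane:
  assumes b: "b \<in> Basis" and e: "norm e = 1" and \<beta>: "e \<bullet> b \<noteq> 0"
    and A[measurable]: "A \<in> sets borel" and Ae: "\<And>x. x \<in> A \<Longrightarrow> (x - x0) \<bullet> e = 0"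
  shows "ennreal \<bar>e \<bullet> b\<bar> * emeasure h A = emeasure h (plane_cube b) *
     emeasure lborel {x \<in> slab b. x - ((x - x0) \<bullet> e / (e \<bullet> b)) *\<^sub>R b \<in> A}"
proof -
  have nb: "norm b = 1" using b by simp
  have bb: "b \<bullet> b = 1" using b by simp
  define R where "R = reflect (e - b)"
  have Rb: "R b = e" using e nb by (simp add: R_def reflect_swap)
  have RR: "R (R x) = x" for x by (simp add: R_def)
  have Rl: "R x \<bullet> y = x \<bullet> R y" for x y by (simp add: R_def inner_reflect_left)
  have Re: "R e = b" using Rb RR by metis
  have [measurable]: "R \<in> borel \<rightarrow>\<^sub>M borel" by (simp add: R_def)
  define p where "p = drop_coord b e"
  define z where "z x = x - ((x - x0) \<bullet> e / (e \<bullet> b)) *\<^sub>R b" for x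
  have [measurable]: "z \<in> borel \<rightarrow>\<^sub>M borel" unfolding z_def by measurable
  define B where "B = {y. x0 + R y \<in> A \<and> y \<bullet> b = 0}"
  have [measurable]: "B \<in> sets borel" unfolding B_def by measurable
  have Beq: "A = (\<lambda>y. x0 + R y) ` B"
  proof safe
    fix x assume x: "x \<in> A"
    have "R (x - x0) \<bullet> b = 0" using Ae[OF x] by (simp add: Rl Rb)
    then have "R (x - x0) \<in> B" using x by (simp add: B_def RR)
    moreover have "x = x0 + R (R (x - x0))" by (simp add: RR)
    ultimately show "x \<in> (\<lambda>y. x0 + R y) ` B" by blast
  qed (auto simp: B_def)
  have "emeasure h A = emeasure h B"
    unfolding Beq
  proof (rule emeasure_h_isometry)
    show "(\<lambda>y. x0 + R y) ` B \<in> sets borel" by (simp flip: Beq)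
    show "dist (x0 + R x) (x0 + R y) = dist x y" for x y
      by (simp add: dist_norm R_def flip: reflect_diff)
  qed simp
  also have "\<dots> = emeasure h (plane_cube b) * emeasure lborel {x \<in> slab b. drop_coord b x \<in> B}"
    using b by (intro emeasure_h_coord_plane) (auto simp: B_def)
  finally have 1: "emeasure h A = emeasure h (plane_cube b) * emeasure lborel {x \<in> slab b. drop_coord b x \<in> B}" .
  \<comment> \<open>\<open>T\<close> is what the reflection \<open>R\<close>, followed by projection
    along \<open>b\<close>, does on the coordinate plane, with the \<open>b\<close>-coordinate left
    alone: |e - b|^2 = 2 (1 - e \<bullet> b) gives the denominator. It maps \<open>p\<close> to -(e
    \<bullet> b) \<open>p\<close> and fixes its orthogonal complement, so it scales volume by |e
    \<bullet> b|, the factor in the claim.\<close>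
  define T where "T x = x - ((x \<bullet> p) / (1 - e \<bullet> b)) *\<^sub>R p" for x
  have pp: "p \<bullet> p = 1 - (e \<bullet> b)\<^sup>2" "p \<bullet> b = 0"
    using e b by (auto simp: p_def drop_coord_def inner_diff_left inner_diff_right norm_eq_1 inner_commute power2_eq_square)
  \<comment> \<open>Both points lie in the plane through \<open>x0\<close> orthogonal to
    \<open>e\<close> and have the same projection along \<open>b\<close>; as e \<bullet> b is
    nonzero, they coincide.\<close>
  have key: "z (drop_coord b x0 + T x) = x0 + R (drop_coord b x)" for x
  proof -
    let ?d = "drop_coord b"
    have on: "(z y - x0) \<bullet> e = 0" for y
    proof -
      have "(y - q *\<^sub>R b - x0) \<bullet> e = (y - x0) \<bullet> e - q * (e \<bullet> b)" for q
        by (simp add: inner_diff_left inner_commute[of b e])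
      then have "(z y - x0) \<bullet> e = (y - x0) \<bullet> e - ((y - x0) \<bullet> e / (e \<bullet> b)) * (e \<bullet> b)"
        unfolding z_def .
      also have "\<dots> = 0" by (subst nonzero_eq_divide_eq[OF \<beta>, THEN iffD1, OF refl]) simp
      finally show ?thesis .
    qed
    have on': "(x0 + R (?d x) - x0) \<bullet> e = 0"
      using b by (simp add: Rl Re)
    have dz: "?d (z y) = ?d y" for y
      by (simp add: z_def drop_coord_def inner_diff_left bb algebra_simps)
    have xp: "x \<bullet> p = ?d x \<bullet> e"
      by (simp add: p_def drop_coord_def inner_diff_left inner_diff_right inner_commute)
    have dT: "?d (T x) = ?d (R (?d x))"
    proof (cases "e = b")
      case True
      then show ?thesis
        using bb by (simp add: T_def R_def reflect_def p_def drop_coord_def inner_diff_left algebra_simps)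
    next
      case False
      have ee: "e \<bullet> e = 1" using e by (simp add: norm_eq_1)
      have ne: "1 - e \<bullet> b \<noteq> 0"
      proof
        assume "1 - e \<bullet> b = 0"
        then have "(e - b) \<bullet> (e - b) = 0" by (simp add: inner_diff_left inner_diff_right inner_commute bb ee)
        then show False using False by simp
      qed
      have "(e - b) \<bullet> (e - b) = 2 * (1 - e \<bullet> b)"
        by (simp add: inner_diff_left inner_diff_right inner_commute bb ee)
      moreover have "?d x \<bullet> (e - b) = x \<bullet> p" using b by (simp add: xp inner_diff_right)
      ultimately have "R (?d x) = ?d x - ((x \<bullet> p) / (1 - e \<bullet> b)) *\<^sub>R (e - b)"
        by (simp only: R_def reflect_def mult_divide_mult_cancel_left_if) simp
      moreover have "?d (e - b) = p" using bb by (simp add: p_def drop_coord_def inner_diff_left algebra_simps)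
      ultimately have "?d (R (?d x)) = ?d (?d x) - ((x \<bullet> p) / (1 - e \<bullet> b)) *\<^sub>R p"
        using drop_coord_add[of b "?d x" "- ((x \<bullet> p) / (1 - e \<bullet> b)) *\<^sub>R (e - b)"]
          drop_coord_scaleR[of b "- ((x \<bullet> p) / (1 - e \<bullet> b))" "e - b"] by simp
      moreover have "?d (?d x) = ?d x" using b by (intro drop_coord_idem) simp
      moreover have "?d (T x) = ?d x - ((x \<bullet> p) / (1 - e \<bullet> b)) *\<^sub>R p"
        using pp by (simp add: T_def drop_coord_def inner_diff_left algebra_simps)
      ultimately show ?thesis by simp
    qed
    have "?d (z (?d x0 + T x)) = ?d (x0 + R (?d x))"
      using b by (simp add: dz drop_coord_add dT drop_coord_idem)
    then obtain t where t: "z (?d x0 + T x) = x0 + R (?d x) + t *\<^sub>R b"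
      unfolding drop_coord_def[of b "z _"] drop_coord_def[of b "x0 + _"]
      by (metis (no_types, lifting) add.commute add_diff_eq diff_add_cancel scaleR_left_diff_distrib diff_diff_eq2)
    have "t * (e \<bullet> b) = 0"
      using on[of "?d x0 + T x"] on' unfolding t by (simp add: inner_add_left inner_commute[of b e])
    then show ?thesis using t \<beta> by simp
  qed
  have "emeasure lborel {x \<in> slab b. z x \<in> A} = (\<integral>\<^sup>+x. indicator {x \<in> slab b. z x \<in> A} x \<partial>lborel)"
    by simp
  also have "\<dots> = (\<integral>\<^sup>+x. indicator {x \<in> slab b. z x \<in> A} (x + drop_coord b x0) \<partial>lborel)"
    by (rule nn_integral_lborel_translate[symmetric]) measurable
  also have "\<dots> = ennreal \<bar>e \<bullet> b\<bar> * (\<integral>\<^sup>+x. indicator {x \<in> slab b. z x \<in> A} (T x + drop_coord b x0) \<partial>lborel)"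
  \<comment> \<open>\<open>p = 0\<close> means that \<open>e\<close> is \<open>b\<close> or
    \<open>-b\<close>. Then \<open>T\<close> is the identity; for \<open>e = b\<close> its quotient
    is a division by zero, multiplied by the zero vector.\<close>
  proof (cases "p = 0")
    case True
    then have "\<bar>e \<bullet> b\<bar> = 1" using pp by (auto simp: power2_eq_1_iff)
    then show ?thesis using True by (simp add: T_def)
  next
    case False
    define u where "u = (1 / norm p) *\<^sub>R p"
    have u: "norm u = 1" using False by (simp add: u_def)
    have ne: "1 - e \<bullet> b \<noteq> 0" using pp False by auto
    have Teq: "x + ((- (e \<bullet> b) - 1) * (x \<bullet> u)) *\<^sub>R u = T x" for x
    proof -
      have pn: "norm p * norm p = (1 - e \<bullet> b) * (1 + e \<bullet> b)"
        using pp(1) by (simp add: power2_eq_square algebra_simps flip: power2_norm_eq_inner)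
      have "(- (e \<bullet> b) - 1) * (x \<bullet> u) * (1 / norm p) = (- (e \<bullet> b) - 1) * (x \<bullet> p) / (norm p * norm p)"
        by (simp add: u_def)
      also have "\<dots> = - ((x \<bullet> p) / (1 - e \<bullet> b))"
      proof -
        have "norm p * norm p \<noteq> 0" using False by simp
        then have "1 + e \<bullet> b \<noteq> 0" unfolding pn by auto
        then show ?thesis unfolding pn using ne by (simp add: divide_simps) (simp add: algebra_simps)
      qed
      finally have "((- (e \<bullet> b) - 1) * (x \<bullet> u)) *\<^sub>R u = (- ((x \<bullet> p) / (1 - e \<bullet> b))) *\<^sub>R p"
        by (simp add: u_def)
      then show ?thesis by (simp add: T_def)
    qed
    show ?thesis
      using nn_integral_lborel_stretch[of "\<lambda>x. indicator {x \<in> slab b. z x \<in> A} (x + drop_coord b x0)" u "- (e \<bullet> b)"]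
        u \<beta> by (simp add: Teq)
  qed
  also have "(\<integral>\<^sup>+x. indicator {x \<in> slab b. z x \<in> A} (T x + drop_coord b x0) \<partial>lborel) =
      (\<integral>\<^sup>+x. indicator {x \<in> slab b. drop_coord b x \<in> B} x \<partial>lborel)"
  proof (rule nn_integral_cong)
    fix x
    have "T x + drop_coord b x0 \<in> slab b \<longleftrightarrow> x \<in> slab b"
      using b pp by (simp add: slab_def T_def inner_add_left inner_diff_left)
    then show "indicator {x \<in> slab b. z x \<in> A} (T x + drop_coord b x0) =
        (indicator {x \<in> slab b. drop_coord b x \<in> B} x :: ennreal)"
      using key[of x] b by (auto simp: B_def add.commute split: split_indicator)
  qed
  also have "\<dots> = emeasure lborel {x \<in> slab b. drop_coord b x \<in> B}"
    by simp
  finally have 2: "emeasure lborel {x \<in> slab b. z x \<in> A} =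
      ennreal \<bar>e \<bullet> b\<bar> * emeasure lborel {x \<in> slab b. drop_coord b x \<in> B}" .
  show ?thesis
    unfolding 1 2[unfolded z_def] by (simp add: ac_simps)
qed

end

section \<open>The area formula for graphs\<close>

text \<open>By the Lindelof property countably many of the neighbourhoods cover \<open>W\<close>.
  Made disjoint, they cut \<open>A\<close> into pieces on which the local inequality holds, and
  these inequalities add up.\<close>

lemma emeasure_le_if_locally_le:
  fixes \<mu> \<kappa> :: "'a::euclidean_space measure"
  assumes [simp]: "sets \<mu> = sets borel" "sets \<kappa> = sets borel"
    and loc: "\<And>x. x \<in> W \<Longrightarrow> \<exists>U. open U \<and> x \<in> U \<and>
        (\<forall>A\<in>sets borel. A \<subseteq> W \<inter> U \<longrightarrow> emeasure \<mu> A \<le> K * emeasure \<kappa> A)"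
    and A: "A \<in> sets borel" "A \<subseteq> W"
  shows "emeasure \<mu> A \<le> K * emeasure \<kappa> A"
proof (cases "W = {}")
  case True
  then show ?thesis using A by auto
next
  case False
  obtain U where U: "\<And>x. x \<in> W \<Longrightarrow> open (U x)" "\<And>x. x \<in> W \<Longrightarrow> x \<in> U x"
    "\<And>x A. x \<in> W \<Longrightarrow> A \<in> sets borel \<Longrightarrow> A \<subseteq> W \<inter> U x \<Longrightarrow> emeasure \<mu> A \<le> K * emeasure \<kappa> A"
    using loc by metis
  obtain F where F: "F \<subseteq> U ` W" "countable F" "\<Union>F = \<Union>(U ` W)"
    using Lindelof[of "U ` W"] U(1) by blast
  have "F \<noteq> {}" using F(3) False U(2) by blast
  define G where "G = from_nat_into F"
  have rangeG: "range G = F"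
    unfolding G_def by (rule range_from_nat_into[OF \<open>F \<noteq> {}\<close> F(2)])
  have G: "\<exists>x\<in>W. G i = U x" for i
    using rangeG F(1) by blast
  have opG: "G i \<in> sets borel" for i
    using G[of i] U(1) by auto
  define B where "B i = A \<inter> disjointed G i" for i
  have Bs: "B i \<in> sets borel" for i
    unfolding B_def using A opG sets.range_disjointed_sets[of G borel] by (auto intro!: sets.Int)
  have AB: "A = (\<Union>i. B i)"
  proof -
    have "A \<subseteq> (\<Union>i. G i)" using A F(3) U(2) rangeG by blast
    then have "A \<subseteq> (\<Union>i. disjointed G i)" by (simp only: UN_disjointed_eq)
    then show ?thesis unfolding B_def by blast
  qed
  have dis: "disjoint_family B"
    unfolding B_def using disjoint_family_disjointed[of G] by (auto simp: disjoint_family_on_def)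
  have "emeasure \<mu> A = (\<Sum>i. emeasure \<mu> (B i))"
    unfolding AB using Bs by (intro suminf_emeasure[symmetric] dis) auto
  also have "\<dots> \<le> (\<Sum>i. K * emeasure \<kappa> (B i))"
  proof (rule suminf_le)
    fix i
    obtain x where "x \<in> W" "G i = U x" using G by blast
    then show "emeasure \<mu> (B i) \<le> K * emeasure \<kappa> (B i)"
      using U(3)[of x "B i"] Bs A disjointed_subset[of G i] by (auto simp: B_def)
  qed auto
  also have "\<dots> = K * (\<Sum>i. emeasure \<kappa> (B i))"
    by (rule ennreal_suminf_cmult)
  also have "(\<Sum>i. emeasure \<kappa> (B i)) = emeasure \<kappa> A"
    unfolding AB using Bs by (intro suminf_emeasure dis) auto
  finally show ?thesis .
qed

lemma ennreal_le_if_le_mult: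
  fixes a b :: ennreal
  assumes "\<And>K::real. K > 1 \<Longrightarrow> a \<le> ennreal K * b"
  shows "a \<le> b"
proof (cases "b = \<infinity>")
  case False
  then obtain r where r: "b = ennreal r" "r \<ge> 0" by (cases b) auto
  have "a \<le> ennreal (2 * r)" using assms[of 2] r by (simp add: ennreal_mult)
  then obtain q where q: "a = ennreal q" "q \<ge> 0" by (cases a) (auto simp: top_unique)
  have "q \<le> r"
  proof (rule field_le_mult_one_interval)
    fix z :: real assume z: "0 < z" "z < 1"
    have "ennreal q \<le> ennreal (1 / z) * ennreal r"
      using assms[of "1 / z"] z q r by simp
    then have "q \<le> 1 / z * r"
      using z r by (simp flip: ennreal_mult)
    then show "z * q \<le> r" using z by (simp add: field_simps)
  qed
  then show ?thesis using q r by (simp add: ennreal_leI)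
qed simp

text \<open>The part of \<open>M\<close> in \<open>V\<close> is a graph over the coordinate plane orthogonal to \<open>b\<close>, and \<open>\<pi>\<close>
  is the projection onto it along \<open>b\<close>, defined on the cylinder \<open>D\<close> over that graph.\<close>
locale graph_chart =
  fixes M V D :: "'a::euclidean_space set" and N \<pi> :: "'a \<Rightarrow> 'a" and b :: 'a
  assumes b: "b \<in> Basis"
    and openV: "open V" and openD: "open D"
    and pi_borel [measurable]: "\<pi> \<in> borel_measurable borel"
    and D_drop: "\<And>x. drop_coord b x \<in> D \<longleftrightarrow> x \<in> D"
    and pi_drop: "\<And>x. \<pi> (drop_coord b x) = \<pi> x"
    and pi_mem: "\<And>x. x \<in> D \<Longrightarrow> \<pi> x \<in> M \<inter> V"
    and drop_pi: "\<And>x. x \<in> D \<Longrightarrow> drop_coord b (\<pi> x) = drop_coord b x"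
    and mem_D: "\<And>x. x \<in> M \<inter> V \<Longrightarrow> x \<in> D"
    and pi_id: "\<And>x. x \<in> M \<inter> V \<Longrightarrow> \<pi> x = x"
    and norm_N: "\<And>x. x \<in> M \<inter> V \<Longrightarrow> norm (N x) = 1"
    and N_b: "\<And>x. x \<in> M \<inter> V \<Longrightarrow> N x \<bullet> b \<noteq> 0"
    and cont_N: "continuous_on (M \<inter> V) N"
    and deriv_pi: "\<And>x. x \<in> D \<Longrightarrow> (\<pi> has_derivative (\<lambda>v. v - (v \<bullet> N (\<pi> x) / (b \<bullet> N (\<pi> x))) *\<^sub>R b)) (at x)"
    and tangent: "\<And>x \<epsilon>. x \<in> M \<inter> V \<Longrightarrow> \<epsilon> > 0 \<Longrightarrow>
        \<exists>r>0. \<forall>y\<in>M \<inter> V \<inter> ball x r. \<forall>z\<in>M \<inter> V \<inter> ball x r. \<bar>(y - z) \<bullet> N x\<bar> \<le> \<epsilon> * norm (y - z)"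
begin

lemma borel_D [measurable]: "D \<in> sets borel"
  using openD by simp

lemma borel_MV [measurable]: "M \<inter> V \<in> sets borel"
proof -
  have "M \<inter> V = {x \<in> D. \<pi> x = x}"
    using mem_D pi_id pi_mem by (force simp: set_eq_iff)
  also have "\<dots> \<in> sets borel" by measurable
  finally show ?thesis .
qed

text \<open>The Jacobian of the projection along \<open>b\<close> restricted to \<open>M\<close>,
  extended by 0.\<close>

definition weight :: "'a \<Rightarrow> real" where
  "weight x = indicator (M \<inter> V) x * \<bar>N x \<bullet> b\<bar>"

lemma weight_nonneg [simp]: "weight x \<ge> 0"
  by (simp add: weight_def)

lemma weight_borel [measurable]: "weight \<in> borel_measurable borel"
proof -
  have "(\<lambda>x. indicator (M \<inter> V) x *\<^sub>R \<bar>N x \<bullet> b\<bar>) \<in> borel_measurable borel"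
    by (intro borel_measurable_continuous_on_indicator continuous_intros cont_N) measurable
  then show ?thesis by (simp add: weight_def[abs_def])
qed

text \<open>Lebesgue measure of the coordinate plane, realised as slab volume, lifted to the graph
  by \<pi>.\<close>

definition graph_measure :: "'a measure" where
  "graph_measure = distr (density lborel (indicator (slab b \<inter> D))) borel \<pi>"

lemma sets_graph_measure [simp, measurable_cong]: "sets graph_measure = sets borel"
  by (simp add: graph_measure_def)

lemma emeasure_graph_measure:
  assumes [measurable]: "A \<in> sets borel"
  shows "emeasure graph_measure A = emeasure lborel {x \<in> slab b. x \<in> D \<and> \<pi> x \<in> A}"
proof -
  have "emeasure graph_measure A = (\<integral>\<^sup>+x. indicator (slab b \<inter> D) x * indicator (\<pi> -` A) x \<partial>lborel)"
    unfolding graph_measure_def using measurable_sets[OF pi_borel assms]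
    by (subst emeasure_distr) (auto simp: emeasure_density)
  also have "\<dots> = (\<integral>\<^sup>+x. indicator {x \<in> slab b. x \<in> D \<and> \<pi> x \<in> A} x \<partial>lborel)"
    by (rule nn_integral_cong) (auto split: split_indicator)
  finally show ?thesis by simp
qed

lemma emeasure_weight:
  fixes h :: "'a measure"
  assumes h: "sets h = sets borel" and A: "A \<in> sets borel" "A \<subseteq> M \<inter> V"
    and lr: "\<And>x. x \<in> A \<Longrightarrow> l \<le> \<bar>N x \<bullet> b\<bar>" "\<And>x. x \<in> A \<Longrightarrow> \<bar>N x \<bullet> b\<bar> \<le> r" and "0 \<le> l" "0 \<le> r"
  shows "ennreal l * emeasure h A \<le> emeasure (density h weight) A"
    and "emeasure (density h weight) A \<le> ennreal r * emeasure h A"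
proof -
  note [measurable_cong] = h
  note [measurable] = A(1)
  have eq: "emeasure (density h weight) A = (\<integral>\<^sup>+x. ennreal (weight x) * indicator A x \<partial>h)"
    by (rule emeasure_density) measurable
  have c: "(\<integral>\<^sup>+x. ennreal t * indicator A x \<partial>h) = ennreal t * emeasure h A" for t
    by (rule nn_integral_cmult_indicator) measurable
  show "ennreal l * emeasure h A \<le> emeasure (density h weight) A"
    unfolding eq c[symmetric]
    using lr A(2) by (intro nn_integral_mono) (auto simp: weight_def ennreal_leI split: split_indicator)
  show "emeasure (density h weight) A \<le> ennreal r * emeasure h A"
    unfolding eq c[symmetric]
    using lr A(2) by (intro nn_integral_mono) (auto simp: weight_def ennreal_leI split: split_indicator)
qed

end

locale hausdorff_graph = graph_chart M V D N \<pi> b + hausdorff_space h n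
  for M V D :: "'a::euclidean_space set" and N \<pi> :: "'a \<Rightarrow> 'a" and b :: 'a
    and h :: "'a measure" and n :: nat
begin

definition plane_const :: real where
  "plane_const = enn2real (emeasure h (plane_cube b))"

lemma emeasure_plane_cube: "emeasure h (plane_cube b) = ennreal plane_const"
  unfolding plane_const_def using emeasure_h_plane_cube_finite[OF b] by simp

lemma plane_const_nonneg [simp]: "plane_const \<ge> 0"
  by (simp add: plane_const_def)

text \<open>Near \<open>x0\<close> the projection along \<open>b\<close> onto the tangent plane at \<open>x0\<close> is almost isometric on \<open>M\<close>.\<close>
lemma area_formula_local:
  assumes x0: "x0 \<in> M \<inter> V" and K: "K > 1"
  shows "\<exists>U. open U \<and> x0 \<in> U \<and> (\<forall>A\<in>sets borel. A \<subseteq> M \<inter> V \<inter> U \<longrightarrow>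
      emeasure (density h weight) A \<le> ennreal K * (ennreal plane_const * emeasure graph_measure A) \<and>
      ennreal plane_const * emeasure graph_measure A \<le> ennreal K * emeasure (density h weight) A)"
proof -
  define e where "e = N x0"
  define \<beta> where "\<beta> = e \<bullet> b"
  have e: "norm e = 1" and \<beta>: "\<beta> \<noteq> 0" using norm_N[OF x0] N_b[OF x0] by (auto simp: e_def \<beta>_def)
  have bb: "b \<bullet> b = 1" and nb: "norm b = 1" using b by auto
  \<comment> \<open>Two errors accumulate: L^n from comparing \<open>M\<close> with its tangent
    plane by a map that is Lipschitz in both directions, and one more \<open>L\<close> from the
    variation of |N \<bullet> b|. Together they give L^(n+1) = K.\<close>
  define L where "L = root (Suc n) K"
  have L: "L > 1" "L * L ^ n = K"
    using K real_root_pow_pos2[of "Suc n" K] by (auto simp: L_def)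
  \<comment> \<open>Then 1 - \<delta> = 1 / L and 1 + \<delta> \<le> L, so a map that alters
    differences by a relative error of at most \<delta> changes distances by a factor between 1 / L
    and L.\<close>
  define \<delta> where "\<delta> = 1 - 1 / L"
  have \<delta>: "\<delta> > 0" using L by (simp add: \<delta>_def)
  have L2: "1 + \<delta> \<le> L"
  proof -
    have "0 \<le> (L - 1)\<^sup>2" by simp
    then have "(1 + \<delta>) * L \<le> L * L" using L by (simp add: \<delta>_def power2_eq_square algebra_simps)
    then show ?thesis using L by simp
  qed
  obtain r where r: "r > 0" "\<And>y z. y \<in> M \<inter> V \<inter> ball x0 r \<Longrightarrow> z \<in> M \<inter> V \<inter> ball x0 r \<Longrightarrow>
      \<bar>(y - z) \<bullet> e\<bar> \<le> \<delta> * \<bar>\<beta>\<bar> * norm (y - z)"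
    using tangent[OF x0, of "\<delta> * \<bar>\<beta>\<bar>"] \<delta> \<beta> unfolding e_def by auto
  have "continuous_on (M \<inter> V) (\<lambda>x. \<bar>N x \<bullet> b\<bar>)"
    by (intro continuous_intros cont_N)
  moreover have "\<bar>\<beta>\<bar> * (L - 1) / L > 0" using \<beta> L by simp
  ultimately obtain r' where r': "r' > 0"
    "\<And>x. x \<in> M \<inter> V \<Longrightarrow> dist x x0 < r' \<Longrightarrow> dist \<bar>N x \<bullet> b\<bar> \<bar>\<beta>\<bar> < \<bar>\<beta>\<bar> * (L - 1) / L"
    unfolding continuous_on_iff using x0 unfolding \<beta>_def e_def by blast
  have bounds: "\<bar>\<beta>\<bar> / L \<le> \<bar>N x \<bullet> b\<bar>" "\<bar>N x \<bullet> b\<bar> \<le> L * \<bar>\<beta>\<bar>"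
    if "x \<in> M \<inter> V \<inter> ball x0 r'" for x
  proof -
    have *: "\<bar>\<bar>N x \<bullet> b\<bar> - \<bar>\<beta>\<bar>\<bar> < \<bar>\<beta>\<bar> * (L - 1) / L"
      using r'(2)[of x] that by (auto simp: dist_real_def dist_commute)
    have "\<bar>\<beta>\<bar> - \<bar>\<beta>\<bar> * (L - 1) / L = \<bar>\<beta>\<bar> / L" using L by (simp add: field_simps)
    then show "\<bar>\<beta>\<bar> / L \<le> \<bar>N x \<bullet> b\<bar>" using * by linarith
    have "\<bar>\<beta>\<bar> * (L - 1) / L \<le> \<bar>\<beta>\<bar> * (L - 1) / 1"
      using L by (intro divide_left_mono) auto
    then have "\<bar>N x \<bullet> b\<bar> \<le> \<bar>\<beta>\<bar> + \<bar>\<beta>\<bar> * (L - 1)" using * by linarith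
    then show "\<bar>N x \<bullet> b\<bar> \<le> L * \<bar>\<beta>\<bar>" by (simp add: algebra_simps)
  qed
  define z where "z x = x - ((x - x0) \<bullet> e / \<beta>) *\<^sub>R b" for x
  have [measurable]: "z \<in> borel \<rightarrow>\<^sub>M borel" unfolding z_def by measurable
  have on_plane: "(z x - x0) \<bullet> e = 0" for x
  proof -
    have "(x - q *\<^sub>R b - x0) \<bullet> e = (x - x0) \<bullet> e - q * \<beta>" for q
      by (simp add: inner_diff_left \<beta>_def inner_commute[of b e])
    then show ?thesis using \<beta> by (simp add: z_def)
  qed
  have z_id: "z x = x" if "(x - x0) \<bullet> e = 0" for x
    using that by (simp add: z_def)
  have drop_z: "drop_coord b (z x) = drop_coord b x" for x
    by (simp add: z_def drop_coord_def inner_diff_left bb algebra_simps)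
  have z_cong: "z x = z y" if "drop_coord b x = drop_coord b y" for x y
  proof -
    have "x = y + (x \<bullet> b - y \<bullet> b) *\<^sub>R b"
      using that by (simp add: drop_coord_def algebra_simps)
    then obtain t where x: "x = y + t *\<^sub>R b" by blast
    have "(x - x0) \<bullet> e / \<beta> = (y - x0) \<bullet> e / \<beta> + t"
      using \<beta> by (simp add: x inner_add_left inner_diff_left \<beta>_def inner_commute[of b e] add_divide_distrib diff_divide_distrib)
    then show ?thesis by (simp add: z_def x algebra_simps)
  qed
  have lip: "dist (z x) (z y) \<le> L * dist x y" "dist x y \<le> L * dist (z x) (z y)"
    if "x \<in> M \<inter> V \<inter> ball x0 r" "y \<in> M \<inter> V \<inter> ball x0 r" for x y
  proof -
    have "z x - z y = (x - y) - ((x - y) \<bullet> e / \<beta>) *\<^sub>R b"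
      by (simp add: z_def inner_diff_left diff_divide_distrib algebra_simps)
    moreover have "norm (((x - y) \<bullet> e / \<beta>) *\<^sub>R b) \<le> \<delta> * norm (x - y)"
      using r(2)[OF that] \<beta> nb by (simp add: divide_le_eq ac_simps)
    ultimately have "norm ((z x - z y) - (x - y)) \<le> \<delta> * norm (x - y)"
      by (simp add: norm_minus_commute)
    then have *: "norm (z x - z y) \<le> norm (x - y) + \<delta> * norm (x - y)"
       "norm (x - y) \<le> norm (z x - z y) + \<delta> * norm (x - y)"
      using norm_triangle_sub[of "z x - z y" "x - y"] norm_triangle_sub[of "x - y" "z x - z y"]
      by (auto simp: norm_minus_commute)
    have "norm (z x - z y) \<le> (1 + \<delta>) * norm (x - y)" using *(1) by (simp add: algebra_simps)
    also have "\<dots> \<le> L * norm (x - y)" using L2 by (intro mult_right_mono) auto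
    finally show "dist (z x) (z y) \<le> L * dist x y" by (simp add: dist_norm)
    have "norm (x - y) / L \<le> norm (z x - z y)" using *(2) by (simp add: \<delta>_def algebra_simps)
    then show "dist x y \<le> L * dist (z x) (z y)" using L by (simp add: dist_norm field_simps)
  qed
  show ?thesis
  proof (intro exI[of _ "ball x0 (min r r')"] conjI ballI impI)
    show "x0 \<in> ball x0 (min r r')" using r r' by simp
    fix A :: "'a set" assume A[measurable]: "A \<in> sets borel" and sub: "A \<subseteq> M \<inter> V \<inter> ball x0 (min r r')"
    have A1: "x \<in> M \<inter> V \<inter> ball x0 r" "x \<in> M \<inter> V \<inter> ball x0 r'" if "x \<in> A" for x
      using sub that by auto
    have AMV: "A \<subseteq> M \<inter> V" using sub by auto
    have D_pi_iff: "x \<in> D \<and> \<pi> x \<in> A \<longleftrightarrow> (\<exists>a\<in>A. drop_coord b x = drop_coord b a)" for x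
    proof
      assume "x \<in> D \<and> \<pi> x \<in> A"
      then show "\<exists>a\<in>A. drop_coord b x = drop_coord b a" using drop_pi by metis
    next
      assume "\<exists>a\<in>A. drop_coord b x = drop_coord b a"
      then obtain a where a: "a \<in> A" "drop_coord b x = drop_coord b a" by blast
      then have "a \<in> D" "\<pi> a = a" using AMV mem_D pi_id by blast+
      moreover have "x \<in> D" using D_drop a \<open>a \<in> D\<close> by metis
      moreover have "\<pi> x = \<pi> a" using pi_drop a by metis
      ultimately show "x \<in> D \<and> \<pi> x \<in> A" using a by simp
    qed
    have pi_z: "\<pi> (z a) = a" if "a \<in> A" for a
      using pi_drop drop_z pi_id AMV that by (metis subsetD)
    \<comment> \<open>Writing the image as a set of points of the plane that \<pi> sends into
      \<open>A\<close> shows that it is Borel.\<close>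
    have zA: "z ` A = {w. (w - x0) \<bullet> e = 0 \<and> w \<in> D \<and> \<pi> w \<in> A}"
    proof safe
      fix a assume a: "a \<in> A"
      show "(z a - x0) \<bullet> e = 0" by (rule on_plane)
      show "z a \<in> D" "\<pi> (z a) \<in> A" using D_pi_iff[of "z a"] drop_z a by auto
    next
      fix w assume w: "(w - x0) \<bullet> e = 0" "w \<in> D" "\<pi> w \<in> A"
      have "w = z (\<pi> w)"
        using z_id[OF w(1)] z_cong[of w "\<pi> w"] drop_pi[OF w(2)] by simp
      then show "w \<in> z ` A" using w by blast
    qed
    have zA_borel[measurable]: "z ` A \<in> sets borel"
      unfolding zA by measurable
    have "{x \<in> slab b. z x \<in> z ` A} = {x \<in> slab b. x \<in> D \<and> \<pi> x \<in> A}"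
    proof -
      have "z x \<in> z ` A \<longleftrightarrow> x \<in> D \<and> \<pi> x \<in> A" for x
        unfolding D_pi_iff using z_cong drop_z by (metis (no_types, lifting) image_iff)
      then show ?thesis by simp
    qed
    then have plane: "ennreal \<bar>\<beta>\<bar> * emeasure h (z ` A) = ennreal plane_const * emeasure graph_measure A"
      using emeasure_h_plane[OF b e, of "z ` A" x0] \<beta> on_plane zA_borel
      by (simp add: \<beta>_def[symmetric] z_def[symmetric] emeasure_graph_measure emeasure_plane_cube image_iff)
         (metis (no_types, lifting) \<open>\<And>x. (z x - x0) \<bullet> e = 0\<close>)
    have l1: "emeasure h (z ` A) \<le> ennreal (L ^ n) * emeasure h A"
      using L lip A1 by (intro emeasure_h_lipschitz) auto
    have piz: "\<pi> ` z ` A = A" using pi_z by (force simp: image_iff)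
    have l2: "emeasure h A \<le> ennreal (L ^ n) * emeasure h (z ` A)"
    proof -
      have "emeasure h (\<pi> ` z ` A) \<le> ennreal (L ^ n) * emeasure h (z ` A)"
        using L lip A1 by (intro emeasure_h_lipschitz) (auto simp: piz pi_z)
      then show ?thesis by (simp add: piz)
    qed
    have "emeasure (density h weight) A \<le> ennreal (L * \<bar>\<beta>\<bar>) * emeasure h A"
      using bounds A1 L by (intro emeasure_weight[where l = 0] A AMV) auto
    also have "\<dots> \<le> ennreal (L * \<bar>\<beta>\<bar>) * (ennreal (L ^ n) * emeasure h (z ` A))"
      by (intro mult_left_mono l2) auto
    also have "\<dots> = ennreal K * (ennreal \<bar>\<beta>\<bar> * emeasure h (z ` A))"
      using L by (simp add: L(2)[symmetric] ennreal_mult ac_simps)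
    finally show "emeasure (density h weight) A \<le> ennreal K * (ennreal plane_const * emeasure graph_measure A)"
      unfolding plane .
    have "ennreal plane_const * emeasure graph_measure A \<le> ennreal \<bar>\<beta>\<bar> * (ennreal (L ^ n) * emeasure h A)"
      unfolding plane[symmetric] by (intro mult_left_mono l1) auto
    also have "\<dots> = ennreal K * (ennreal (\<bar>\<beta>\<bar> / L) * emeasure h A)"
    proof -
      have "ennreal K * ennreal (\<bar>\<beta>\<bar> / L) = ennreal (K * (\<bar>\<beta>\<bar> / L))"
        using L K by (intro ennreal_mult[symmetric]) auto
      also have "K * (\<bar>\<beta>\<bar> / L) = \<bar>\<beta>\<bar> * L ^ n" using L by (simp add: L(2)[symmetric])
      also have "ennreal (\<bar>\<beta>\<bar> * L ^ n) = ennreal \<bar>\<beta>\<bar> * ennreal (L ^ n)" using L by (simp add: ennreal_mult)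
      finally show ?thesis by (simp add: mult.assoc[symmetric])
    qed
    also have "\<dots> \<le> ennreal K * emeasure (density h weight) A"
      using bounds A1 L by (intro mult_left_mono emeasure_weight[where r = "L * \<bar>\<beta>\<bar>"] A AMV) auto
    finally show "ennreal plane_const * emeasure graph_measure A \<le> ennreal K * emeasure (density h weight) A" .
  qed simp
qed

text \<open>Both measures are concentrated on \<open>M \<inter> V\<close>. There they agree locally
  up to any factor K > 1; the local inequalities globalise, and K is then sent to 1.\<close>

lemma area_formula:
  "density h weight = density graph_measure (\<lambda>_. ennreal plane_const)"
proof (rule measure_eqI)
  fix A assume "A \<in> sets (density h weight)"
  then have A[measurable]: "A \<in> sets borel" by simp
  let ?m = "density graph_measure (\<lambda>_. ennreal plane_const)"
  have em: "emeasure ?m B = ennreal plane_const * emeasure graph_measure B" if [measurable]: "B \<in> sets borel" for B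
    by (subst emeasure_density) (auto simp: nn_integral_cmult_indicator)
  define A' where "A' = A \<inter> (M \<inter> V)"
  have A'[measurable]: "A' \<in> sets borel" unfolding A'_def by measurable
  have 1: "emeasure (density h weight) A = emeasure (density h weight) A'"
  proof -
    have "emeasure (density h weight) A = (\<integral>\<^sup>+x. ennreal (weight x) * indicator A x \<partial>h)"
      by (rule emeasure_density) measurable
    also have "\<dots> = (\<integral>\<^sup>+x. ennreal (weight x) * indicator A' x \<partial>h)"
      by (rule nn_integral_cong) (auto simp: A'_def weight_def split: split_indicator)
    also have "\<dots> = emeasure (density h weight) A'"
      by (rule emeasure_density[symmetric]) measurable
    finally show ?thesis .
  qed
  have 2: "emeasure ?m A = emeasure ?m A'"
    using pi_mem by (simp add: em emeasure_graph_measure)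
      (rule arg_cong[where f = "\<lambda>S. ennreal plane_const * emeasure lborel S"], auto simp: A'_def)
  have "emeasure (density h weight) A' = emeasure ?m A'"
  proof (rule antisym; rule ennreal_le_if_le_mult)
    fix K :: real assume K: "K > 1"
    show "emeasure (density h weight) A' \<le> ennreal K * emeasure ?m A'"
    proof (rule emeasure_le_if_locally_le[where W = "M \<inter> V"])
      fix x0 assume "x0 \<in> M \<inter> V"
      from area_formula_local[OF this K] show "\<exists>U. open U \<and> x0 \<in> U \<and>
          (\<forall>A\<in>sets borel. A \<subseteq> M \<inter> V \<inter> U \<longrightarrow> emeasure (density h weight) A \<le> ennreal K * emeasure ?m A)"
        by (metis em)
    qed (auto simp: A'_def)
    show "emeasure ?m A' \<le> ennreal K * emeasure (density h weight) A'"
    proof (rule emeasure_le_if_locally_le[where W = "M \<inter> V"])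
      fix x0 assume "x0 \<in> M \<inter> V"
      from area_formula_local[OF this K] show "\<exists>U. open U \<and> x0 \<in> U \<and>
          (\<forall>A\<in>sets borel. A \<subseteq> M \<inter> V \<inter> U \<longrightarrow> emeasure ?m A \<le> ennreal K * emeasure (density h weight) A)"
        by (metis em)
    qed (auto simp: A'_def)
  qed
  then show "emeasure (density h weight) A = emeasure ?m A"
    using 1 2 by simp
qed simp

text \<open>Dividing \<open>f\<close> by the Jacobian turns an integral against \<open>h\<close>
  into one against the weighted measure, which the area formula identifies with a slab
  integral.\<close>

lemma has_bochner_integral_graph:
  fixes f :: "'a \<Rightarrow> real"
  assumes [measurable]: "f \<in> borel_measurable borel"
    and f0: "\<And>x. x \<notin> M \<inter> V \<Longrightarrow> f x = 0"
    and int: "has_bochner_integral lborel (\<lambda>x. indicator (slab b \<inter> D) x * (f (\<pi> x) / \<bar>N (\<pi> x) \<bullet> b\<bar>)) I"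
  shows "has_bochner_integral h f (plane_const * I)"
proof -
  \<comment> \<open>\<open>weight\<close> is nonzero on \<open>M \<inter> V\<close>, and off this
    set \<open>f\<close> vanishes too, so division by zero does no harm.\<close>
  define g where "g x = f x / weight x" for x
  have [measurable]: "g \<in> borel_measurable borel" unfolding g_def by measurable
  have gf: "weight x * g x = f x" for x
  proof (cases "x \<in> M \<inter> V")
    case True
    then show ?thesis using N_b[OF True] by (simp add: g_def weight_def)
  qed (simp add: g_def weight_def f0)
  have gpi: "indicator (slab b \<inter> D) x * g (\<pi> x) = indicator (slab b \<inter> D) x * (f (\<pi> x) / \<bar>N (\<pi> x) \<bullet> b\<bar>)" for x
    using pi_mem[of x] by (auto simp: g_def weight_def split: split_indicator)
  have "has_bochner_integral (density lborel (\<lambda>x. ennreal (indicator (slab b \<inter> D) x))) (\<lambda>x. g (\<pi> x)) I"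
    using int by (intro has_bochner_integral_density) (auto simp: gpi)
  moreover have "(\<lambda>x. ennreal (indicator (slab b \<inter> D) x)) = indicator (slab b \<inter> D)"
    by (auto split: split_indicator)
  ultimately have "has_bochner_integral graph_measure g I"
    unfolding graph_measure_def by (intro has_bochner_integral_distr) auto
  then have "has_bochner_integral graph_measure (\<lambda>x. plane_const *\<^sub>R g x) (plane_const * I)"
    using has_bochner_integral_mult_right[of plane_const graph_measure g I] by auto
  then have "has_bochner_integral (density h weight) g (plane_const * I)"
    unfolding area_formula by (intro has_bochner_integral_density) auto
  then show ?thesis
    by (simp add: has_bochner_integral_iff integrable_density integral_density gf)
qed

end

section \<open>Integration by parts and the divergence on a graph\<close>

lemma integral_lborel_translate:
  fixes f :: "'a::euclidean_space \<Rightarrow> real"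
  assumes "integrable lborel f"
  shows "has_bochner_integral lborel (\<lambda>x. f (x + v)) (\<integral>x. f x \<partial>lborel)"
proof -
  have [measurable]: "f \<in> borel_measurable borel"
    using borel_measurable_integrable[OF assms] by simp
  have "has_bochner_integral (distr lborel borel ((+) v)) f (\<integral>x. f x \<partial>lborel)"
    unfolding lborel_distr_plus using assms by (rule has_bochner_integral_integrable)
  then have "has_bochner_integral lborel (\<lambda>x. f (v + x)) (\<integral>x. f x \<partial>lborel)"
    by (simp add: has_bochner_integral_iff integrable_distr_eq integral_distr)
  then show ?thesis by (simp add: add.commute)
qed

text \<open>The slab is invariant under translation along \<open>i\<close>, so every difference
  quotient in that direction integrates to 0 over it. By the mean value theorem the quotients are
  bounded by \<open>C\<close>, with supports in a fixed ball, and dominated convergence passes to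
  the derivative; its measurability comes from the same limit.\<close>

lemma has_integral_directional_derivative_slab:
  fixes f :: "'a::euclidean_space \<Rightarrow> real"
  assumes der: "\<And>x. (f has_derivative f' x) (at x)"
    and bound: "\<And>x. \<bar>f' x i\<bar> \<le> C"
    and i: "i \<in> Basis" "i \<bullet> b = 0"
    and supp: "\<And>x. x \<in> slab b \<Longrightarrow> norm x > R \<Longrightarrow> f x = 0"
  shows "has_bochner_integral lborel (\<lambda>x. indicator (slab b) x * f' x i) 0"
proof -
  have cont: "continuous_on UNIV f"
    using der by (meson continuous_at_imp_continuous_on has_derivative_continuous)
  then have [measurable]: "f \<in> borel_measurable borel"
    by (rule borel_measurable_continuous_onI)
  have int: "integrable lborel (\<lambda>x. indicator (slab b) x * f x)"
  proof -
    have "closed (slab b)"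
      unfolding slab_def by (intro closed_Collect_le continuous_intros)
    then have "compact (slab b \<inter> cball 0 R)" by (intro closed_Int_compact) auto
    then have "integrable lborel (\<lambda>x. indicator (slab b \<inter> cball 0 R) x *\<^sub>R f x)"
      by (rule borel_integrable_compact) (rule continuous_on_subset[OF cont], simp)
    moreover have "(\<lambda>x. indicator (slab b \<inter> cball 0 R) x *\<^sub>R f x) = (\<lambda>x. indicator (slab b) x * f x)"
      using supp by (auto simp: fun_eq_iff split: split_indicator)
    ultimately show ?thesis by (simp only:)
  qed
  define t where "t k = 1 / real (Suc k)" for k
  have t: "0 < t k" "t k \<le> 1" for k by (auto simp: t_def)
  have t0: "t \<longlonglongrightarrow> 0"
    unfolding t_def using LIMSEQ_inverse_real_of_nat by (simp add: divide_inverse)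
  define u where "u k x = indicator (slab b) x * ((f (x + t k *\<^sub>R i) - f x) / t k)" for k x
  have ti: "x + s *\<^sub>R i \<in> slab b \<longleftrightarrow> x \<in> slab b" for x s
    using i by (intro slab_add) simp
  have int_u: "has_bochner_integral lborel (u k) 0" for k
  proof -
    have "has_bochner_integral lborel (\<lambda>x. indicator (slab b) (x + t k *\<^sub>R i) * f (x + t k *\<^sub>R i))
        (\<integral>x. indicator (slab b) x * f x \<partial>lborel)"
      using integral_lborel_translate[OF int] .
    then have "has_bochner_integral lborel
        (\<lambda>x. (indicator (slab b) (x + t k *\<^sub>R i) * f (x + t k *\<^sub>R i) - indicator (slab b) x * f x) / t k)
        ((\<integral>x. indicator (slab b) x * f x \<partial>lborel - (\<integral>x. indicator (slab b) x * f x \<partial>lborel)) / t k)"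
      by (intro has_bochner_integral_divide_zero has_bochner_integral_diff has_bochner_integral_integrable int)
    moreover have "(indicator (slab b) (x + t k *\<^sub>R i) * f (x + t k *\<^sub>R i) - indicator (slab b) x * f x) / t k = u k x" for x
      using ti by (auto simp: u_def split: split_indicator)
    ultimately show ?thesis by simp
  qed
  have lim: "(\<lambda>k. u k x) \<longlonglongrightarrow> indicator (slab b) x * f' x i" for x
  proof -
    have "((\<lambda>s. f (x + s *\<^sub>R i)) has_derivative (\<lambda>s. f' x (s *\<^sub>R i))) (at 0)"
    proof -
      have "((\<lambda>s. x + s *\<^sub>R i) has_derivative (\<lambda>s. s *\<^sub>R i)) (at (0::real))"
        by (auto intro!: derivative_eq_intros)
      then show ?thesis
        using has_derivative_compose[of "\<lambda>s. x + s *\<^sub>R i" "\<lambda>s. s *\<^sub>R i" "0::real" UNIV f "f' x"] der[of x]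
        by simp
    qed
    moreover have "f' x (s *\<^sub>R i) = f' x i * s" for s
      using linear_scale[OF has_derivative_linear[OF der[of x]]] by simp
    ultimately have "((\<lambda>s. f (x + s *\<^sub>R i)) has_field_derivative f' x i) (at 0)"
      by (simp add: has_field_derivative_def)
    then have "((\<lambda>s. (f (x + s *\<^sub>R i) - f x) / s) \<longlongrightarrow> f' x i) (at 0)"
      by (simp add: has_field_derivative_iff)
    moreover have "filterlim t (at 0) sequentially"
      unfolding filterlim_at using t0 t by (auto simp: less_le)
    ultimately have "(\<lambda>k. (f (x + t k *\<^sub>R i) - f x) / t k) \<longlonglongrightarrow> f' x i"
      by (rule filterlim_compose)
    then show ?thesis unfolding u_def by (intro tendsto_intros)
  qed
  \<comment> \<open>Steps have length at most 1, hence the radius R + 1: beyond it both values in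
    the quotient vanish.\<close>
  have bd: "norm (u k x) \<le> C * indicator (cball 0 (R + 1)) x" for k x
  proof (cases "x \<in> slab b \<and> norm x > R + 1")
    case True
    have "norm x \<le> norm (x + t k *\<^sub>R i) + norm (t k *\<^sub>R i)"
      by (metis add_diff_cancel_right' norm_triangle_ineq4)
    then have "norm (x + t k *\<^sub>R i) > R" using True t[of k] i by simp
    then show ?thesis using True supp[of x] supp[of "x + t k *\<^sub>R i"] ti by (simp add: u_def)
  next
    case False
    have C: "C \<ge> 0" using bound[of x] by linarith
    show ?thesis
    proof (cases "x \<in> slab b")
      case True
      have *: "((\<lambda>s. f (x + s *\<^sub>R i)) has_derivative (\<lambda>d. f' (x + s *\<^sub>R i) (d *\<^sub>R i))) (at s within {0..t k})" for s
      proof -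
        have "((\<lambda>s. x + s *\<^sub>R i) has_derivative (\<lambda>s. s *\<^sub>R i)) (at s within {0..t k})"
          by (auto intro!: derivative_eq_intros)
        then show ?thesis
          by (rule has_derivative_compose) (rule der)
      qed
      obtain s where s: "f (x + t k *\<^sub>R i) - f (x + 0 *\<^sub>R i) = f' (x + s *\<^sub>R i) ((t k - 0) *\<^sub>R i)"
        using mvt_simple[OF t(1)[of k], of "\<lambda>s. f (x + s *\<^sub>R i)", OF *] by blast
      have "f' (x + s *\<^sub>R i) ((t k - 0) *\<^sub>R i) = t k * f' (x + s *\<^sub>R i) i"
        using linear_scale[OF has_derivative_linear[OF der]] by simp
      then have "u k x = f' (x + s *\<^sub>R i) i"
        using s t[of k] True by (simp add: u_def)
      then show ?thesis using bound[of "x + s *\<^sub>R i"] False True by simp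
    qed (use C in \<open>simp add: u_def\<close>)
  qed
  have um: "u k \<in> borel_measurable lborel" for k
    using int_u by (meson borel_measurable_has_bochner_integral)
  have fm: "(\<lambda>x. indicator (slab b) x * f' x i) \<in> borel_measurable lborel"
    by (rule borel_measurable_LIMSEQ_metric[OF um lim])
  have wint: "integrable lborel (\<lambda>x. C * indicator (cball (0::'a) (R + 1)) x)"
    by (intro integrable_mult_right integrable_real_indicator emeasure_bounded_finite) auto
  have 1: "integrable lborel (\<lambda>x. indicator (slab b) x * f' x i)"
    by (rule integrable_dominated_convergence[where s = u, OF fm um wint]) (use lim bd in auto)
  have 2: "(\<lambda>k. integral\<^sup>L lborel (u k)) \<longlonglongrightarrow> (\<integral>x. indicator (slab b) x * f' x i \<partial>lborel)"
    by (rule integral_dominated_convergence[where s = u, OF fm um wint]) (use lim bd in auto)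
  have "integral\<^sup>L lborel (u k) = 0" for k
    using int_u by (rule has_bochner_integral_integral_eq)
  then have "(\<integral>x. indicator (slab b) x * f' x i \<partial>lborel) = 0"
    using 2 by (simp add: LIMSEQ_const_iff)
  then show ?thesis using 1 by (simp add: has_bochner_integral_iff)
qed

lemma sum_Basis_linear:
  fixes L :: "'a::euclidean_space \<Rightarrow> 'b::real_vector"
  assumes "linear L"
  shows "(\<Sum>i\<in>Basis. (i \<bullet> u) *\<^sub>R L i) = L u"
proof -
  have "L u = L (\<Sum>i\<in>Basis. (u \<bullet> i) *\<^sub>R i)" by (simp add: euclidean_representation)
  also have "\<dots> = (\<Sum>i\<in>Basis. (u \<bullet> i) *\<^sub>R L i)"
    using assms by (simp add: linear_sum linear_scale)
  finally show ?thesis by (simp add: inner_commute)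
qed

lemma sum_Basis_linear_inner:
  fixes L :: "'a::euclidean_space \<Rightarrow> 'b::real_inner"
  assumes "linear L"
  shows "(\<Sum>i\<in>Basis. (i \<bullet> u) * (L i \<bullet> w)) = L u \<bullet> w"
  by (simp add: inner_sum_left flip: sum_Basis_linear[OF assms, of u])

definition tangent_proj :: "'a::euclidean_space \<Rightarrow> 'a \<Rightarrow> 'a" where
  "tangent_proj \<nu> v = v - (v \<bullet> \<nu>) *\<^sub>R \<nu>"

text \<open>For a unit vector \<nu> this is the trace of \<open>L\<close> compressed to the
  orthogonal complement of \<nu>: the tangential divergence if \<open>L\<close> is the derivative of
  a field, the mean curvature if it is the derivative of the unit normal.\<close>

definition trace_tangent :: "'a::euclidean_space \<Rightarrow> ('a \<Rightarrow> 'a) \<Rightarrow> real" where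
  "trace_tangent \<nu> L = (\<Sum>i\<in>Basis. L (tangent_proj \<nu> i) \<bullet> i)"

lemma trace_tangent_eq:
  assumes "linear L"
  shows "trace_tangent \<nu> L = (\<Sum>i\<in>Basis. L i \<bullet> i) - L \<nu> \<bullet> \<nu>"
proof -
  have "trace_tangent \<nu> L = (\<Sum>i\<in>Basis. L i \<bullet> i - (i \<bullet> \<nu>) * (L \<nu> \<bullet> i))"
    unfolding trace_tangent_def tangent_proj_def
    by (intro sum.cong refl) (simp add: linear_diff[OF assms] linear_scale[OF assms] inner_diff_left)
  also have "\<dots> = (\<Sum>i\<in>Basis. L i \<bullet> i) - (\<Sum>i\<in>Basis. (i \<bullet> \<nu>) * (L \<nu> \<bullet> i))"
    by (simp add: sum_subtractf)
  also have "(\<Sum>i\<in>Basis. (i \<bullet> \<nu>) * (L \<nu> \<bullet> i)) = L \<nu> \<bullet> \<nu>"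
    by (subst euclidean_inner) (simp add: inner_commute mult.commute)
  finally show ?thesis .
qed

text \<open>Divergence on the graph in coordinates: the projection along \<open>b\<close> has derivative
  \<open>v \<mapsto> v - (v \<bullet> \<nu> / b \<bullet> \<nu>) b\<close>; \<open>G\<close> is the derivative of \<open>(X - (X \<bullet> \<nu>) \<nu>) / (\<nu> \<bullet> b)\<close> when
  \<open>A\<close> and \<open>W\<close> are the derivatives of \<open>X\<close> and \<open>\<nu>\<close> and \<open>\<xi>\<close> is the value of \<open>X\<close>.\<close>
lemma trace_graph_divergence:
  fixes A W :: "'a::euclidean_space \<Rightarrow> 'a"
  assumes A: "linear A" and W: "linear W" and \<nu>: "\<nu> \<bullet> \<nu> = 1" and \<beta>: "\<beta> = \<nu> \<bullet> b" "\<beta> \<noteq> 0"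
    and normal: "\<And>v. v \<bullet> \<nu> = 0 \<Longrightarrow> W v \<bullet> \<nu> = 0"
    and sym: "\<And>u v. u \<bullet> \<nu> = 0 \<Longrightarrow> v \<bullet> \<nu> = 0 \<Longrightarrow> W u \<bullet> v = W v \<bullet> u"
    and T: "T = \<xi> - (\<xi> \<bullet> \<nu>) *\<^sub>R \<nu>"
    and B: "\<And>v. B v = A v - (A v \<bullet> \<nu> + \<xi> \<bullet> W v) *\<^sub>R \<nu> - (\<xi> \<bullet> \<nu>) *\<^sub>R W v"
    and G: "\<And>v. G v = (1 / \<beta>) *\<^sub>R B v - ((W v \<bullet> b) / \<beta>\<^sup>2) *\<^sub>R T"
  shows "(\<Sum>i\<in>Basis. G (i - (i \<bullet> \<nu> / (b \<bullet> \<nu>)) *\<^sub>R b) \<bullet> i) =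
    (trace_tangent \<nu> A - trace_tangent \<nu> W * (\<xi> \<bullet> \<nu>)) / \<beta>"
proof -
  have b\<nu>: "b \<bullet> \<nu> = \<beta>" by (simp add: \<beta> inner_commute)
  note lin = linear_diff linear_add linear_scale
  have Bl: "linear B"
    by (rule linearI) (auto simp: B lin[OF A] lin[OF W] inner_add_left inner_add_right algebra_simps)
  have Gl: "linear G"
    by (rule linearI) (auto simp: G lin[OF Bl] lin[OF W] inner_add_left algebra_simps add_divide_distrib)
  have T\<nu>: "T \<bullet> \<nu> = 0" by (simp add: T inner_diff_left \<nu>)
  \<comment> \<open>b = \<beta> (\<nu> - w) with \<open>w\<close> tangent, so B b \<bullet> \<nu>
    follows from B \<nu> and B w. The symmetry of the Weingarten map exchanges W w \<bullet> T for W
    T \<bullet> w.\<close>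
  define w where "w = \<nu> - (1 / \<beta>) *\<^sub>R b"
  have w: "w \<bullet> \<nu> = 0" using \<beta> by (simp add: w_def inner_diff_left \<nu> b\<nu>)
  have "B w \<bullet> \<nu> = - (\<xi> \<bullet> W w)"
    by (simp add: B inner_diff_left inner_add_left \<nu> normal[OF w])
  also have "\<dots> = - (W w \<bullet> T)"
    using normal[OF w] by (simp add: T inner_diff_right inner_diff_left inner_commute)
  also have "\<dots> = - (W T \<bullet> w)" using sym[OF w T\<nu>] by simp
  also have "\<dots> = (W T \<bullet> b) / \<beta>" using normal[OF T\<nu>] by (simp add: w_def inner_diff_right)
  finally have Bw: "B w \<bullet> \<nu> = (W T \<bullet> b) / \<beta>" .
  \<comment> \<open>The term W T \<bullet> b will cancel the one produced by differentiating 1 /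
    \<beta> in \<open>G\<close>.\<close>
  have Bb: "B b \<bullet> \<nu> = \<beta> * (B \<nu> \<bullet> \<nu>) - W T \<bullet> b"
    using Bw \<beta> by (simp add: w_def lin[OF Bl] inner_diff_left field_simps)
  \<comment> \<open>Removing the normal part of the field costs exactly the mean curvature term: the
    contribution W \<nu> \<bullet> \<xi> occurs in the full trace and in B \<nu> \<bullet> \<nu>,
    and drops out.\<close>
  have trB: "trace_tangent \<nu> B = trace_tangent \<nu> A - trace_tangent \<nu> W * (\<xi> \<bullet> \<nu>)"
  proof -
    have "B i \<bullet> i = A i \<bullet> i - (i \<bullet> \<nu>) * (A i \<bullet> \<nu>) - (i \<bullet> \<nu>) * (W i \<bullet> \<xi>) - (\<xi> \<bullet> \<nu>) * (W i \<bullet> i)" for i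
      unfolding B inner_diff_left inner_scaleR_left inner_commute[of \<xi> "W i"] inner_commute[of \<nu> i]
      by (simp only: algebra_simps)
    then have "(\<Sum>i\<in>Basis. B i \<bullet> i) = (\<Sum>i\<in>Basis. A i \<bullet> i) - (\<Sum>i\<in>Basis. (i \<bullet> \<nu>) * (A i \<bullet> \<nu>))
        - (\<Sum>i\<in>Basis. (i \<bullet> \<nu>) * (W i \<bullet> \<xi>)) - (\<Sum>i\<in>Basis. (\<xi> \<bullet> \<nu>) * (W i \<bullet> i))"
      by (simp only: sum_subtractf)
    also have "\<dots> = (\<Sum>i\<in>Basis. A i \<bullet> i) - A \<nu> \<bullet> \<nu> - W \<nu> \<bullet> \<xi> - (\<xi> \<bullet> \<nu>) * (\<Sum>i\<in>Basis. W i \<bullet> i)"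
      by (simp add: sum_Basis_linear_inner A W sum_distrib_left)
    finally have "(\<Sum>i\<in>Basis. B i \<bullet> i) = \<dots>" .
    moreover have "B \<nu> \<bullet> \<nu> = - (W \<nu> \<bullet> \<xi>) - (\<xi> \<bullet> \<nu>) * (W \<nu> \<bullet> \<nu>)"
      by (simp add: B inner_diff_left \<nu> inner_commute[of \<xi> "W \<nu>"])
    ultimately show ?thesis
      by (simp add: trace_tangent_eq Bl A W algebra_simps)
  qed
  have WT: "(\<Sum>i\<in>Basis. (i \<bullet> T) * (W i \<bullet> b)) = W T \<bullet> b"
    by (rule sum_Basis_linear_inner[OF W])
  have "(\<Sum>i\<in>Basis. G (i - (i \<bullet> \<nu> / (b \<bullet> \<nu>)) *\<^sub>R b) \<bullet> i) =
      (\<Sum>i\<in>Basis. G i \<bullet> i) - (\<Sum>i\<in>Basis. (i \<bullet> \<nu>) * (G b \<bullet> i)) / \<beta>"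
    by (simp add: lin[OF Gl] inner_diff_left b\<nu> sum_subtractf sum_divide_distrib)
  also have "(\<Sum>i\<in>Basis. (i \<bullet> \<nu>) * (G b \<bullet> i)) = G b \<bullet> \<nu>"
    by (subst euclidean_inner[of "G b"]) (simp add: inner_commute mult.commute)
  also have "G b \<bullet> \<nu> = (B b \<bullet> \<nu>) / \<beta>"
    by (simp add: G inner_diff_left T\<nu>)
  also have "(\<Sum>i\<in>Basis. G i \<bullet> i) = (\<Sum>i\<in>Basis. B i \<bullet> i) / \<beta> - (W T \<bullet> b) / \<beta>\<^sup>2"
  proof -
    have "G i \<bullet> i = (B i \<bullet> i) / \<beta> - ((i \<bullet> T) * (W i \<bullet> b)) / \<beta>\<^sup>2" for i
      by (simp add: G inner_diff_left inner_commute[of T i])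
    then show ?thesis by (simp add: sum_subtractf WT flip: sum_divide_distrib)
  qed
  also have "(\<Sum>i\<in>Basis. B i \<bullet> i) / \<beta> - (W T \<bullet> b) / \<beta>\<^sup>2 - (B b \<bullet> \<nu>) / \<beta> / \<beta> = trace_tangent \<nu> B / \<beta>"
    using \<beta>(2) by (simp add: Bb trace_tangent_eq[OF Bl] field_simps power2_eq_square)
  finally show ?thesis by (simp add: trB)
qed

section \<open>The divergence theorem\<close>

lemma continuous_on_linear_family:
  fixes L :: "'c::topological_space \<Rightarrow> 'a::euclidean_space \<Rightarrow> 'b::real_normed_vector"
  assumes lin: "\<And>x. x \<in> S \<Longrightarrow> linear (L x)"
    and L: "\<And>i. i \<in> Basis \<Longrightarrow> continuous_on S (\<lambda>x. L x i)"
    and v: "continuous_on S v"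
  shows "continuous_on S (\<lambda>x. L x (v x))"
proof -
  have "continuous_on S (\<lambda>x. \<Sum>i\<in>Basis. (i \<bullet> v x) *\<^sub>R L x i)"
    by (intro continuous_intros L v)
  then show ?thesis
    by (rule continuous_on_eq) (simp add: sum_Basis_linear lin)
qed

text \<open>\<open>DN\<close> is the derivative of an extension of the normal, so symmetry is
  claimed for tangent vectors only. The constant sign \<sigma> reconciles the N \<bullet> b in the
  divergence with the |N \<bullet> b| in the area formula.\<close>

locale curved_chart = graph_chart M V D N \<pi> b
  for M V D :: "'a::euclidean_space set" and N \<pi> :: "'a \<Rightarrow> 'a" and b :: 'a +
  fixes DN :: "'a \<Rightarrow> 'a \<Rightarrow> 'a" and \<sigma> :: real
  assumes deriv_N: "\<And>x. x \<in> M \<inter> V \<Longrightarrow> (N has_derivative DN x) (at x)"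
    and cont_DN: "\<And>i. i \<in> Basis \<Longrightarrow> continuous_on (M \<inter> V) (\<lambda>x. DN x i)"
    and DN_sym: "\<And>x u v. x \<in> M \<inter> V \<Longrightarrow> u \<bullet> N x = 0 \<Longrightarrow> v \<bullet> N x = 0 \<Longrightarrow> DN x u \<bullet> v = DN x v \<bullet> u"
    and sgn_N: "\<And>x. x \<in> M \<inter> V \<Longrightarrow> sgn (N x \<bullet> b) = \<sigma>"
begin

definition vertical_proj :: "'a \<Rightarrow> 'a \<Rightarrow> 'a" where
  "vertical_proj p v = v - (v \<bullet> N p / (b \<bullet> N p)) *\<^sub>R b"

lemma vertical_proj_tangent: "v \<bullet> N p = 0 \<Longrightarrow> vertical_proj p v = v"
  by (simp add: vertical_proj_def)

lemma deriv_pi': "x \<in> D \<Longrightarrow> (\<pi> has_derivative vertical_proj (\<pi> x)) (at x)"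
  using deriv_pi by (simp add: vertical_proj_def[abs_def])

lemma continuous_on_pi: "continuous_on D \<pi>"
  using deriv_pi by (meson continuous_at_imp_continuous_on has_derivative_continuous)

text \<open>The extended field has length 1 on \<open>M\<close> but perhaps not nearby, so N
  \<bullet> N = 1 is differentiated after composition with \<pi>, whose derivative fixes tangent
  vectors.\<close>

lemma DN_normal:
  assumes p: "p \<in> M \<inter> V" and v: "v \<bullet> N p = 0"
  shows "DN p v \<bullet> N p = 0"
proof -
  have pD: "p \<in> D" "\<pi> p = p" using p mem_D pi_id by auto
  have 1: "((\<lambda>x. N (\<pi> x)) has_derivative (\<lambda>v. DN p (vertical_proj p v))) (at p)"
    using has_derivative_compose[of \<pi> "vertical_proj p" p UNIV N "DN p"] deriv_pi'[of p] deriv_N[OF p] pD by simp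
  have "((\<lambda>x. N (\<pi> x) \<bullet> N (\<pi> x)) has_derivative (\<lambda>v. N (\<pi> p) \<bullet> DN p (vertical_proj p v) + DN p (vertical_proj p v) \<bullet> N (\<pi> p))) (at p)"
    by (rule has_derivative_inner[OF 1 1])
  moreover have "((\<lambda>x. N (\<pi> x) \<bullet> N (\<pi> x)) has_derivative (\<lambda>v. 0)) (at p)"
  proof (rule has_derivative_transform_within_open[OF _ openD pD(1)])
    show "((\<lambda>x. 1) has_derivative (\<lambda>v. 0)) (at p)" by simp
    show "1 = N (\<pi> x) \<bullet> N (\<pi> x)" if "x \<in> D" for x
      using norm_N[OF pi_mem[OF that]] by (simp add: norm_eq_1)
  qed
  ultimately have "(\<lambda>v. N (\<pi> p) \<bullet> DN p (vertical_proj p v) + DN p (vertical_proj p v) \<bullet> N (\<pi> p)) = (\<lambda>v. 0)"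
    by (rule has_derivative_unique)
  from fun_cong[OF this, of v] show ?thesis
    by (simp add: pD vertical_proj_tangent[OF v] inner_commute)
qed

end

text \<open>div_T X - H X \<bullet> \<nu>, which on \<open>M\<close> is the tangential divergence of
  the tangential part of \<open>X\<close>.\<close>

definition tangential_divergence_defect ::
    "('a::euclidean_space \<Rightarrow> 'a) \<Rightarrow> ('a \<Rightarrow> 'a \<Rightarrow> 'a) \<Rightarrow> ('a \<Rightarrow> 'a) \<Rightarrow> ('a \<Rightarrow> 'a \<Rightarrow> 'a) \<Rightarrow> 'a \<Rightarrow> real" where
  "tangential_divergence_defect N DN X DX x =
     trace_tangent (N x) (DX x) - trace_tangent (N x) (DN x) * (X x \<bullet> N x)"

locale hausdorff_curved = curved_chart M V D N \<pi> b DN \<sigma> + hausdorff_graph M V D N \<pi> b h n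
  for M V D :: "'a::euclidean_space set" and N \<pi> :: "'a \<Rightarrow> 'a" and b :: 'a
    and DN :: "'a \<Rightarrow> 'a \<Rightarrow> 'a" and \<sigma> :: real and h :: "'a measure" and n :: nat
begin

text \<open>The quotient of the tangential part of \<open>X\<close> by N \<bullet> b becomes, via
  \<pi>, a field \<open>Y\<close> on the whole space, constant along \<open>b\<close>. Each diagonal
  term of its derivative integrates to 0 over the slab, and their sum is \<sigma> times the defect
  over |N \<bullet> b|.\<close>

lemma local_divergence_theorem:
  fixes X :: "'a \<Rightarrow> 'a"
  assumes U: "open U" and K: "compact K" "K \<subseteq> M \<inter> V \<inter> U"
    and DX: "\<And>x. x \<in> U \<Longrightarrow> (X has_derivative DX x) (at x)"
    and cont_DX: "\<And>i. i \<in> Basis \<Longrightarrow> continuous_on U (\<lambda>x. DX x i)"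
    and X0: "\<And>x. x \<in> M \<inter> V \<Longrightarrow> x \<notin> K \<Longrightarrow> X x = 0"
  shows "has_bochner_integral h (\<lambda>x. indicator K x * tangential_divergence_defect N DN X DX x) 0"
proof -
  have KM: "x \<in> M \<inter> V" "x \<in> U" if "x \<in> K" for x using K that by auto
  define T where "T y = X y - (X y \<bullet> N y) *\<^sub>R N y" for y
  define B where "B y v = DX y v - (DX y v \<bullet> N y + X y \<bullet> DN y v) *\<^sub>R N y - (X y \<bullet> N y) *\<^sub>R DN y v" for y v
  define G where "G y = (1 / (N y \<bullet> b)) *\<^sub>R T y" for y
  define DG where "DG y v = (1 / (N y \<bullet> b)) *\<^sub>R B y v - ((DN y v \<bullet> b) / (N y \<bullet> b)\<^sup>2) *\<^sub>R T y" for y v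
  have derT: "(T has_derivative B y) (at y)" if "y \<in> M \<inter> V" "y \<in> U" for y
    unfolding T_def B_def
    by (rule derivative_eq_intros DX[OF that(2)] deriv_N[OF that(1)] refl)+
      (simp add: fun_eq_iff algebra_simps)
  have derG: "(G has_derivative DG y) (at y)" if y: "y \<in> M \<inter> V" "y \<in> U" for y
  proof -
    have "((\<lambda>y. N y \<bullet> b) has_derivative (\<lambda>v. DN y v \<bullet> b)) (at y)"
      by (rule derivative_eq_intros deriv_N[OF y(1)] refl)+ simp
    then have "((\<lambda>y. inverse (N y \<bullet> b)) has_derivative (\<lambda>v. - (inverse (N y \<bullet> b) * (DN y v \<bullet> b) * inverse (N y \<bullet> b)))) (at y)"
      using N_b[OF y(1)] by (intro Deriv.has_derivative_inverse)
    from has_derivative_scaleR[OF this derT[OF y]]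
    show ?thesis
      unfolding G_def DG_def
      by (simp add: inverse_eq_divide power2_eq_square)
  qed
  \<comment> \<open>The cylinder along \<open>b\<close> over \<open>K\<close>. It is the preimage of
    a compact projection, hence closed; so \<open>Y\<close> vanishes on an open complement and is
    differentiable everywhere.\<close>
  define Kc where "Kc = {x \<in> D. \<pi> x \<in> K}"
  have Kc_iff: "x \<in> Kc \<longleftrightarrow> drop_coord b x \<in> drop_coord b ` K" for x
  proof
    assume "x \<in> Kc"
    then have "drop_coord b (\<pi> x) = drop_coord b x" "\<pi> x \<in> K" using drop_pi by (auto simp: Kc_def)
    then show "drop_coord b x \<in> drop_coord b ` K" by (metis imageI)
  next
    assume "drop_coord b x \<in> drop_coord b ` K"
    then obtain a where a: "a \<in> K" "drop_coord b x = drop_coord b a" by blast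
    have "a \<in> D" "\<pi> a = a" using mem_D pi_id KM[OF a(1)] by blast+
    then show "x \<in> Kc" using a D_drop pi_drop unfolding Kc_def by (metis (mono_tags, lifting) mem_Collect_eq)
  qed
  have closed_Kc: "closed Kc"
  proof -
    have "compact (drop_coord b ` K)" by (intro compact_continuous_image continuous_intros K)
    then have "closed (drop_coord b -` (drop_coord b ` K))"
      by (intro closed_vimage compact_imp_closed continuous_on_drop_coord)
    moreover have "Kc = drop_coord b -` (drop_coord b ` K)" using Kc_iff by auto
    ultimately show ?thesis by simp
  qed
  define D' where "D' = D \<inter> \<pi> -` U"
  have openD': "open D'"
    unfolding D'_def by (rule continuous_open_preimage[OF continuous_on_pi openD U])
  have KcD': "Kc \<subseteq> D'" using KM by (auto simp: Kc_def D'_def)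
  define Y where "Y x = (if x \<in> D' then G (\<pi> x) else 0)" for x
  define DY where "DY x v = (if x \<in> Kc then DG (\<pi> x) (vertical_proj (\<pi> x) v) else 0)" for x v
  have Y0: "Y x = 0" if "x \<notin> Kc" for x
  proof (cases "x \<in> D'")
    case True
    then have "X (\<pi> x) = 0" using that X0[of "\<pi> x"] pi_mem[of x] by (auto simp: Kc_def D'_def)
    then show ?thesis by (simp add: Y_def G_def T_def)
  qed (simp add: Y_def)
  have derY: "(Y has_derivative DY x) (at x)" for x
  proof (cases "x \<in> Kc")
    case True
    then have x: "x \<in> D'" "x \<in> D" "\<pi> x \<in> K" using KcD' by (auto simp: Kc_def)
    have "((\<lambda>x. G (\<pi> x)) has_derivative (\<lambda>v. DG (\<pi> x) (vertical_proj (\<pi> x) v))) (at x)"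
      using has_derivative_compose[OF deriv_pi'[OF x(2)] derG[of "\<pi> x"]] KM[OF x(3)] by simp
    then have "(Y has_derivative (\<lambda>v. DG (\<pi> x) (vertical_proj (\<pi> x) v))) (at x)"
      by (rule has_derivative_transform_within_open[OF _ openD' x(1)]) (simp add: Y_def)
    then show ?thesis using True by (simp add: DY_def[abs_def])
  next
    case False
    have "open (- Kc)" using closed_Kc by auto
    have "(Y has_derivative (\<lambda>v. 0)) (at x)"
      by (rule has_derivative_transform_within_open[OF _ \<open>open (- Kc)\<close>, of "\<lambda>x. 0"]) (use False Y0 in auto)
    then show ?thesis using False by (simp add: DY_def[abs_def])
  qed
  have cN: "continuous_on K N" by (rule continuous_on_subset[OF cont_N]) (use KM in auto)
  have cX: "continuous_on K X"
    using DX[OF KM(2)] by (intro continuous_at_imp_continuous_on ballI) (blast intro: has_derivative_continuous)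
  have cDX: "continuous_on K (\<lambda>x. DX x (v x))" if "continuous_on K v" for v
  proof (rule continuous_on_linear_family[OF _ _ that])
    show "linear (DX x)" if "x \<in> K" for x using DX[OF KM(2)[OF that]] by (rule has_derivative_linear)
    show "continuous_on K (\<lambda>x. DX x i)" if "i \<in> Basis" for i
      using cont_DX[OF that] by (rule continuous_on_subset) (use KM in blast)
  qed
  have cDN: "continuous_on K (\<lambda>x. DN x (v x))" if "continuous_on K v" for v
  proof (rule continuous_on_linear_family[OF _ _ that])
    show "linear (DN x)" if "x \<in> K" for x using deriv_N[OF KM(1)[OF that]] by (rule has_derivative_linear)
    show "continuous_on K (\<lambda>x. DN x i)" if "i \<in> Basis" for i
      using cont_DN[OF that] by (rule continuous_on_subset) (use KM in blast)
  qed
  have NbK: "\<forall>x\<in>K. N x \<bullet> b \<noteq> 0" "\<forall>x\<in>K. b \<bullet> N x \<noteq> 0" using N_b KM by (auto simp: inner_commute)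
  \<comment> \<open>\<open>DY\<close> takes, besides 0, only values of a function continuous on the
    compact set \<open>K\<close>; the cylinder itself is unbounded.\<close>
  have bound: "\<exists>C. \<forall>x. \<bar>DY x i \<bullet> i\<bar> \<le> C" for i
  proof -
    have cv: "continuous_on K (\<lambda>y. vertical_proj y i)"
      unfolding vertical_proj_def by (intro continuous_intros cN NbK)
    have cT: "continuous_on K T"
      unfolding T_def by (intro continuous_intros cX cN)
    have cB: "continuous_on K (\<lambda>y. B y (vertical_proj y i))"
      unfolding B_def by (intro continuous_intros cDX[OF cv] cDN[OF cv] cX cN)
    have "\<forall>y\<in>K. (N y \<bullet> b)\<^sup>2 \<noteq> 0" using NbK by simp
    then have "continuous_on K (\<lambda>y. DG y (vertical_proj y i) \<bullet> i)"
      unfolding DG_def by (intro continuous_intros cB cT cDN[OF cv] cN NbK)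
    then have "compact ((\<lambda>y. DG y (vertical_proj y i) \<bullet> i) ` K)"
      using K(1) by (rule compact_continuous_image)
    from compact_imp_bounded[OF this]
    obtain C where "\<forall>z\<in>(\<lambda>y. DG y (vertical_proj y i) \<bullet> i) ` K. norm z \<le> C"
      unfolding bounded_iff by blast
    then have C: "\<And>y. y \<in> K \<Longrightarrow> \<bar>DG y (vertical_proj y i) \<bullet> i\<bar> \<le> C"
      by simp
    have "\<bar>DY x i \<bullet> i\<bar> \<le> max C 0" for x
      using C[of "\<pi> x"] by (auto simp: DY_def Kc_def)
    then show ?thesis by blast
  qed
  obtain R where R: "\<And>x. x \<in> K \<Longrightarrow> norm x \<le> R"
    using compact_imp_bounded[OF K(1)] unfolding bounded_iff by blast
  \<comment> \<open>A point of the cylinder over a \<in> K has norm at most |a| + |a \<bullet> b| +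
    |x \<bullet> b|, and the last term is at most 1/2 in the slab.\<close>
  have supp: "Y x = 0" if "x \<in> slab b" "norm x > 2 * R + 1" for x
  proof (rule Y0, rule notI)
    assume "x \<in> Kc"
    then obtain a where a: "a \<in> K" "drop_coord b x = drop_coord b a" using Kc_iff by auto
    have "x = a - (a \<bullet> b) *\<^sub>R b + (x \<bullet> b) *\<^sub>R b" using a(2) by (simp add: drop_coord_def algebra_simps)
    then have "norm x \<le> norm a + \<bar>a \<bullet> b\<bar> + \<bar>x \<bullet> b\<bar>"
      using b norm_triangle_ineq[of "a - (a \<bullet> b) *\<^sub>R b" "(x \<bullet> b) *\<^sub>R b"] norm_triangle_ineq4[of a "(a \<bullet> b) *\<^sub>R b"]
      by simp
    also have "\<dots> \<le> R + R + 1"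
      using R[OF a(1)] Basis_le_norm[OF b, of a] that(1) by (simp add: slab_def)
    finally show False using that(2) by simp
  qed
  have int_i: "has_bochner_integral lborel (\<lambda>x. indicator (slab b) x * (DY x i \<bullet> i)) 0" if i: "i \<in> Basis" for i
  proof (cases "i = b")
    case True
    \<comment> \<open>The slab is not invariant along \<open>b\<close>, so this direction cannot be
      integrated by translation; but \<open>Y\<close> is constant along \<open>b\<close>.\<close>
    have "DY x b \<bullet> b = 0" for x
    proof (cases "x \<in> Kc")
      case True
      then have p: "\<pi> x \<in> K" by (simp add: Kc_def)
      have "vertical_proj (\<pi> x) b = 0" using NbK p by (simp add: vertical_proj_def)
      moreover have "DG (\<pi> x) 0 = 0"
        by (rule linear_0[OF has_derivative_linear[OF derG[OF KM[OF p]]]])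
      ultimately show ?thesis by (simp add: DY_def)
    qed (simp add: DY_def)
    then show ?thesis using True by (simp add: has_bochner_integral_zero)
  next
    case False
    obtain C where "\<forall>x. \<bar>DY x i \<bullet> i\<bar> \<le> C" using bound by blast
    then show ?thesis
      using has_integral_directional_derivative_slab[of "\<lambda>x. Y x \<bullet> i" "\<lambda>x v. DY x v \<bullet> i" i C b "2 * R + 1"]
        has_derivative_inner_left[OF derY] supp that False b by (auto simp: inner_Basis)
  qed
  define E where "E = tangential_divergence_defect N DN X DX"
  have "has_bochner_integral lborel (\<lambda>x. \<Sum>i\<in>Basis. indicator (slab b) x * (DY x i \<bullet> i)) (\<Sum>i\<in>(Basis::'a set). 0)"
    by (intro has_bochner_integral_sum int_i)
  then have "has_bochner_integral lborel (\<lambda>x. \<sigma> * (\<Sum>i\<in>Basis. indicator (slab b) x * (DY x i \<bullet> i))) (\<sigma> * 0)"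
    by (intro has_bochner_integral_mult_right) simp
  moreover have "\<sigma> * (\<Sum>i\<in>Basis. indicator (slab b) x * (DY x i \<bullet> i)) =
      indicator (slab b \<inter> D) x * ((indicator K (\<pi> x) * E (\<pi> x)) / \<bar>N (\<pi> x) \<bullet> b\<bar>)" for x
  proof (cases "x \<in> Kc")
    case False
    then show ?thesis by (auto simp: DY_def Kc_def split: split_indicator)
  next
    case True
    define p where "p = \<pi> x"
    have p: "p \<in> K" "x \<in> D" using True by (auto simp: Kc_def p_def)
    note pM = KM[OF p(1)]
    have "(\<Sum>i\<in>Basis. DG p (i - (i \<bullet> N p / (b \<bullet> N p)) *\<^sub>R b) \<bullet> i) = E p / (N p \<bullet> b)"
      unfolding E_def tangential_divergence_defect_def
    proof (rule trace_graph_divergence)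
      show "linear (DX p)" "linear (DN p)"
        using DX deriv_N pM by (auto intro: has_derivative_linear)
      show "N p \<bullet> N p = 1" using norm_N[OF pM(1)] by (simp add: norm_eq_1)
      show "N p \<bullet> b \<noteq> 0" using N_b pM by blast
      show "DN p v \<bullet> N p = 0" if "v \<bullet> N p = 0" for v using DN_normal[OF pM(1) that] .
      show "DN p u \<bullet> v = DN p v \<bullet> u" if "u \<bullet> N p = 0" "v \<bullet> N p = 0" for u v
        using DN_sym[OF pM(1) that] .
    qed (simp_all add: T_def B_def DG_def)
    then have "(\<Sum>i\<in>Basis. DY x i \<bullet> i) = E p / (N p \<bullet> b)"
      using True by (simp add: DY_def p_def vertical_proj_def)
    moreover have "\<sigma> * (E p / (N p \<bullet> b)) = E p / \<bar>N p \<bullet> b\<bar>"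
      using sgn_N[OF pM(1)] N_b[OF pM(1)] by (auto simp: sgn_if abs_if split: if_splits)
    ultimately show ?thesis
      using p by (cases "x \<in> slab b") (simp_all add: p_def[symmetric])
  qed
  ultimately have "has_bochner_integral lborel
      (\<lambda>x. indicator (slab b \<inter> D) x * ((indicator K (\<pi> x) * E (\<pi> x)) / \<bar>N (\<pi> x) \<bullet> b\<bar>)) 0"
    by simp
  then have "has_bochner_integral h (\<lambda>x. indicator K x * E x) (plane_const * 0)"
  proof (rule has_bochner_integral_graph[rotated 2])
    have "continuous_on K E"
      unfolding E_def tangential_divergence_defect_def trace_tangent_def tangent_proj_def
      by (intro continuous_intros cDX cDN cX cN)
    then have "(\<lambda>x. indicator K x *\<^sub>R E x) \<in> borel_measurable borel"
      using K(1) by (intro borel_measurable_continuous_on_indicator) (auto simp: borel_compact)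
    then show "(\<lambda>x. indicator K x * E x) \<in> borel_measurable borel" by simp
    show "indicator K x * E x = 0" if "x \<notin> M \<inter> V" for x
      using KM that by (auto split: split_indicator)
  qed
  then show ?thesis by (simp add: E_def)
qed

end

section \<open>Partition of unity and the global divergence theorem\<close>

definition bump :: "'a::euclidean_space \<Rightarrow> real \<Rightarrow> 'a \<Rightarrow> real" where
  "bump p r y = (max 0 (r\<^sup>2 - (norm (y - p))\<^sup>2))\<^sup>2"

definition bump_deriv :: "'a::euclidean_space \<Rightarrow> real \<Rightarrow> 'a \<Rightarrow> 'a \<Rightarrow> real" where
  "bump_deriv p r y v = - 4 * max 0 (r\<^sup>2 - (norm (y - p))\<^sup>2) * ((y - p) \<bullet> v)"

text \<open>Squaring the positive part makes it differentiable at 0, where the difference quotient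
  at s is at most |s|. This makes \<open>bump\<close> continuously differentiable across the sphere
  of radius r.\<close>

lemma has_real_derivative_max_square:
  "((\<lambda>t::real. (max 0 t)\<^sup>2) has_real_derivative 2 * max 0 t) (at t)"
proof -
  consider "t > 0" | "t < 0" | "t = 0" by linarith
  then show ?thesis
  proof cases
    case 1
    have "((\<lambda>t. t\<^sup>2) has_real_derivative 2 * max 0 t) (at t)"
      using 1 by (auto intro!: derivative_eq_intros)
    then show ?thesis
      by (rule has_field_derivative_transform_within_open[where S = "{0<..}"]) (use 1 in auto)
  next
    case 2
    have "((\<lambda>t. 0) has_real_derivative 2 * max 0 t) (at t)"
      using 2 by (auto intro!: derivative_eq_intros)
    then show ?thesis
      by (rule has_field_derivative_transform_within_open[where S = "{..<0}"]) (use 2 in auto)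
  next
    case 3
    have "((\<lambda>s. ((max 0 s)\<^sup>2 - (max 0 0)\<^sup>2) / (s - 0)) \<longlongrightarrow> 0) (at (0::real))"
    proof (rule Lim_null_comparison)
      show "\<forall>\<^sub>F s in at 0. norm (((max 0 s)\<^sup>2 - (max 0 0)\<^sup>2) / (s - 0)) \<le> \<bar>s::real\<bar>"
        by (rule always_eventually) (auto simp: max_def power2_eq_square)
      show "((\<lambda>s::real. \<bar>s\<bar>) \<longlongrightarrow> 0) (at 0)"
        by (rule tendsto_eq_intros refl | simp)+
    qed
    then show ?thesis using 3 by (simp add: has_field_derivative_iff)
  qed
qed

lemma has_derivative_bump: "(bump p r has_derivative bump_deriv p r y) (at y)"
proof -
  have "((\<lambda>y. r\<^sup>2 - (y - p) \<bullet> (y - p)) has_derivative (\<lambda>v. - 2 * ((y - p) \<bullet> v))) (at y)"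
    by (auto intro!: derivative_eq_intros simp: inner_commute)
  from has_derivative_compose[OF this has_real_derivative_max_square[of "r\<^sup>2 - (y - p) \<bullet> (y - p)", unfolded has_field_derivative_def]]
  show ?thesis
    by (simp add: bump_def[abs_def] bump_deriv_def[abs_def] power2_norm_eq_inner algebra_simps)
qed

lemma bump_nonneg [simp]: "bump p r y \<ge> 0"
  by (simp add: bump_def)

lemma bump_pos: "norm (y - p) < r \<Longrightarrow> bump p r y > 0"
  using power_strict_mono[of "norm (y - p)" r 2] by (simp add: bump_def)

lemma bump_outside:
  assumes "norm (y - p) \<ge> r" "r \<ge> 0"
  shows "bump p r y = 0" "bump_deriv p r y v = 0"
  using power_mono[OF assms, of 2] by (simp_all add: bump_def bump_deriv_def max_def)

lemma continuous_on_bump_deriv: "continuous_on S (\<lambda>y. bump_deriv p r y v)"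
  unfolding bump_deriv_def by (intro continuous_intros)

lemma continuous_on_bump: "continuous_on S (bump p r)"
  using has_derivative_bump by (meson continuous_at_imp_continuous_on has_derivative_continuous)

text \<open>The normalised bumps sum to 1 on an open set containing \<open>K\<close>, so their
  derivatives sum to 0 there. The defects of the localised fields therefore add up to the defect of
  \<open>X\<close>, and each integrates to 0 in its own chart.\<close>

lemma (in hausdorff_space) divergence_theorem:
  fixes M :: "'a set" and X :: "'a \<Rightarrow> 'a"
  assumes charts: "\<And>p. p \<in> K \<Longrightarrow> \<exists>V D \<pi> b \<sigma>. p \<in> V \<and> curved_chart M V D N \<pi> b DN \<sigma>"
    and U: "open U" and K: "compact K" "K \<subseteq> M \<inter> U"
    and DX: "\<And>x. x \<in> U \<Longrightarrow> (X has_derivative DX x) (at x)"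
    and cont_DX: "\<And>i. i \<in> Basis \<Longrightarrow> continuous_on U (\<lambda>x. DX x i)"
    and X0: "\<And>x. x \<in> M \<Longrightarrow> x \<notin> K \<Longrightarrow> X x = 0"
  shows "has_bochner_integral h (\<lambda>x. indicator K x * tangential_divergence_defect N DN X DX x) 0"
proof -
  \<comment> \<open>Hiding the remaining chart data behind an existential leaves only
    \<open>V\<close> and \<open>r\<close> to be chosen for each point.\<close>
  define Q where "Q p V r \<longleftrightarrow> (\<exists>D \<pi> b \<sigma>. curved_chart M V D N \<pi> b DN \<sigma>) \<and> (0::real) < r \<and> cball p r \<subseteq> V" for p V r
  have Q: "\<exists>V r. Q p V r" if pK: "p \<in> K" for p
  proof -
    obtain V D \<pi> b \<sigma> where V: "p \<in> V" "curved_chart M V D N \<pi> b DN \<sigma>"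
      using charts[OF pK] by blast
    interpret curved_chart M V D N \<pi> b DN \<sigma> by (rule V(2))
    obtain r where "r > 0" "cball p r \<subseteq> V"
      using openV V(1) open_contains_cball by blast
    then show ?thesis using V unfolding Q_def by blast
  qed
  obtain V where "\<forall>p\<in>K. \<exists>r. Q p (V p) r"
    using bchoice[of K "\<lambda>p V. \<exists>r. Q p V r"] Q by blast
  then obtain r where "\<forall>p\<in>K. Q p (V p) (r p)"
    using bchoice[of K "\<lambda>p r. Q p (V p) r"] by blast
  then have V: "\<And>p. p \<in> K \<Longrightarrow> \<exists>D \<pi> b \<sigma>. curved_chart M (V p) D N \<pi> b DN \<sigma>"
    and r: "\<And>p. p \<in> K \<Longrightarrow> r p > 0" "\<And>p. p \<in> K \<Longrightarrow> cball p (r p) \<subseteq> V p"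
    unfolding Q_def by blast+
  have "K \<subseteq> (\<Union>p\<in>K. ball p (r p))"
  proof
    fix p assume "p \<in> K"
    then show "p \<in> (\<Union>p\<in>K. ball p (r p))" using r(1)[of p] by (intro UN_I[of p]) simp_all
  qed
  then obtain P where P: "P \<subseteq> K" "finite P" "K \<subseteq> (\<Union>p\<in>P. ball p (r p))"
    using compactE_image[OF K(1), of K "\<lambda>p. ball p (r p)"] by (simp add: open_ball) blast
  define S where "S y = (\<Sum>p\<in>P. bump p (r p) y)" for y
  define DS where "DS y v = (\<Sum>p\<in>P. bump_deriv p (r p) y v)" for y v
  have derS: "(S has_derivative DS y) (at y)" for y
    unfolding S_def DS_def by (intro has_derivative_sum has_derivative_bump)
  have contS: "continuous_on A S" for A
    unfolding S_def by (intro continuous_on_sum continuous_on_bump)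
  have contDS: "continuous_on A (\<lambda>y. DS y v)" for A v
    unfolding DS_def by (intro continuous_on_sum continuous_on_bump_deriv)
  \<comment> \<open>Quotients by \<open>S\<close> are differentiable where \<open>S\<close> is
    positive, an open condition that holds on \<open>K\<close>.\<close>
  define U' where "U' = U \<inter> {y. S y > 0}"
  have openU': "open U'"
    unfolding U'_def using U by (intro open_Int open_Collect_less contS continuous_on_const)
  have S_pos: "S y > 0" if y: "y \<in> K" for y
  proof -
    obtain p where p: "p \<in> P" "y \<in> ball p (r p)" using P y by blast
    then have "bump p (r p) y > 0" by (intro bump_pos) (simp add: dist_norm norm_minus_commute)
    then show ?thesis unfolding S_def using p P by (intro sum_pos2[of P p]) auto
  qed
  have KU': "K \<subseteq> U'" using K S_pos by (auto simp: U'_def)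
  define \<zeta> where "\<zeta> p y = bump p (r p) y / S y" for p y
  define D\<zeta> where "D\<zeta> p y v = (bump_deriv p (r p) y v * S y - bump p (r p) y * DS y v) / (S y * S y)" for p y v
  have der\<zeta>: "(\<zeta> p has_derivative D\<zeta> p y) (at y)" if "y \<in> U'" for p y
    unfolding \<zeta>_def[abs_def] D\<zeta>_def[abs_def]
    using has_derivative_divide'[OF has_derivative_bump derS] that by (auto simp: U'_def)
  define Y where "Y p y = \<zeta> p y *\<^sub>R X y" for p y
  define DY where "DY p y v = \<zeta> p y *\<^sub>R DX y v + D\<zeta> p y v *\<^sub>R X y" for p y v
  have derY: "(Y p has_derivative DY p y) (at y)" if y: "y \<in> U'" for p y
  proof -
    have "y \<in> U" using y by (simp add: U'_def)
    from has_derivative_scaleR[OF der\<zeta>[OF y] DX[OF this]] show ?thesis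
      unfolding Y_def[abs_def] DY_def[abs_def] .
  qed
  have contX: "continuous_on U' X"
    using DX by (intro continuous_at_imp_continuous_on ballI) (auto simp: U'_def intro: has_derivative_continuous)
  have S_ne: "\<forall>y\<in>U'. S y \<noteq> 0" "\<forall>y\<in>U'. S y * S y \<noteq> 0" by (auto simp: U'_def)
  have contDY: "continuous_on U' (\<lambda>y. DY p y i)" if "i \<in> Basis" for p i
  proof -
    have "continuous_on U' (\<lambda>y. DX y i)"
      by (rule continuous_on_subset[OF cont_DX[OF that]]) (auto simp: U'_def)
    then show ?thesis
      unfolding DY_def \<zeta>_def D\<zeta>_def
      by (intro continuous_intros contX contS contDS continuous_on_bump continuous_on_bump_deriv S_ne)
  qed
  have local: "has_bochner_integral h (\<lambda>x. indicator (K \<inter> cball p (r p)) x * tangential_divergence_defect N DN (Y p) (DY p) x) 0"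
    if p: "p \<in> P" for p
  proof -
    have pK: "p \<in> K" using P p by blast
    obtain D \<pi> b \<sigma> where "curved_chart M (V p) D N \<pi> b DN \<sigma>" using V[OF pK] by blast
    then interpret curved_chart M "V p" D N \<pi> b DN \<sigma> .
    interpret hausdorff_curved M "V p" D N \<pi> b DN \<sigma> h n ..
    show ?thesis
    proof (rule local_divergence_theorem[OF openU' _ _ derY contDY])
      show "compact (K \<inter> cball p (r p))" using K by (intro compact_Int_closed) auto
      show "K \<inter> cball p (r p) \<subseteq> M \<inter> V p \<inter> U'" using r(2)[OF pK] K KU' by blast
      show "Y p x = 0" if "x \<in> M \<inter> V p" "x \<notin> K \<inter> cball p (r p)" for x
      proof (cases "x \<in> K")
        case False
        then show ?thesis using X0 that by (simp add: Y_def)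
      next
        case True
        then have "bump p (r p) x = 0" using that r(1)[OF pK]
          by (intro bump_outside) (auto simp: dist_norm norm_minus_commute)
        then show ?thesis by (simp add: Y_def \<zeta>_def)
      qed
    qed
  qed
  have "has_bochner_integral h
      (\<lambda>x. \<Sum>p\<in>P. indicator (K \<inter> cball p (r p)) x * tangential_divergence_defect N DN (Y p) (DY p) x) (\<Sum>p\<in>P. 0)"
    by (intro has_bochner_integral_sum local)
  moreover have "(\<Sum>p\<in>P. indicator (K \<inter> cball p (r p)) x * tangential_divergence_defect N DN (Y p) (DY p) x)
      = indicator K x * tangential_divergence_defect N DN X DX x" for x
  proof (cases "x \<in> K")
    case True
    have "(\<Sum>p\<in>P. indicator (K \<inter> cball p (r p)) x * tangential_divergence_defect N DN (Y p) (DY p) x) =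
        (\<Sum>p\<in>P. tangential_divergence_defect N DN (Y p) (DY p) x)"
    proof (intro sum.cong refl)
      fix p assume p: "p \<in> P"
      show "indicator (K \<inter> cball p (r p)) x * tangential_divergence_defect N DN (Y p) (DY p) x =
        tangential_divergence_defect N DN (Y p) (DY p) x"
      proof (cases "x \<in> cball p (r p)")
        case False
        then have "r p \<le> norm (x - p)" "0 \<le> r p"
          using r(1)[of p] p P by (auto simp: dist_norm norm_minus_commute intro: less_imp_le)
        note b = bump_outside[OF this]
        then have "Y p x = 0" "\<And>v. DY p x v = 0"
          by (simp_all add: Y_def DY_def \<zeta>_def D\<zeta>_def)
        then show ?thesis by (simp add: tangential_divergence_defect_def trace_tangent_def)
      qed (simp add: True)
    qed
    also have "\<dots> = trace_tangent (N x) (\<lambda>v. \<Sum>p\<in>P. DY p x v) - trace_tangent (N x) (DN x) * ((\<Sum>p\<in>P. Y p x) \<bullet> N x)"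
      by (simp add: tangential_divergence_defect_def trace_tangent_def sum_subtractf inner_sum_left
          sum_distrib_left sum.swap[of _ P Basis])
    also have "(\<Sum>p\<in>P. Y p x) = X x"
    proof -
      have "(\<Sum>p\<in>P. \<zeta> p x) = 1"
        using S_pos[OF True] by (simp add: \<zeta>_def S_def[symmetric] flip: sum_divide_distrib)
      then show ?thesis by (simp add: Y_def flip: scaleR_sum_left)
    qed
    also have "(\<lambda>v. \<Sum>p\<in>P. DY p x v) = DX x"
    proof
      fix v
      have "(\<Sum>p\<in>P. \<zeta> p x) = 1"
        using S_pos[OF True] by (simp add: \<zeta>_def S_def[symmetric] flip: sum_divide_distrib)
      moreover have "(\<Sum>p\<in>P. D\<zeta> p x v) = 0"
        by (simp add: D\<zeta>_def sum_subtractf DS_def[symmetric] S_def[symmetric] flip: sum_divide_distrib sum_distrib_right)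
      ultimately show "(\<Sum>p\<in>P. DY p x v) = DX x v"
        by (simp add: DY_def sum.distrib flip: scaleR_sum_left)
    qed
    finally show ?thesis using True by (simp add: tangential_divergence_defect_def)
  qed simp
  ultimately show ?thesis by simp
qed

section \<open>Existence of charts\<close>

text \<open>The second difference is the increment in direction \<open>u\<close> of s \<mapsto> F (x
  + s u + t v) - F (x + s u). The mean value theorem turns it into a difference of gradients,
  expanded to first order at \<open>x\<close>.\<close>

lemma second_difference_estimate:
  fixes F :: "'a::euclidean_space \<Rightarrow> real"
  assumes U: "open U" "x \<in> U"
    and dF: "\<And>y. y \<in> U \<Longrightarrow> (F has_derivative (\<lambda>v. gF y \<bullet> v)) (at y)"
    and dg: "(gF has_derivative H) (at x)" and \<epsilon>: "\<epsilon> > 0"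
  shows "\<exists>\<delta>>0. \<forall>t. 0 < t \<longrightarrow> t < \<delta> \<longrightarrow>
    \<bar>F (x + t *\<^sub>R u + t *\<^sub>R v) - F (x + t *\<^sub>R u) - F (x + t *\<^sub>R v) + F x - t\<^sup>2 * (H v \<bullet> u)\<bar> \<le> \<epsilon> * t\<^sup>2"
proof -
  have linH: "linear H" using dg by (rule has_derivative_linear)
  \<comment> \<open>The two remainders are evaluated at points whose norms add up to at most t (2
    |u| + |v|), and are paired with \<open>u\<close>; adding 1 keeps \<open>c\<close>
    positive.\<close>
  define c where "c = (2 * norm u + norm v) * norm u + 1"
  have c: "c > 0" unfolding c_def by (intro add_nonneg_pos mult_nonneg_nonneg) auto
  have "\<epsilon> / c > 0" using \<epsilon> c by simp
  then obtain d where d: "d > 0" "\<And>w. norm w < d \<Longrightarrow> norm (gF (x + w) - gF x - H w) \<le> \<epsilon> / c * norm w"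
    using dg unfolding has_derivative_at_alt by (metis add_diff_cancel_left')
  obtain e where e: "e > 0" "ball x e \<subseteq> U" using U open_contains_ball by blast
  \<comment> \<open>Keeps every point x + s u + r v with s, r \<le> t inside \<open>U\<close> and
    inside the range of the first-order expansion.\<close>
  define \<delta> where "\<delta> = min d e / (norm u + norm v + 1)"
  have pos: "norm u + norm v + 1 > 0" by (intro add_nonneg_pos) auto
  show ?thesis
  proof (intro exI[of _ \<delta>] conjI allI impI)
    show "\<delta> > 0" using d e pos by (simp add: \<delta>_def)
    fix t :: real assume t: "0 < t" "t < \<delta>"
    have small: "norm (s *\<^sub>R u + r *\<^sub>R v) < min d e" if "0 \<le> s" "s \<le> t" "0 \<le> r" "r \<le> t" for s r
    proof -
      have "norm (s *\<^sub>R u + r *\<^sub>R v) \<le> s * norm u + r * norm v"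
        using norm_triangle_ineq[of "s *\<^sub>R u" "r *\<^sub>R v"] that by simp
      also have "\<dots> \<le> t * norm u + t * norm v"
        using that by (intro add_mono mult_right_mono) auto
      also have "\<dots> < t * (norm u + norm v + 1)" using t by (simp add: algebra_simps)
      also have "\<dots> < \<delta> * (norm u + norm v + 1)" using t pos by (intro mult_strict_right_mono) auto
      also have "\<dots> = min d e" using pos unfolding \<delta>_def by (intro nonzero_eq_divide_eq[THEN iffD1, OF _ refl]) simp
      finally show ?thesis .
    qed
    have inU: "x + (s *\<^sub>R u + r *\<^sub>R v) \<in> U" if "0 \<le> s" "s \<le> t" "0 \<le> r" "r \<le> t" for s r
    proof -
      have "x + (s *\<^sub>R u + r *\<^sub>R v) \<in> ball x e"
      proof -
        have "dist x (x + w) = norm w" for w by (simp add: dist_norm)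
        moreover have "norm (s *\<^sub>R u + r *\<^sub>R v) < e" using small[OF that] by (rule less_le_trans) simp
        ultimately show ?thesis unfolding mem_ball by (simp only:)
      qed
      then show ?thesis using e(2) by blast
    qed
    define \<phi> where "\<phi> s = F (x + (s *\<^sub>R u + t *\<^sub>R v)) - F (x + (s *\<^sub>R u + 0 *\<^sub>R v))" for s
    have der: "((\<lambda>s. F (x + (s *\<^sub>R u + r *\<^sub>R v))) has_derivative (\<lambda>h. gF (x + (s *\<^sub>R u + r *\<^sub>R v)) \<bullet> (h *\<^sub>R u))) (at s within {0..t})"
      if "0 \<le> s" "s \<le> t" "0 \<le> r" "r \<le> t" for s r
    proof -
      have "((\<lambda>s. x + (s *\<^sub>R u + r *\<^sub>R v)) has_derivative (\<lambda>h. h *\<^sub>R u)) (at s within {0..t})"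
        by (auto intro!: derivative_eq_intros)
      then show ?thesis by (rule has_derivative_compose) (rule dF[OF inU[OF that]])
    qed
    have "(\<phi> has_derivative (\<lambda>h. gF (x + (s *\<^sub>R u + t *\<^sub>R v)) \<bullet> (h *\<^sub>R u) - gF (x + (s *\<^sub>R u + 0 *\<^sub>R v)) \<bullet> (h *\<^sub>R u))) (at s within {0..t})"
      if "0 \<le> s" "s \<le> t" for s
      unfolding \<phi>_def by (intro has_derivative_diff der that) (use t in auto)
    from mvt_simple[OF t(1) this]
    obtain s where s: "s \<in> {0<..<t}" "\<phi> t - \<phi> 0 = gF (x + (s *\<^sub>R u + t *\<^sub>R v)) \<bullet> ((t - 0) *\<^sub>R u) - gF (x + (s *\<^sub>R u + 0 *\<^sub>R v)) \<bullet> ((t - 0) *\<^sub>R u)"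
      by auto
    define a where "a = s *\<^sub>R u + t *\<^sub>R v"
    define b where "b = s *\<^sub>R u + 0 *\<^sub>R v"
    have sm: "norm a < d" "norm b < d" using small[of s t] small[of s 0] s t by (auto simp: a_def b_def)
    define ra where "ra = gF (x + a) - gF x - H a"
    define rb where "rb = gF (x + b) - gF x - H b"
    have ra: "norm ra \<le> \<epsilon> / c * norm a" and rb: "norm rb \<le> \<epsilon> / c * norm b"
      unfolding ra_def rb_def using d(2) sm by auto
    have "a = b + t *\<^sub>R v" by (simp add: a_def b_def)
    then have "H a = H b + t *\<^sub>R H v" by (simp add: linear_add[OF linH] linear_scale[OF linH])
    then have g: "gF (x + a) - gF (x + b) = t *\<^sub>R H v + (ra - rb)" by (simp add: ra_def rb_def)
    have "\<phi> t - \<phi> 0 = t * ((gF (x + a) - gF (x + b)) \<bullet> u)"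
      unfolding s(2) a_def[symmetric] b_def[symmetric] by (simp add: inner_diff_left algebra_simps)
    also have "\<dots> = t\<^sup>2 * (H v \<bullet> u) + t * ((ra - rb) \<bullet> u)"
      unfolding g by (simp add: inner_add_left power2_eq_square algebra_simps)
    finally have *: "\<phi> t - \<phi> 0 - t\<^sup>2 * (H v \<bullet> u) = t * ((ra - rb) \<bullet> u)" by simp
    have nab: "norm a + norm b \<le> t * (2 * norm u + norm v)"
    proof -
      have "norm a \<le> s * norm u + t * norm v" "norm b \<le> s * norm u"
        using norm_triangle_ineq[of "s *\<^sub>R u" "t *\<^sub>R v"] s t by (auto simp: a_def b_def)
      moreover have "s * norm u \<le> t * norm u" using s by (intro mult_right_mono) auto
      ultimately show ?thesis by (simp add: algebra_simps)
    qed
    have "\<bar>t * ((ra - rb) \<bullet> u)\<bar> \<le> t * (norm (ra - rb) * norm u)"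
      using t Cauchy_Schwarz_ineq2[of "ra - rb" u] by (simp add: abs_mult)
    also have "\<dots> \<le> t * ((\<epsilon> / c * (norm a + norm b)) * norm u)"
      using norm_triangle_ineq4[of ra rb] ra rb t by (intro mult_left_mono mult_right_mono) (auto simp: distrib_left)
    also have "\<dots> \<le> t * ((\<epsilon> / c * (t * (2 * norm u + norm v))) * norm u)"
      using nab t \<epsilon> c by (intro mult_left_mono mult_right_mono) auto
    also have "\<dots> = (\<epsilon> / c) * t\<^sup>2 * (c - 1)"
      by (simp add: c_def power2_eq_square)
    also have "\<dots> \<le> (\<epsilon> / c) * t\<^sup>2 * c"
      using \<epsilon> c by (intro mult_left_mono) auto
    also have "\<dots> = \<epsilon> * t\<^sup>2" using c by simp
    finally have "\<bar>\<phi> t - \<phi> 0 - t\<^sup>2 * (H v \<bullet> u)\<bar> \<le> \<epsilon> * t\<^sup>2" unfolding * .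
    then show "\<bar>F (x + t *\<^sub>R u + t *\<^sub>R v) - F (x + t *\<^sub>R u) - F (x + t *\<^sub>R v) + F x - t\<^sup>2 * (H v \<bullet> u)\<bar> \<le> \<epsilon> * t\<^sup>2"
      by (simp add: \<phi>_def algebra_simps)
  qed
qed

text \<open>The second difference is symmetric in \<open>u\<close> and \<open>v\<close>, yet
  approximates both t^2 (H v \<bullet> u) and t^2 (H u \<bullet> v) up to o(t^2).\<close>

lemma symmetric_second_derivative:
  fixes F :: "'a::euclidean_space \<Rightarrow> real"
  assumes U: "open U" "x \<in> U"
    and dF: "\<And>y. y \<in> U \<Longrightarrow> (F has_derivative (\<lambda>v. gF y \<bullet> v)) (at y)"
    and dg: "(gF has_derivative H) (at x)"
  shows "H u \<bullet> v = H v \<bullet> u"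
proof -
  have "\<bar>H u \<bullet> v - H v \<bullet> u\<bar> \<le> 0 + \<epsilon>" if \<epsilon>: "\<epsilon> > 0" for \<epsilon>
  proof -
    define f where "f t = F (x + t *\<^sub>R u + t *\<^sub>R v) - F (x + t *\<^sub>R u) - F (x + t *\<^sub>R v) + F x" for t
    obtain d1 where d1: "d1 > 0" "\<And>t. 0 < t \<Longrightarrow> t < d1 \<Longrightarrow> \<bar>f t - t\<^sup>2 * (H v \<bullet> u)\<bar> \<le> (\<epsilon> / 2) * t\<^sup>2"
      using second_difference_estimate[OF U dF dg, of "\<epsilon> / 2" u v] \<epsilon> unfolding f_def by auto
    obtain d2 where d2: "d2 > 0" "\<And>t. 0 < t \<Longrightarrow> t < d2 \<Longrightarrow> \<bar>f t - t\<^sup>2 * (H u \<bullet> v)\<bar> \<le> (\<epsilon> / 2) * t\<^sup>2"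
    proof -
      have "F (x + t *\<^sub>R v + t *\<^sub>R u) - F (x + t *\<^sub>R v) - F (x + t *\<^sub>R u) + F x = f t" for t
        by (simp add: f_def algebra_simps)
      then show ?thesis
        using second_difference_estimate[OF U dF dg, of "\<epsilon> / 2" v u] \<epsilon> that by auto
    qed
    define t where "t = min d1 d2 / 2"
    have t: "0 < t" "t < d1" "t < d2" using d1 d2 by (auto simp: t_def min_def)
    have "\<bar>t\<^sup>2 * (H u \<bullet> v) - t\<^sup>2 * (H v \<bullet> u)\<bar> \<le> (\<epsilon> / 2) * t\<^sup>2 + (\<epsilon> / 2) * t\<^sup>2"
      using d1(2)[OF t(1,2)] d2(2)[OF t(1,3)] by linarith
    also have "\<bar>t\<^sup>2 * (H u \<bullet> v) - t\<^sup>2 * (H v \<bullet> u)\<bar> = t\<^sup>2 * \<bar>H u \<bullet> v - H v \<bullet> u\<bar>"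
      by (simp add: abs_mult flip: right_diff_distrib)
    finally have "t\<^sup>2 * \<bar>H u \<bullet> v - H v \<bullet> u\<bar> \<le> t\<^sup>2 * \<epsilon>" by (simp add: algebra_simps)
    then show ?thesis using t by (simp add: mult_le_cancel_left)
  qed
  then have "\<bar>H u \<bullet> v - H v \<bullet> u\<bar> \<le> 0" by (rule field_le_epsilon)
  then show ?thesis by simp
qed

text \<open>The chart comes from the inverse function theorem for \<open>x \<mapsto> drop_coord b x + F x b\<close>.\<close>
lemma curved_chart_exists:
  fixes F :: "'a::euclidean_space \<Rightarrow> real"
  assumes p: "p \<in> M" "p \<in> U" and U: "open U" and MU: "M \<inter> U = {x\<in>U. F x = 0}"
    and dF: "\<And>x. x \<in> U \<Longrightarrow> (F has_derivative (\<lambda>v. gF x \<bullet> v)) (at x)"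
    and dg: "\<And>x. x \<in> U \<Longrightarrow> (gF has_derivative HF x) (at x)"
    and gF0: "\<And>x. x \<in> M \<inter> U \<Longrightarrow> gF x \<noteq> 0"
    and W: "open W" "M \<subseteq> W"
    and dN: "\<And>x. x \<in> W \<Longrightarrow> (N has_derivative DN x) (at x)"
    and cDN: "\<And>i. i \<in> Basis \<Longrightarrow> continuous_on W (\<lambda>x. DN x i)"
    and nN: "\<And>x. x \<in> M \<Longrightarrow> norm (N x) = 1"
    and par: "\<And>x. x \<in> M \<inter> U \<Longrightarrow> gF x = (gF x \<bullet> N x) *\<^sub>R N x"
  shows "\<exists>V D \<pi> b \<sigma>. p \<in> V \<and> curved_chart M V D N \<pi> b DN \<sigma>"
proof -
  have contg: "continuous_on U gF"
    using dg by (intro continuous_at_imp_continuous_on ballI) (blast intro: has_derivative_continuous)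
  have contN: "continuous_on W N"
    using dN by (intro continuous_at_imp_continuous_on ballI) (blast intro: has_derivative_continuous)
  \<comment> \<open>A coordinate direction transversal to \<open>M\<close> at
    \<open>p\<close>.\<close>
  obtain b where b: "b \<in> Basis" "gF p \<bullet> b \<noteq> 0"
    using gF0[of p] p euclidean_all_zero_iff[of "gF p"] by blast
  have bb: "b \<bullet> b = 1" using b by simp
  define \<sigma> where "\<sigma> = sgn (N p \<bullet> b)"
  have "N p \<bullet> b \<noteq> 0"
  proof
    assume "N p \<bullet> b = 0"
    then have "gF p \<bullet> b = 0" using par[of p] p by (metis IntI inner_scaleR_left mult_zero_right)
    then show False using b by simp
  qed
  then have \<sigma>: "\<sigma> * (N p \<bullet> b) > 0" "\<sigma> = 1 \<or> \<sigma> = -1"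
    by (auto simp: \<sigma>_def sgn_if)
  \<comment> \<open>On this neighbourhood transversality persists and N \<bullet> b keeps the sign
    it has at \<open>p\<close>.\<close>
  define U1 where "U1 = (U \<inter> gF -` {v. v \<bullet> b \<noteq> 0}) \<inter> (W \<inter> N -` {v. \<sigma> * (v \<bullet> b) > 0})"
  have openU1: "open U1"
    unfolding U1_def
    by (intro open_Int continuous_open_preimage contg contN U W(1) open_Collect_neq open_Collect_less continuous_intros)
  have U1: "x \<in> U" "x \<in> W" "gF x \<bullet> b \<noteq> 0" "\<sigma> * (N x \<bullet> b) > 0" if "x \<in> U1" for x
    using that by (auto simp: U1_def)
  have pU1: "p \<in> U1" using p b \<sigma> W by (auto simp: U1_def)
  \<comment> \<open>Replaces the \<open>b\<close>-coordinate of x by F x, so that \<open>M\<close>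
    becomes a piece of the hyperplane orthogonal to \<open>b\<close>.\<close>
  define \<Psi> where "\<Psi> x = x + (F x - x \<bullet> b) *\<^sub>R b" for x
  define D\<Psi> where "D\<Psi> x = id_blinfun + (blinfun_scaleR_left b o\<^sub>L blinfun_inner_left (gF x - b))" for x
  have D\<Psi>_apply: "blinfun_apply (D\<Psi> x) v = v + (gF x \<bullet> v - v \<bullet> b) *\<^sub>R b" for x v
    by (simp add: D\<Psi>_def plus_blinfun.rep_eq inner_diff_right inner_commute)
  \<comment> \<open>The derivative is the identity plus a rank one map with image spanned by
    \<open>b\<close>, so its inverse has the same form and can be written down.\<close>
  define inv\<Psi> where "inv\<Psi> = id_blinfun + (blinfun_scaleR_left b o\<^sub>L blinfun_inner_left ((1 / (gF p \<bullet> b)) *\<^sub>R (b - gF p)))"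
  have inv: "inv\<Psi> o\<^sub>L D\<Psi> p = id_blinfun"
  proof (rule blinfun_eqI)
    fix v
    define q where "q = gF p \<bullet> v - v \<bullet> b"
    have v1: "blinfun_apply (D\<Psi> p) v = v + q *\<^sub>R b" by (simp only: D\<Psi>_apply q_def)
    have i1: "blinfun_apply inv\<Psi> w = w + ((1 / (gF p \<bullet> b)) * (w \<bullet> b - w \<bullet> gF p)) *\<^sub>R b" for w
      by (simp add: inv\<Psi>_def plus_blinfun.rep_eq inner_diff_right)
    have "(v + q *\<^sub>R b) \<bullet> b - (v + q *\<^sub>R b) \<bullet> gF p = - q * (gF p \<bullet> b)"
    proof -
      have "(v + q *\<^sub>R b) \<bullet> b = gF p \<bullet> v"
        unfolding inner_add_left inner_scaleR_left bb q_def by simp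
      moreover have "(v + q *\<^sub>R b) \<bullet> gF p = gF p \<bullet> v + q * (gF p \<bullet> b)"
        unfolding inner_add_left inner_scaleR_left inner_commute[of v "gF p"] inner_commute[of b "gF p"] ..
      ultimately show ?thesis by simp
    qed
    then have "(1 / (gF p \<bullet> b)) * ((v + q *\<^sub>R b) \<bullet> b - (v + q *\<^sub>R b) \<bullet> gF p) = - q"
      using b(2) by simp
    then show "blinfun_apply (inv\<Psi> o\<^sub>L D\<Psi> p) v = blinfun_apply id_blinfun v"
      by (simp only: blinfun_apply_blinfun_compose v1 i1) simp
  qed
  have der\<Psi>: "(\<Psi> has_derivative blinfun_apply (D\<Psi> x)) (at x)" if "x \<in> U1" for x
    unfolding \<Psi>_def D\<Psi>_apply
    by (rule derivative_eq_intros dF[OF U1(1)[OF that]] refl)+ (simp add: D\<Psi>_apply fun_eq_iff)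
  have cont\<Psi>: "continuous_on U1 D\<Psi>"
  proof -
    have "continuous_on U1 gF" by (rule continuous_on_subset[OF contg]) (auto simp: U1_def)
    then have "continuous_on U1 (\<lambda>x. gF x - b)" by (intro continuous_on_diff continuous_on_const)
    then have "continuous_on U1 (\<lambda>x. blinfun_inner_left (gF x - b))"
      by (rule bounded_linear.continuous_on[OF bounded_linear_blinfun_inner_left])
    then have "continuous_on U1 (\<lambda>x. blinfun_scaleR_left b o\<^sub>L blinfun_inner_left (gF x - b))"
      by (rule bounded_bilinear.continuous_on[OF bounded_bilinear_blinfun_compose continuous_on_const])
    then show ?thesis unfolding D\<Psi>_def by (intro continuous_on_add continuous_on_const)
  qed
  obtain V Y g g' where V: "open V" "V \<subseteq> U1" "p \<in> V" and Y: "open Y" "\<Psi> p \<in> Y"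
    and hom: "homeomorphism V Y \<Psi> g"
    and derg: "\<And>y. y \<in> Y \<Longrightarrow> (g has_derivative (g' y)) (at y)"
    and g': "\<And>y. y \<in> Y \<Longrightarrow> g' y = inv (blinfun_apply (D\<Psi> (g y)))"
    and bij: "\<And>y. y \<in> Y \<Longrightarrow> bij (blinfun_apply (D\<Psi> (g y)))"
  proof (rule inverse_function_theorem[where f = \<Psi> and f' = D\<Psi> and U = U1 and ?x0.0 = p and invf = inv\<Psi>])
    fix U' V g g'
    assume "open U'" "U' \<subseteq> U1" "p \<in> U'" "open V" "\<Psi> p \<in> V" "homeomorphism U' V \<Psi> g"
      "\<And>y. y \<in> V \<Longrightarrow> (g has_derivative (g' y)) (at y)"
      "\<And>y. y \<in> V \<Longrightarrow> g' y = inv (blinfun_apply (D\<Psi> (g y)))"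
      "\<And>y. y \<in> V \<Longrightarrow> bij (blinfun_apply (D\<Psi> (g y)))"
    then show thesis by (rule that)
  next
    show "open U1" "p \<in> U1" by (rule openU1 pU1)+
    show "(\<Psi> has_derivative blinfun_apply (D\<Psi> x)) (at x)" if "x \<in> U1" for x by (rule der\<Psi>[OF that])
    show "continuous_on U1 D\<Psi>" by (rule cont\<Psi>)
    show "inv\<Psi> o\<^sub>L D\<Psi> p = id_blinfun" by (rule inv)
  qed
  have g_mem: "g y \<in> V" "\<Psi> (g y) = y" if "y \<in> Y" for y
    using hom that by (auto simp: homeomorphism_def)
  have \<Psi>_mem: "\<Psi> x \<in> Y" "g (\<Psi> x) = x" if "x \<in> V" for x
    using hom that by (auto simp: homeomorphism_def)
  have drop\<Psi>: "drop_coord b (\<Psi> x) = drop_coord b x" for x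
    by (simp add: \<Psi>_def drop_coord_def inner_add_left inner_diff_left bb algebra_simps)
  have \<Psi>b: "\<Psi> x \<bullet> b = F x" for x
    by (simp add: \<Psi>_def inner_add_left bb)
  have drop_drop: "drop_coord b (drop_coord b x) = drop_coord b x" for x
    using b by (intro drop_coord_idem) simp
  define D where "D = {x. drop_coord b x \<in> Y}"
  \<comment> \<open>The value 0 outside \<open>D\<close> makes \<pi> a total Borel function.\<close>
  define \<pi> where "\<pi> x = (if x \<in> D then g (drop_coord b x) else 0)" for x
  have openD: "open D"
    using open_vimage[OF Y(1) continuous_on_drop_coord] by (simp add: D_def vimage_def)
  have pi_facts: "\<pi> x \<in> V" "\<pi> x \<in> M" "drop_coord b (\<pi> x) = drop_coord b x" if x: "x \<in> D" for x
  proof -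
    have y: "drop_coord b x \<in> Y" using x by (simp add: D_def)
    have eq: "\<pi> x = g (drop_coord b x)" using x by (simp add: \<pi>_def)
    show "\<pi> x \<in> V" using g_mem[OF y] eq by simp
    have "F (\<pi> x) = 0" using \<Psi>b[of "\<pi> x"] g_mem(2)[OF y] b eq by simp
    then show "\<pi> x \<in> M" using MU \<open>\<pi> x \<in> V\<close> V(2) U1(1) by blast
    show "drop_coord b (\<pi> x) = drop_coord b x"
      using drop\<Psi>[of "\<pi> x"] g_mem(2)[OF y] eq drop_drop by simp
  qed
  have MV: "x \<in> U" "x \<in> W" "gF x \<bullet> b \<noteq> 0" "\<sigma> * (N x \<bullet> b) > 0" "F x = 0" "x \<in> M \<inter> U"
    if "x \<in> M \<inter> V" for x
    using that U1 V(2) MU by blast+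
  have idMV: "x \<in> D" "\<pi> x = x" if x: "x \<in> M \<inter> V" for x
  proof -
    have "\<Psi> x \<bullet> b = 0" unfolding \<Psi>b by (rule MV(5)[OF x])
    from drop_coord_idem[OF this] have eq: "drop_coord b x = \<Psi> x" by (simp only: drop\<Psi>)
    have xV: "x \<in> V" using x by simp
    show xD: "x \<in> D" unfolding D_def mem_Collect_eq eq by (rule \<Psi>_mem(1)[OF xV])
    show "\<pi> x = x" unfolding \<pi>_def if_P[OF xD] eq by (rule \<Psi>_mem(2)[OF xV])
  qed
  have lam: "gF x \<bullet> N x \<noteq> 0" if x: "x \<in> M \<inter> V" for x
  proof
    assume 0: "gF x \<bullet> N x = 0"
    have "gF x = 0" using par[OF MV(6)[OF x]] unfolding 0 by simp
    then show False using gF0[OF MV(6)[OF x]] by simp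
  qed
  have der_pi: "(\<pi> has_derivative (\<lambda>v. v - (v \<bullet> N (\<pi> x) / (b \<bullet> N (\<pi> x))) *\<^sub>R b)) (at x)" if x: "x \<in> D" for x
  proof -
    define q where "q = \<pi> x"
    have q: "q \<in> M \<inter> V" using pi_facts[OF x] by (simp add: q_def)
    have y: "drop_coord b x \<in> Y" using x by (simp add: D_def)
    have qg: "q = g (drop_coord b x)" using x by (simp add: q_def \<pi>_def)
    have "(drop_coord b has_derivative drop_coord b) (at x)"
      unfolding drop_coord_def[abs_def] by (auto intro!: derivative_eq_intros)
    then have "((\<lambda>x. g (drop_coord b x)) has_derivative (\<lambda>v. g' (drop_coord b x) (drop_coord b v))) (at x)"
      by (rule has_derivative_compose) (rule derg[OF y])
    then have 1: "(\<pi> has_derivative (\<lambda>v. g' (drop_coord b x) (drop_coord b v))) (at x)"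
      by (rule has_derivative_transform_within_open[OF _ openD x]) (simp add: \<pi>_def)
    have "g' (drop_coord b x) (drop_coord b v) = v - (v \<bullet> N q / (b \<bullet> N q)) *\<^sub>R b" for v
    proof -
      \<comment> \<open>\<open>l\<close> is the tangent vector with the same projection along
        \<open>b\<close> as v. As the gradient of \<open>F\<close> annihilates it, the derivative of
        \<Psi> maps it to \<open>drop_coord b v\<close>; inverting gives the derivative of
        \<pi>.\<close>
      define l where "l = v - (v \<bullet> N q / (b \<bullet> N q)) *\<^sub>R b"
      have "b \<bullet> N q \<noteq> 0" using MV(4)[OF q] by (auto simp: inner_commute)
      then have lN: "l \<bullet> N q = 0" by (simp add: l_def inner_diff_left)
      have "gF q \<bullet> l = ((gF q \<bullet> N q) *\<^sub>R N q) \<bullet> l"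
        by (rule arg_cong[where f = "\<lambda>w. w \<bullet> l", OF par[OF MV(6)[OF q]]])
      then have "gF q \<bullet> l = (gF q \<bullet> N q) * (N q \<bullet> l)" by (simp only: inner_scaleR_left)
      then have "gF q \<bullet> l = 0" using lN by (simp add: inner_commute)
      then have "blinfun_apply (D\<Psi> q) l = drop_coord b l"
        by (simp add: D\<Psi>_apply drop_coord_def)
      also have "\<dots> = drop_coord b v"
        using bb by (simp add: l_def drop_coord_def inner_diff_left algebra_simps)
      finally have "inv (blinfun_apply (D\<Psi> q)) (drop_coord b v) = l"
        using inv_f_f[OF bij_is_inj[OF bij[OF y]], of l] unfolding qg by simp
      then show ?thesis using g'[OF y] qg by (simp add: l_def)
    qed
    then show ?thesis using 1 by (simp add: q_def)
  qed
  have "curved_chart M V D N \<pi> b DN \<sigma>"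
  proof
    show "b \<in> Basis" "open V" "open D" by fact+
    show "\<pi> \<in> borel_measurable borel"
    proof -
      have "continuous_on D (\<lambda>x. g (drop_coord b x))"
        by (rule continuous_on_compose2[OF homeomorphism_cont2[OF hom] continuous_on_drop_coord])
          (auto simp: D_def)
      then have "(\<lambda>x. indicator D x *\<^sub>R g (drop_coord b x)) \<in> borel_measurable borel"
        using openD by (intro borel_measurable_continuous_on_indicator) auto
      moreover have "(\<lambda>x. indicator D x *\<^sub>R g (drop_coord b x)) = \<pi>"
        by (auto simp: \<pi>_def fun_eq_iff)
      ultimately show ?thesis by simp
    qed
    show "drop_coord b x \<in> D \<longleftrightarrow> x \<in> D" "\<pi> (drop_coord b x) = \<pi> x" for x
      by (auto simp: D_def \<pi>_def drop_drop)
    show "\<pi> x \<in> M \<inter> V" "drop_coord b (\<pi> x) = drop_coord b x" if "x \<in> D" for x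
      using pi_facts[OF that] by auto
    show "x \<in> D" "\<pi> x = x" if "x \<in> M \<inter> V" for x by (fact idMV[OF that])+
    show "norm (N x) = 1" if "x \<in> M \<inter> V" for x using nN that by simp
    show "N x \<bullet> b \<noteq> 0" if "x \<in> M \<inter> V" for x using MV(4)[OF that] by auto
    show "sgn (N x \<bullet> b) = \<sigma>" if "x \<in> M \<inter> V" for x
      using MV(4)[OF that] \<sigma>(2) by (auto simp: sgn_if)
    show "continuous_on (M \<inter> V) N" by (rule continuous_on_subset[OF contN]) (use W in auto)
    show "(\<pi> has_derivative (\<lambda>v. v - (v \<bullet> N (\<pi> x) / (b \<bullet> N (\<pi> x))) *\<^sub>R b)) (at x)" if "x \<in> D" for x
      by (rule der_pi[OF that])
    show "(N has_derivative DN x) (at x)" if "x \<in> M \<inter> V" for x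
      using dN MV(2)[OF that] by blast
    show "continuous_on (M \<inter> V) (\<lambda>x. DN x i)" if "i \<in> Basis" for i
      by (rule continuous_on_subset[OF cDN[OF that]]) (use W in auto)
    show "\<exists>r>0. \<forall>y\<in>M \<inter> V \<inter> ball x r. \<forall>z\<in>M \<inter> V \<inter> ball x r. \<bar>(y - z) \<bullet> N x\<bar> \<le> \<epsilon> * norm (y - z)"
      if x: "x \<in> M \<inter> V" and \<epsilon>: "\<epsilon> > 0" for x \<epsilon>
    proof -
      \<comment> \<open>The estimate is proved for the gradient, which is (gF \<bullet> N) N on
        \<open>M\<close>, and then divided by |gF \<bullet> N|.\<close>
      define \<eta> where "\<eta> = \<epsilon> * \<bar>gF x \<bullet> N x\<bar>"
      have \<eta>: "\<eta> > 0" using lam[OF x] \<epsilon> by (simp add: \<eta>_def)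
      have xU: "x \<in> U" by (rule MV(1)[OF x])
      obtain r1 where r1: "r1 > 0" "\<And>y. y \<in> U \<Longrightarrow> dist y x < r1 \<Longrightarrow> dist (gF y) (gF x) < \<eta>"
        using contg xU \<eta> unfolding continuous_on_iff by blast
      obtain r2 where r2: "r2 > 0" "ball x r2 \<subseteq> U" using U xU open_contains_ball by blast
      show ?thesis
      proof (intro exI[of _ "min r1 r2"] conjI ballI)
        show "min r1 r2 > 0" using r1 r2 by simp
        fix y z assume y: "y \<in> M \<inter> V \<inter> ball x (min r1 r2)" and z: "z \<in> M \<inter> V \<inter> ball x (min r1 r2)"
        \<comment> \<open>Subtracting the linear part at \<open>x\<close> leaves a function with
          derivative at most \<eta> on a ball. Since \<open>F\<close> vanishes at y and z, only the
          linear part is left in the difference.\<close>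
        have "norm ((F y - gF x \<bullet> y) - (F z - gF x \<bullet> z)) \<le> \<eta> * norm (y - z)"
        proof (rule differentiable_bound[where S = "ball x (min r1 r2)" and f' = "\<lambda>w v. gF w \<bullet> v - gF x \<bullet> v"])
          fix w assume w: "w \<in> ball x (min r1 r2)"
          then have wU: "w \<in> U" using r2 by auto
          show "((\<lambda>w. F w - gF x \<bullet> w) has_derivative (\<lambda>v. gF w \<bullet> v - gF x \<bullet> v)) (at w within ball x (min r1 r2))"
            by (intro has_derivative_diff has_derivative_at_withinI[OF dF[OF wU]])
              (auto intro!: derivative_eq_intros)
          show "onorm (\<lambda>v. gF w \<bullet> v - gF x \<bullet> v) \<le> \<eta>"
          proof (rule onorm_le)
            fix v :: 'a
            have "norm (gF w - gF x) \<le> \<eta>" using r1(2)[OF wU] w by (simp add: dist_norm norm_minus_commute)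
            then have "norm (gF w - gF x) * norm v \<le> \<eta> * norm v" by (rule mult_right_mono) simp
            moreover have "norm (gF w \<bullet> v - gF x \<bullet> v) \<le> norm (gF w - gF x) * norm v"
              unfolding inner_diff_left[symmetric] real_norm_def by (rule Cauchy_Schwarz_ineq2)
            ultimately show "norm (gF w \<bullet> v - gF x \<bullet> v) \<le> \<eta> * norm v" by (rule order_trans[rotated])
          qed
        qed (use y z in auto)
        then have "\<bar>gF x \<bullet> (y - z)\<bar> \<le> \<eta> * norm (y - z)"
          using MV(5) y z by (simp add: inner_diff_right abs_minus_commute)
        moreover have "gF x \<bullet> (y - z) = (gF x \<bullet> N x) * ((y - z) \<bullet> N x)"
        proof -
          have "gF x \<bullet> (y - z) = ((gF x \<bullet> N x) *\<^sub>R N x) \<bullet> (y - z)"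
          by (rule arg_cong[where f = "\<lambda>w. w \<bullet> (y - z)", OF par[OF MV(6)[OF x]]])
        then show ?thesis by (simp only: inner_scaleR_left inner_commute[of "N x"])
      qed
        ultimately have "\<bar>gF x \<bullet> N x\<bar> * \<bar>(y - z) \<bullet> N x\<bar> \<le> \<bar>gF x \<bullet> N x\<bar> * (\<epsilon> * norm (y - z))"
          by (simp only: \<eta>_def abs_mult mult.assoc mult.left_commute[of \<epsilon>])
        then show "\<bar>(y - z) \<bullet> N x\<bar> \<le> \<epsilon> * norm (y - z)"
          using lam[OF x] by (simp add: mult_le_cancel_left)
      qed
    qed
    show "DN x u \<bullet> v = DN x v \<bullet> u" if x: "x \<in> M \<inter> V" and u: "u \<bullet> N x = 0" and v: "v \<bullet> N x = 0" for x u v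
    proof -
      have xD: "x \<in> D" "\<pi> x = x" using idMV[OF x] by auto
      have xU: "x \<in> U" and xW: "x \<in> W" using MV[OF x] by auto
      define P where "P v = v - (v \<bullet> N x / (b \<bullet> N x)) *\<^sub>R b" for v
      have dpi: "(\<pi> has_derivative P) (at x)"
        using der_pi[OF xD(1)] xD by (simp add: P_def[abs_def])
      have d1: "((\<lambda>y. gF (\<pi> y)) has_derivative (\<lambda>v. HF x (P v))) (at x)"
        using has_derivative_compose[OF dpi, of gF "HF x"] dg[OF xU] xD by simp
      have d2: "((\<lambda>y. N (\<pi> y)) has_derivative (\<lambda>v. DN x (P v))) (at x)"
        using has_derivative_compose[OF dpi, of N "DN x"] dN[OF xW] xD by simp
      define l where "l v = gF x \<bullet> DN x (P v) + HF x (P v) \<bullet> N x" for v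
      have d3: "((\<lambda>y. gF (\<pi> y) \<bullet> N (\<pi> y)) has_derivative l) (at x)"
        using has_derivative_inner[OF d1 d2] xD by (simp add: l_def[abs_def])
      have d4: "((\<lambda>y. (gF (\<pi> y) \<bullet> N (\<pi> y)) *\<^sub>R N (\<pi> y)) has_derivative
          (\<lambda>v. (gF x \<bullet> N x) *\<^sub>R DN x (P v) + l v *\<^sub>R N x)) (at x)"
        using has_derivative_scaleR[OF d3 d2] xD by simp
      \<comment> \<open>The identity gF = (gF \<bullet> N) N holds on \<open>M\<close> only, so it
        is differentiated after composition with \<pi>. On tangent vectors it makes the Hessian of
        \<open>F\<close> a nonzero multiple of \<open>DN\<close>, which transfers the
        symmetry.\<close>
      have "((\<lambda>y. (gF (\<pi> y) \<bullet> N (\<pi> y)) *\<^sub>R N (\<pi> y)) has_derivative (\<lambda>v. HF x (P v))) (at x)"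
      proof (rule has_derivative_transform_within_open[OF d1 openD xD(1)])
        fix y assume y: "y \<in> D"
        have "\<pi> y \<in> M \<inter> V" using pi_facts[OF y] by blast
        then show "gF (\<pi> y) = (gF (\<pi> y) \<bullet> N (\<pi> y)) *\<^sub>R N (\<pi> y)" by (rule par[OF MV(6)])
      qed
      then have eq: "HF x (P w) = (gF x \<bullet> N x) *\<^sub>R DN x (P w) + l w *\<^sub>R N x" for w
        using fun_cong[OF has_derivative_unique[OF _ d4], of "\<lambda>v. HF x (P v)" w] by simp
      have *: "HF x w \<bullet> w' = (gF x \<bullet> N x) * (DN x w \<bullet> w')" if "w \<bullet> N x = 0" "w' \<bullet> N x = 0" for w w'
      proof -
        have "P w = w" using that by (simp add: P_def)
        then have "HF x w \<bullet> w' = ((gF x \<bullet> N x) *\<^sub>R DN x w + l w *\<^sub>R N x) \<bullet> w'" using eq[of w] by simp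
        then show ?thesis using that by (simp add: inner_add_left inner_commute[of "N x" w'])
      qed
      have "HF x u \<bullet> v = HF x v \<bullet> u"
        by (rule symmetric_second_derivative[OF U xU dF dg[OF xU]])
      then show ?thesis using *[OF u v] *[OF v u] lam[OF x] by simp
    qed
  qed
  then show ?thesis using V(3) by blast
qed

section \<open>Smooth hypersurfaces\<close>

lemma smooth_onD:
  assumes "smooth_on U f"
  shows "open U"
    and "\<And>x. x \<in> U \<Longrightarrow> (f has_derivative frechet_derivative f (at x)) (at x)"
    and "\<And>i x. i \<in> Basis \<Longrightarrow> x \<in> U \<Longrightarrow> pderiv_dir i f differentiable (at x)"
    and "\<And>i j x. i \<in> Basis \<Longrightarrow> j \<in> Basis \<Longrightarrow> x \<in> U \<Longrightarrow> pderiv_dir j (pderiv_dir i f) differentiable (at x)"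
proof -
  have *: "foldr pderiv_dir ds f differentiable (at x)" if "set ds \<subseteq> Basis" "x \<in> U" for ds x
    using assms that by (simp add: smooth_on_def)
  show "open U" using assms by (simp add: smooth_on_def)
  show "(f has_derivative frechet_derivative f (at x)) (at x)" if "x \<in> U" for x
    using *[of "[]" x] that by (intro frechet_derivative_works[THEN iffD1]) simp
  show "pderiv_dir i f differentiable (at x)" if "i \<in> Basis" "x \<in> U" for i x
    using *[of "[i]" x] that by simp
  show "pderiv_dir j (pderiv_dir i f) differentiable (at x)" if "i \<in> Basis" "j \<in> Basis" "x \<in> U" for i j x
    using *[of "[j, i]" x] that by simp
qed

lemma smooth_on_continuous_frechet_derivative:
  assumes "smooth_on U f" "i \<in> Basis"
  shows "continuous_on U (\<lambda>x. frechet_derivative f (at x) i)"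
proof -
  have "continuous_on U (pderiv_dir i f)"
    using smooth_onD(3)[OF assms] by (intro continuous_at_imp_continuous_on ballI differentiable_imp_continuous_within)
  then show ?thesis by (simp add: pderiv_dir_def)
qed

definition gradient :: "('a::euclidean_space \<Rightarrow> real) \<Rightarrow> 'a \<Rightarrow> 'a" where
  "gradient f x = (\<Sum>i\<in>Basis. pderiv_dir i f x *\<^sub>R i)"

lemma smooth_on_has_gradient:
  assumes "smooth_on U f" "x \<in> U"
  shows "(f has_derivative (\<lambda>v. gradient f x \<bullet> v)) (at x)"
proof -
  note d = smooth_onD(2)[OF assms]
  have "frechet_derivative f (at x) v = gradient f x \<bullet> v" for v
    using sum_Basis_linear[OF has_derivative_linear[OF d], of v]
    by (simp add: gradient_def pderiv_dir_def inner_sum_left mult.commute)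
  then have "frechet_derivative f (at x) = (\<lambda>v. gradient f x \<bullet> v)" ..
  then show ?thesis using d by simp
qed

definition hessian :: "('a::euclidean_space \<Rightarrow> real) \<Rightarrow> 'a \<Rightarrow> 'a \<Rightarrow> 'a" where
  "hessian f x v = (\<Sum>i\<in>Basis. frechet_derivative (pderiv_dir i f) (at x) v *\<^sub>R i)"

lemma smooth_on_has_hessian:
  assumes "smooth_on U f" "x \<in> U"
  shows "(gradient f has_derivative hessian f x) (at x)"
proof -
  have "(pderiv_dir i f has_derivative frechet_derivative (pderiv_dir i f) (at x)) (at x)" if "i \<in> Basis" for i
    using smooth_onD(3)[OF assms(1) that assms(2)] frechet_derivative_works by blast
  then have "((\<lambda>x. \<Sum>i\<in>Basis. pderiv_dir i f x *\<^sub>R i) has_derivative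
      (\<lambda>v. \<Sum>i\<in>Basis. frechet_derivative (pderiv_dir i f) (at x) v *\<^sub>R i)) (at x)"
    by (intro has_derivative_sum has_derivative_scaleR_left)
  then show ?thesis by (simp add: gradient_def[abs_def] hessian_def[abs_def])
qed

lemma smooth_on_continuous_hessian:
  assumes "smooth_on U f" "j \<in> Basis"
  shows "continuous_on U (\<lambda>x. hessian f x j)"
proof -
  have "continuous_on U (pderiv_dir j (pderiv_dir i f))" if "i \<in> Basis" for i
    using smooth_onD(4)[OF assms(1) that assms(2)]
    by (intro continuous_at_imp_continuous_on ballI differentiable_imp_continuous_within)
  then have "continuous_on U (\<lambda>x. \<Sum>i\<in>Basis. pderiv_dir j (pderiv_dir i f) x *\<^sub>R i)"
    by (intro continuous_intros)
  then show ?thesis by (simp add: hessian_def pderiv_dir_def)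
qed

text \<open>Curves with prescribed velocity are obtained from the chart whose normal field is the
  normalised gradient of the defining function.\<close>
lemma tangent_space_level_set:
  fixes F :: "'a::euclidean_space \<Rightarrow> real"
  assumes x: "x \<in> M" "x \<in> U" and F: "smooth_on U F" and MU: "M \<inter> U = {x\<in>U. F x = 0}"
    and gF: "\<And>x. x \<in> M \<inter> U \<Longrightarrow> gradient F x \<noteq> 0"
  shows "tangent_space M x = {v. gradient F x \<bullet> v = 0}"
proof safe
  have openU: "open U" using F by (rule smooth_onD)
  fix v assume "v \<in> tangent_space M x"
  then obtain \<gamma> e where g: "e > 0" "\<gamma> ` {-e<..<e} \<subseteq> M" "\<gamma> 0 = x" "(\<gamma> has_vector_derivative v) (at 0)"
    unfolding tangent_space_def by blast
  have d: "(\<gamma> has_derivative (\<lambda>t. t *\<^sub>R v)) (at 0)" using g(4) by (simp add: has_vector_derivative_def)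
  have 1: "((\<lambda>t. F (\<gamma> t)) has_derivative (\<lambda>t. gradient F x \<bullet> (t *\<^sub>R v))) (at 0)"
    using has_derivative_compose[OF d, of F "\<lambda>v. gradient F x \<bullet> v"] smooth_on_has_gradient[OF F x(2)] g(3) by simp
  have "isCont \<gamma> 0" using d by (rule has_derivative_continuous)
  then obtain S where S: "open S" "0 \<in> S" "\<And>t. t \<in> S \<Longrightarrow> \<gamma> t \<in> U"
    using openU x(2) g(3) unfolding continuous_at_open by metis
  have "((\<lambda>t. F (\<gamma> t)) has_derivative (\<lambda>t. 0)) (at 0)"
  proof (rule has_derivative_transform_within_open[of "\<lambda>_. 0" _ _ _ "S \<inter> {-e<..<e}"])
    show "0 = F (\<gamma> t)" if "t \<in> S \<inter> {-e<..<e}" for t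
    proof -
      have "\<gamma> t \<in> M \<inter> U" using that g(2) S(3) by blast
      then show ?thesis using MU by simp
    qed
  qed (use S g in auto)
  from has_derivative_unique[OF 1 this] have "gradient F x \<bullet> (1 *\<^sub>R v) = 0" by (rule fun_cong)
  then show "gradient F x \<bullet> v = 0" by simp
next
  have openU: "open U" using F by (rule smooth_onD)
  fix v assume v: "gradient F x \<bullet> v = 0"
  define g where "g = gradient F"
  have contg: "continuous_on U g"
    using smooth_on_has_hessian[OF F] unfolding g_def
    by (intro continuous_at_imp_continuous_on ballI) (blast intro: has_derivative_continuous)
  define W where "W = U \<inter> g -` {v. v \<noteq> 0}"
  have openW: "open W"
    unfolding W_def by (intro continuous_open_preimage contg openU open_Collect_neq continuous_intros)
  \<comment> \<open>The given unit normal cannot serve here: that it is parallel to the gradient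
    will itself be deduced from this lemma.\<close>
  define N where "N y = inverse (norm (g y)) *\<^sub>R g y" for y
  define DN where "DN y v = inverse (norm (g y)) *\<^sub>R hessian F y v +
      (- (inverse (norm (g y)) * (hessian F y v \<bullet> sgn (g y)) * inverse (norm (g y)))) *\<^sub>R g y" for y v
  have dN: "(N has_derivative DN y) (at y)" if y: "y \<in> W" for y
  proof -
    have yU: "y \<in> U" and g0: "g y \<noteq> 0" using y by (auto simp: W_def)
    have dg: "(g has_derivative hessian F y) (at y)"
      unfolding g_def by (rule smooth_on_has_hessian[OF F yU])
    have "((\<lambda>y. norm (g y)) has_derivative (\<lambda>v. hessian F y v \<bullet> sgn (g y))) (at y)"
      using has_derivative_compose[OF dg has_derivative_norm[OF g0]] .
    then have "((\<lambda>y. inverse (norm (g y))) has_derivative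
        (\<lambda>v. - (inverse (norm (g y)) * (hessian F y v \<bullet> sgn (g y)) * inverse (norm (g y))))) (at y)"
      using g0 by (intro Deriv.has_derivative_inverse) auto
    from has_derivative_scaleR[OF this dg] show ?thesis
      unfolding N_def[abs_def] DN_def[abs_def] .
  qed
  have cDN: "continuous_on W (\<lambda>y. DN y i)" if i: "i \<in> Basis" for i
  proof -
    have c: "continuous_on W g" by (rule continuous_on_subset[OF contg]) (auto simp: W_def)
    have ch: "continuous_on W (\<lambda>y. hessian F y i)"
      by (rule continuous_on_subset[OF smooth_on_continuous_hessian[OF F i]]) (auto simp: W_def)
    have "\<forall>y\<in>W. norm (g y) \<noteq> 0" "\<forall>y\<in>W. g y \<noteq> 0" by (auto simp: W_def)
    then show ?thesis
      unfolding DN_def sgn_div_norm by (intro continuous_intros c ch)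
  qed
  have M'W: "M \<inter> U \<subseteq> W" using gF by (auto simp: W_def g_def)
  \<comment> \<open>Built for \<open>M \<inter> U\<close>, the part of \<open>M\<close> that
    \<open>F\<close> describes.\<close>
  have "\<exists>V D \<pi> b \<sigma>. x \<in> V \<and> curved_chart (M \<inter> U) V D N \<pi> b DN \<sigma>"
  proof (rule curved_chart_exists[where U = U and gF = g and HF = "hessian F" and W = W and F = F])
    show "x \<in> M \<inter> U" "x \<in> U" using x by auto
    show "M \<inter> U \<inter> U = {x \<in> U. F x = 0}" using MU by auto
    show "(F has_derivative (\<lambda>v. g y \<bullet> v)) (at y)" "(g has_derivative hessian F y) (at y)" if "y \<in> U" for y
      unfolding g_def using smooth_on_has_gradient[OF F that] smooth_on_has_hessian[OF F that] by auto
    show "g y \<noteq> 0" if "y \<in> M \<inter> U \<inter> U" for y using gF that by (auto simp: g_def)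
    show "norm (N y) = 1" if "y \<in> M \<inter> U" for y using gF that by (auto simp: N_def g_def)
    show "g y = (g y \<bullet> N y) *\<^sub>R N y" if "y \<in> M \<inter> U \<inter> U" for y
    proof -
      have "g y \<noteq> 0" using gF that by (auto simp: g_def)
      then have "inverse (norm (g y)) * (g y \<bullet> g y) * inverse (norm (g y)) = 1"
        by (simp add: dot_square_norm power2_eq_square field_simps)
      then show ?thesis by (simp add: N_def mult.assoc)
    qed
  qed (fact openU openW M'W dN cDN)+
  then obtain V D \<pi> b \<sigma> where xV: "x \<in> V" and "curved_chart (M \<inter> U) V D N \<pi> b DN \<sigma>" by blast
  then interpret curved_chart "M \<inter> U" V D N \<pi> b DN \<sigma> by simp
  have xMV: "x \<in> M \<inter> U \<inter> V" using x xV by simp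
  have xD: "x \<in> D" "\<pi> x = x" using mem_D[OF xMV] pi_id[OF xMV] by auto
  have vN: "v \<bullet> N x = 0" using v by (simp add: N_def g_def inner_commute)
  \<comment> \<open>The straight line with velocity v is pushed onto \<open>M\<close> by \<pi>,
    whose derivative at \<open>x\<close> fixes tangent vectors.\<close>
  have "((\<lambda>t. x + t *\<^sub>R v) has_derivative (\<lambda>t. t *\<^sub>R v)) (at (0::real))"
    by (auto intro!: derivative_eq_intros)
  then have "((\<lambda>t. \<pi> (x + t *\<^sub>R v)) has_derivative (\<lambda>t. vertical_proj x (t *\<^sub>R v))) (at 0)"
    using has_derivative_compose[of "\<lambda>t. x + t *\<^sub>R v" "\<lambda>t. t *\<^sub>R v" "0::real" UNIV \<pi> "vertical_proj x"] deriv_pi'[OF xD(1)] xD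
    by simp
  moreover have "vertical_proj x (t *\<^sub>R v) = t *\<^sub>R v" for t
    using vN by (intro vertical_proj_tangent) simp
  ultimately have 1: "((\<lambda>t. \<pi> (x + t *\<^sub>R v)) has_vector_derivative v) (at 0)"
    by (simp add: has_vector_derivative_def)
  have "open ((\<lambda>t::real. x + t *\<^sub>R v) -` D)" by (intro open_vimage openD continuous_intros)
  moreover have "(0::real) \<in> (\<lambda>t. x + t *\<^sub>R v) -` D" using xD(1) by simp
  ultimately obtain e where e: "e > 0" "ball (0::real) e \<subseteq> (\<lambda>t. x + t *\<^sub>R v) -` D"
    by (rule openE)
  have "(\<lambda>t. \<pi> (x + t *\<^sub>R v)) ` {-e<..<e} \<subseteq> M"
  proof safe
    fix t assume "t \<in> {-e<..<e}"
    then have "t \<in> ball 0 e" by (auto simp: dist_real_def)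
    then have "x + t *\<^sub>R v \<in> D" using e(2) by blast
    then show "\<pi> (x + t *\<^sub>R v) \<in> M" using pi_mem by blast
  qed
  then show "v \<in> tangent_space M x"
    unfolding tangent_space_def using 1 e(1) xD(2)
    by (intro CollectI exI[of _ "\<lambda>t. \<pi> (x + t *\<^sub>R v)"] exI[of _ e]) auto
qed

text \<open>The component of \<nu> orthogonal to \<open>g\<close> lies in the kernel of
  \<open>g\<close>, so \<nu> is orthogonal to it; being orthogonal to itself, it vanishes.\<close>

lemma normal_parallel:
  fixes g \<nu> :: "'a::euclidean_space"
  assumes g: "g \<noteq> 0" and \<nu>: "norm \<nu> = 1" and perp: "\<And>v. g \<bullet> v = 0 \<Longrightarrow> \<nu> \<bullet> v = 0"
  shows "g = (g \<bullet> \<nu>) *\<^sub>R \<nu>" "g \<bullet> \<nu> \<noteq> 0"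
proof -
  define c where "c = (\<nu> \<bullet> g) / (g \<bullet> g)"
  define v where "v = \<nu> - c *\<^sub>R g"
  have gv: "g \<bullet> v = 0" using g by (simp add: v_def c_def inner_diff_right inner_commute[of g \<nu>])
  then have "v \<bullet> v = 0" using perp[OF gv] by (simp add: v_def inner_diff_left)
  then have \<nu>c: "\<nu> = c *\<^sub>R g" by (simp add: v_def)
  have cg: "c * (g \<bullet> \<nu>) = 1" using \<nu> \<nu>c by (metis inner_scaleR_left norm_eq_1)
  then show "g \<bullet> \<nu> \<noteq> 0" by auto
  have "(g \<bullet> \<nu>) *\<^sub>R \<nu> = (g \<bullet> \<nu>) *\<^sub>R (c *\<^sub>R g)" by (subst \<nu>c) (rule refl)
  then show "g = (g \<bullet> \<nu>) *\<^sub>R \<nu>" using cg by (simp add: mult.commute)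
qed

locale oriented_hypersurface =
  fixes M W :: "'a::euclidean_space set" and N :: "'a \<Rightarrow> 'a" and DN :: "'a \<Rightarrow> 'a \<Rightarrow> 'a"
  assumes MW: "M \<subseteq> W"
    and deriv_N: "\<And>x. x \<in> W \<Longrightarrow> (N has_derivative DN x) (at x)"
    and cont_DN: "\<And>i. i \<in> Basis \<Longrightarrow> continuous_on W (\<lambda>x. DN x i)"
    and norm_N: "\<And>x. x \<in> M \<Longrightarrow> norm (N x) = 1"
    and charts: "\<And>p. p \<in> M \<Longrightarrow> \<exists>V D \<pi> b \<sigma>. p \<in> V \<and> curved_chart M V D N \<pi> b DN \<sigma>"
    and tangent_space: "\<And>x. x \<in> M \<Longrightarrow> tangent_space M x = {v. v \<bullet> N x = 0}"
begin

lemma linear_DN: "x \<in> M \<Longrightarrow> linear (DN x)"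
  using deriv_N MW by (blast intro: has_derivative_linear)

text \<open>\<open>N x\<close> is frozen at the base point: \<open>M\<close> touches its tangent
  plane to first order, so the height above that plane has derivative 0 within \<open>M\<close>.
  Derivatives within \<open>M\<close> therefore do not determine the normal part of a
  gradient.\<close>

lemma has_derivative_normal_component:
  assumes x: "x \<in> M"
  shows "((\<lambda>y. y \<bullet> N x) has_derivative (\<lambda>v. 0)) (at x within M)"
proof -
  obtain V D \<pi> b \<sigma> where V: "x \<in> V" "curved_chart M V D N \<pi> b DN \<sigma>" using charts[OF x] by blast
  interpret curved_chart M V D N \<pi> b DN \<sigma> by (rule V(2))
  have xMV: "x \<in> M \<inter> V" using x V by simp
  obtain r0 where r0: "r0 > 0" "ball x r0 \<subseteq> V" using openV V(1) open_contains_ball by blast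
  show ?thesis
    unfolding has_derivative_within_alt
  proof (intro conjI allI impI)
    fix \<epsilon> :: real assume "\<epsilon> > 0"
    from tangent[OF xMV this] obtain r where r: "r > 0"
      "\<And>y z. y \<in> M \<inter> V \<inter> ball x r \<Longrightarrow> z \<in> M \<inter> V \<inter> ball x r \<Longrightarrow> \<bar>(y - z) \<bullet> N x\<bar> \<le> \<epsilon> * norm (y - z)"
      by blast
    show "\<exists>d>0. \<forall>y\<in>M. norm (y - x) < d \<longrightarrow> norm (y \<bullet> N x - x \<bullet> N x - 0) \<le> \<epsilon> * norm (y - x)"
    proof (intro exI[of _ "min r r0"] conjI ballI impI)
      fix y assume y: "y \<in> M" "norm (y - x) < min r r0"
      then have "y \<in> ball x r" "y \<in> ball x r0" by (auto simp: dist_norm norm_minus_commute)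
      then have "y \<in> M \<inter> V \<inter> ball x r" using y r0 by auto
      moreover have "x \<in> M \<inter> V \<inter> ball x r" using xMV r by simp
      ultimately have "\<bar>(y - x) \<bullet> N x\<bar> \<le> \<epsilon> * norm (y - x)" by (rule r(2))
      then show "norm (y \<bullet> N x - x \<bullet> N x - 0) \<le> \<epsilon> * norm (y - x)" by (simp add: inner_diff_left)
    qed (use r r0 in simp)
  qed simp
qed

text \<open>Existence: removing the normal part does not change the derivative within
  \<open>M\<close>. Uniqueness: the difference of two candidates is tangent, hence the velocity of a
  curve in \<open>M\<close>; both compute the derivative of \<open>f\<close> along it, so the
  difference is orthogonal to itself.\<close>

lemma tgrad_eq:
  assumes x: "x \<in> M" and d: "(\<psi> has_derivative (\<lambda>v. g \<bullet> v)) (at x)"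
    and eq: "\<And>y. y \<in> M \<Longrightarrow> f y = \<psi> y"
  shows "tgrad M f x = tangent_proj (N x) g"
  unfolding tgrad_def
proof (rule the_equality)
  have NN: "N x \<bullet> N x = 1" using norm_N[OF x] by (simp add: norm_eq_1)
  let ?c = "g \<bullet> N x"
  have "((\<lambda>y. (\<psi> y - ?c * (y \<bullet> N x)) + ?c * (y \<bullet> N x)) has_derivative
      (\<lambda>v. (g \<bullet> v - ?c * (v \<bullet> N x)) + ?c * 0)) (at x within M)"
    by (intro has_derivative_add has_derivative_diff has_derivative_mult_right
        has_derivative_normal_component[OF x] has_derivative_at_withinI[OF d]
        has_derivative_inner_left has_derivative_ident)
  then have "(\<psi> has_derivative (\<lambda>v. tangent_proj (N x) g \<bullet> v)) (at x within M)"
    by (simp add: tangent_proj_def inner_diff_left inner_commute[of "N x"])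
  then have "(f has_derivative (\<lambda>v. tangent_proj (N x) g \<bullet> v)) (at x within M)"
    by (rule has_derivative_transform[rotated 2]) (use x eq in auto)
  then show "tangent_proj (N x) g \<in> tangent_space M x \<and>
      (f has_derivative (\<lambda>v. tangent_proj (N x) g \<bullet> v)) (at x within M)"
    using tangent_space[OF x] NN by (simp add: tangent_proj_def inner_diff_left)
  fix g' assume g': "g' \<in> tangent_space M x \<and> (f has_derivative (\<lambda>v. g' \<bullet> v)) (at x within M)"
  let ?g = "tangent_proj (N x) g"
  have "g' - ?g \<in> tangent_space M x"
    using g' tangent_space[OF x] NN by (simp add: tangent_proj_def inner_diff_left)
  then obtain \<gamma> e where \<gamma>: "e > 0" "\<gamma> ` {-e<..<e} \<subseteq> M" "\<gamma> 0 = x"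
    "(\<gamma> has_vector_derivative (g' - ?g)) (at 0)"
    unfolding tangent_space_def by blast
  have d0: "(\<gamma> has_derivative (\<lambda>t. t *\<^sub>R (g' - ?g))) (at 0 within {-e<..<e})"
    using \<gamma>(4) by (simp add: has_vector_derivative_def has_derivative_at_withinI)
  have curve: "((\<lambda>t. f (\<gamma> t)) has_derivative (\<lambda>t. k \<bullet> (t *\<^sub>R (g' - ?g)))) (at 0)"
    if "(f has_derivative (\<lambda>v. k \<bullet> v)) (at x within M)" for k
  proof -
    have "(f has_derivative (\<lambda>v. k \<bullet> v)) (at (\<gamma> 0) within \<gamma> ` {-e<..<e})"
      unfolding \<gamma>(3) by (rule has_derivative_subset[OF that \<gamma>(2)])
    from has_derivative_in_compose[OF d0 this]
    have "((\<lambda>t. f (\<gamma> t)) has_derivative (\<lambda>t. k \<bullet> (t *\<^sub>R (g' - ?g)))) (at 0 within {-e<..<e})" .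
    moreover have "at (0::real) within {-e<..<e} = at 0"
      using \<gamma>(1) by (intro at_within_open) auto
    ultimately show ?thesis by simp
  qed
  have "g' \<bullet> (1 *\<^sub>R (g' - ?g)) = ?g \<bullet> (1 *\<^sub>R (g' - ?g))"
    using has_derivative_unique[OF curve curve, of g' ?g] g' \<open>(f has_derivative (\<lambda>v. ?g \<bullet> v)) (at x within M)\<close>
    by (meson fun_cong)
  then have "(g' - ?g) \<bullet> (g' - ?g) = 0" by (simp add: inner_diff_left)
  then show "g' = ?g" by simp
qed

lemma mean_curv_eq:
  assumes x: "x \<in> M" and eq: "\<And>y. y \<in> M \<Longrightarrow> \<nu> y = N y"
  shows "mean_curv M \<nu> x = trace_tangent (N x) (DN x)"
  unfolding mean_curv_def tdiv_def trace_tangent_def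
proof (intro sum.cong refl)
  fix b :: 'a assume b: "b \<in> Basis"
  \<comment> \<open>The transpose of \<open>DN x\<close> applied to \<open>b\<close>, that is the
    gradient of N \<bullet> b.\<close>
  define g where "g = (\<Sum>i\<in>Basis. (DN x i \<bullet> b) *\<^sub>R i)"
  have g: "g \<bullet> v = DN x v \<bullet> b" for v
    using sum_Basis_linear_inner[OF linear_DN[OF x], of v b]
    by (simp add: g_def inner_sum_left mult.commute)
  have "((\<lambda>y. N y \<bullet> b) has_derivative (\<lambda>v. g \<bullet> v)) (at x)"
    unfolding g using deriv_N MW x by (intro has_derivative_inner_left) auto
  then have "tgrad M (\<lambda>y. \<nu> y \<bullet> b) x = tangent_proj (N x) g"
    by (rule tgrad_eq[OF x]) (simp add: eq)
  then have "b \<bullet> tgrad M (\<lambda>y. \<nu> y \<bullet> b) x = g \<bullet> tangent_proj (N x) b"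
    by (simp add: tangent_proj_def inner_diff_right inner_commute mult.commute)
  then show "b \<bullet> tgrad M (\<lambda>y. \<nu> y \<bullet> b) x = DN x (tangent_proj (N x) b) \<bullet> b"
    by (simp add: g)
qed

text \<open>\<open>M\<close> need not be closed. It is Borel within each chart domain, and countably
  many chart domains cover it.\<close>

lemma borel_M: "M \<in> sets borel"
proof -
  define \<V> where "\<V> = {V. open V \<and> M \<inter> V \<in> sets borel}"
  have 1: "\<exists>V\<in>\<V>. p \<in> V" if p: "p \<in> M" for p
  proof -
    obtain V D \<pi> b \<sigma> where V: "p \<in> V" "curved_chart M V D N \<pi> b DN \<sigma>" using charts[OF p] by blast
    interpret curved_chart M V D N \<pi> b DN \<sigma> by (rule V(2))
    show ?thesis using V openV borel_MV by (auto simp: \<V>_def)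
  qed
  obtain \<F> where F: "\<F> \<subseteq> \<V>" "countable \<F>" "\<Union>\<F> = \<Union>\<V>"
    using Lindelof[of \<V>] by (auto simp: \<V>_def)
  have "M = (\<Union>V\<in>\<F>. M \<inter> V)" using 1 F(3) by blast
  also have "\<dots> \<in> sets borel" using F by (intro sets.countable_UN') (auto simp: \<V>_def)
  finally show ?thesis .
qed

end

text \<open>\<open>unit_normal_field\<close> states orthogonality to velocities of curves. Since
  these fill the kernel of the gradient of each local defining function, the normal is parallel to
  that gradient, as the charts require.\<close>

lemma oriented_hypersurfaceI:
  fixes M :: "'a::euclidean_space set"
  assumes M: "smooth_hypersurface M" and \<nu>: "unit_normal_field M \<nu>"
  shows "\<exists>W N DN. oriented_hypersurface M W N DN \<and> (\<forall>x\<in>M. \<nu> x = N x)"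
proof -
  from \<nu> obtain W N where W: "M \<subseteq> W" "smooth_on W N" "\<And>x. x \<in> M \<Longrightarrow> N x = \<nu> x"
    and n1: "\<And>x. x \<in> M \<Longrightarrow> norm (\<nu> x) = 1"
    and perp: "\<And>x v. x \<in> M \<Longrightarrow> v \<in> tangent_space M x \<Longrightarrow> \<nu> x \<bullet> v = 0"
    unfolding unit_normal_field_def by metis
  define DN where "DN x = frechet_derivative N (at x)" for x
  have dN: "(N has_derivative DN x) (at x)" if "x \<in> W" for x
    unfolding DN_def by (rule smooth_onD(2)[OF W(2) that])
  have cDN: "continuous_on W (\<lambda>x. DN x i)" if "i \<in> Basis" for i
    unfolding DN_def by (rule smooth_on_continuous_frechet_derivative[OF W(2) that])
  have nN: "norm (N x) = 1" if "x \<in> M" for x using n1 W(3) that by simp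
  have local: "(\<exists>V D \<pi> b \<sigma>. p \<in> V \<and> curved_chart M V D N \<pi> b DN \<sigma>) \<and> tangent_space M p = {v. v \<bullet> N p = 0}"
    if p: "p \<in> M" for p
  proof -
    obtain U F where U: "p \<in> U" "smooth_on U (F :: 'a \<Rightarrow> real)" "M \<inter> U = {x\<in>U. F x = 0}"
      "\<And>x. x \<in> M \<inter> U \<Longrightarrow> frechet_derivative F (at x) \<noteq> (\<lambda>v. 0)"
      using M p unfolding smooth_hypersurface_def by metis
    have g0: "gradient F x \<noteq> 0" if x: "x \<in> M \<inter> U" for x
    proof
      assume g: "gradient F x = 0"
      have xU: "x \<in> U" using x by simp
      have "(F has_derivative (\<lambda>v. 0)) (at x)" using smooth_on_has_gradient[OF U(2) xU] by (simp add: g)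
      from frechet_derivative_at[OF this] show False using U(4)[OF x] by simp
    qed
    have ts: "tangent_space M x = {v. gradient F x \<bullet> v = 0}" if "x \<in> M \<inter> U" for x
      by (rule tangent_space_level_set[of _ _ U]) (use that U(2,3) g0 in auto)
    have par: "gradient F x = (gradient F x \<bullet> N x) *\<^sub>R N x" "gradient F x \<bullet> N x \<noteq> 0" if x: "x \<in> M \<inter> U" for x
    proof -
      have xM: "x \<in> M" using x by simp
      have *: "N x \<bullet> v = 0" if "gradient F x \<bullet> v = 0" for v
        using perp[OF xM, of v] ts[OF x] that W(3)[OF xM] by simp
      show "gradient F x = (gradient F x \<bullet> N x) *\<^sub>R N x" "gradient F x \<bullet> N x \<noteq> 0"
        using normal_parallel[OF g0[OF x] nN[OF xM] *] by auto
    qed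
    have "\<exists>V D \<pi> b \<sigma>. p \<in> V \<and> curved_chart M V D N \<pi> b DN \<sigma>"
      by (rule curved_chart_exists[OF p U(1) smooth_onD(1)[OF U(2)] U(3) smooth_on_has_gradient[OF U(2)]
            smooth_on_has_hessian[OF U(2)] g0 smooth_onD(1)[OF W(2)] W(1) dN cDN nN par(1)])
    moreover have "tangent_space M p = {v. v \<bullet> N p = 0}"
    proof -
      have pMU: "p \<in> M \<inter> U" using p U(1) by (rule IntI)
      have eq: "gradient F p \<bullet> v = (gradient F p \<bullet> N p) * (v \<bullet> N p)" for v
      proof -
        have "gradient F p \<bullet> v = ((gradient F p \<bullet> N p) *\<^sub>R N p) \<bullet> v"
          by (rule arg_cong[where f = "\<lambda>w. w \<bullet> v", OF par(1)[OF pMU]])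
        then show ?thesis by (simp only: inner_scaleR_left inner_commute[of "N p"])
      qed
      show ?thesis
        unfolding ts[OF pMU]
      proof (rule Collect_cong)
        fix v
        show "gradient F p \<bullet> v = 0 \<longleftrightarrow> v \<bullet> N p = 0"
          by (subst eq[of v]) (simp add: par(2)[OF pMU])
      qed
    qed
    ultimately show ?thesis ..
  qed
  have "oriented_hypersurface M W N DN"
    by unfold_locales (use W smooth_onD(1)[OF W(2)] dN cDN nN local in auto)
  then show ?thesis using W(3) by force
qed

section \<open>The Hardy inequality\<close>

text \<open>With \<open>s\<close>, \<open>t\<close> the tangential and normal parts of \<open>x\<close>, the first square is completed in \<open>G\<close>.\<close>
lemma hardy_pointwise:
  fixes a \<epsilon> r s t G q H \<phi> :: real
  assumes a: "a > 0" and \<epsilon>: "\<epsilon> > 0" and r: "r \<ge> 0" and s: "s \<ge> 0" and st: "s\<^sup>2 + t\<^sup>2 = r\<^sup>2"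
    and G: "G \<ge> 0" and q: "\<bar>q\<bar> \<le> G * s"
  defines "\<rho> \<equiv> r\<^sup>2 + \<epsilon>"
  shows "\<phi>\<^sup>2 * (a\<^sup>2 / \<rho> + a * (a + 2) * t\<^sup>2 / \<rho>\<^sup>2) \<le>
    (G\<^sup>2 + a * \<bar>H\<bar> * \<phi>\<^sup>2 / r) +
    a * ((2 * a + 2) * \<phi>\<^sup>2 / \<rho> + 2 * \<phi> * q / \<rho> - 2 * \<phi>\<^sup>2 * s\<^sup>2 / \<rho>\<^sup>2 - H * \<phi>\<^sup>2 * t / \<rho>)"
proof -
  have \<rho>: "\<rho> > 0" "r\<^sup>2 \<le> \<rho>" using \<epsilon> r by (auto simp: \<rho>_def add_nonneg_pos)
  have tr: "\<bar>t\<bar> \<le> r"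
    using st r abs_le_square_iff[of t r] by (smt (verit) zero_le_power2)
  \<comment> \<open>From |t| \<le> r and r^2 \<le> \<rho> follows r |t| \<le> \<rho>. At r = 0 also
    t = 0, and the right side is 0 by division by zero.\<close>
  have 1: "H * \<phi>\<^sup>2 * t / \<rho> \<le> \<bar>H\<bar> * \<phi>\<^sup>2 / r"
  proof (cases "r = 0")
    case True
    then show ?thesis using tr by simp
  next
    case False
    have "r * \<bar>t\<bar> \<le> \<rho>"
      using mult_left_mono[OF tr r] \<rho>(2) by (simp add: power2_eq_square)
    then have "\<bar>t\<bar> / \<rho> \<le> 1 / r"
      using False r \<rho>(1) by (simp add: field_simps)
    then have "\<bar>H\<bar> * \<phi>\<^sup>2 * (\<bar>t\<bar> / \<rho>) \<le> \<bar>H\<bar> * \<phi>\<^sup>2 * (1 / r)"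
      by (intro mult_left_mono) auto
    moreover have "H * \<phi>\<^sup>2 * t / \<rho> \<le> \<bar>H * \<phi>\<^sup>2 * t / \<rho>\<bar>" by (rule abs_ge_self)
    moreover have "\<bar>H * \<phi>\<^sup>2 * t / \<rho>\<bar> = \<bar>H\<bar> * \<phi>\<^sup>2 * (\<bar>t\<bar> / \<rho>)"
      using \<rho> by (simp add: abs_mult)
    ultimately show ?thesis by simp
  qed
  \<comment> \<open>The square is (G - u)^2 with u = a |\<phi>| s / \<rho>; the bound on
    \<open>q\<close> makes the mixed term at most 2 G u.\<close>
  have 2: "- (a\<^sup>2 * \<phi>\<^sup>2 * s\<^sup>2 / \<rho>\<^sup>2) \<le> G\<^sup>2 + 2 * a * \<phi> * q / \<rho>"
  proof -
    define u where "u = a * \<bar>\<phi>\<bar> * s / \<rho>"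
    have "0 \<le> (G - u)\<^sup>2" by simp
    then have "2 * G * u \<le> G\<^sup>2 + u\<^sup>2" by (simp add: power2_eq_square algebra_simps)
    moreover have "u\<^sup>2 = a\<^sup>2 * \<phi>\<^sup>2 * s\<^sup>2 / \<rho>\<^sup>2" by (simp add: u_def power_mult_distrib power_divide)
    moreover have "\<bar>2 * a * \<phi> * q / \<rho>\<bar> \<le> 2 * G * u"
    proof -
      have "\<bar>2 * a * \<phi> * q / \<rho>\<bar> = (2 * a * \<bar>\<phi>\<bar> / \<rho>) * \<bar>q\<bar>"
        using a \<rho> by (simp add: abs_mult)
      also have "\<dots> \<le> (2 * a * \<bar>\<phi>\<bar> / \<rho>) * (G * s)"
        using a \<rho> q by (intro mult_left_mono) auto
      finally show ?thesis by (simp add: u_def mult_ac)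
    qed
    moreover have "- c \<le> g + z" if "w \<le> g + v" "v = c" "\<bar>z\<bar> \<le> w" for c g z v w :: real
      using that by linarith
    ultimately show ?thesis by blast
  qed
  \<comment> \<open>The loss caused by \<epsilon>: r^2 \<le> \<rho> goes in the favourable
    direction.\<close>
  have 3: "a * (a + 2) * \<phi>\<^sup>2 * (s\<^sup>2 + t\<^sup>2) / \<rho>\<^sup>2 \<le> a * (a + 2) * \<phi>\<^sup>2 / \<rho>"
  proof -
    have "(s\<^sup>2 + t\<^sup>2) / \<rho>\<^sup>2 \<le> \<rho> / \<rho>\<^sup>2"
      using \<rho> st by (intro divide_right_mono) auto
    also have "\<dots> = 1 / \<rho>" using \<rho> by (simp add: power2_eq_square)
    finally have "a * (a + 2) * \<phi>\<^sup>2 * ((s\<^sup>2 + t\<^sup>2) / \<rho>\<^sup>2) \<le> a * (a + 2) * \<phi>\<^sup>2 * (1 / \<rho>)"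
      using a by (intro mult_left_mono) auto
    then show ?thesis by simp
  qed
  define A where "A = \<phi>\<^sup>2 / \<rho>"
  define S where "S = \<phi>\<^sup>2 * s\<^sup>2 / \<rho>\<^sup>2"
  define T where "T = \<phi>\<^sup>2 * t\<^sup>2 / \<rho>\<^sup>2"
  have h2: "- (a\<^sup>2 * S) \<le> G\<^sup>2 + 2 * a * \<phi> * q / \<rho>" using 2 by (simp add: S_def mult.assoc)
  have h3: "a * (a + 2) * S + a * (a + 2) * T \<le> a * (a + 2) * A"
    using 3 by (simp add: A_def S_def T_def distrib_left add_divide_distrib mult.assoc)
  have h1: "a * (H * \<phi>\<^sup>2 * t / \<rho>) \<le> a * \<bar>H\<bar> * \<phi>\<^sup>2 / r"
    using mult_left_mono[OF 1, of a] a by (simp add: mult.assoc)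
  have L: "\<phi>\<^sup>2 * (a\<^sup>2 / \<rho> + a * (a + 2) * t\<^sup>2 / \<rho>\<^sup>2) = a\<^sup>2 * A + a * (a + 2) * T"
    by (simp add: A_def T_def algebra_simps)
  have R: "a * ((2 * a + 2) * \<phi>\<^sup>2 / \<rho> + 2 * \<phi> * q / \<rho> - 2 * \<phi>\<^sup>2 * s\<^sup>2 / \<rho>\<^sup>2 - H * \<phi>\<^sup>2 * t / \<rho>) =
      a * (2 * a + 2) * A + 2 * a * \<phi> * q / \<rho> - 2 * a * S - a * (H * \<phi>\<^sup>2 * t / \<rho>)"
    by (simp add: A_def S_def algebra_simps add_divide_distrib)
  \<comment> \<open>The divergence of x contributes a n with n = 2 a + 2. It splits into the Hardy
    constant a^2 and a (a + 2), and by \<open>h3\<close> the latter pays for both the tangential and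
    the normal term.\<close>
  have e1: "a * (2 * a + 2) * A = a\<^sup>2 * A + a * (a + 2) * A"
    by (simp add: power2_eq_square algebra_simps)
  have e2: "a * (a + 2) * S = a\<^sup>2 * S + 2 * a * S"
    by (simp add: power2_eq_square algebra_simps)
  have "P + Q \<le> (g + B) + ((P + Q') + z - S2 - w)"
    if "w \<le> B" "- S1 \<le> g + z" "(S1 + S2) + Q \<le> Q'" for P Q Q' g B z S1 S2 w :: real
    using that by linarith
  from this[OF h1 h2 h3[unfolded e2]] show ?thesis
    unfolding L R e1 .
qed

definition hardy_field :: "('a::euclidean_space \<Rightarrow> real) \<Rightarrow> real \<Rightarrow> 'a \<Rightarrow> 'a" where
  "hardy_field \<psi> \<epsilon> x = ((\<psi> x)\<^sup>2 / ((norm x)\<^sup>2 + \<epsilon>)) *\<^sub>R x"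

definition hardy_field_deriv :: "('a::euclidean_space \<Rightarrow> real) \<Rightarrow> ('a \<Rightarrow> 'a) \<Rightarrow> real \<Rightarrow> 'a \<Rightarrow> 'a \<Rightarrow> 'a" where
  "hardy_field_deriv \<psi> g \<epsilon> x v = ((\<psi> x)\<^sup>2 / ((norm x)\<^sup>2 + \<epsilon>)) *\<^sub>R v +
     (2 * \<psi> x / ((norm x)\<^sup>2 + \<epsilon>) * (g x \<bullet> v) - 2 * (\<psi> x)\<^sup>2 / ((norm x)\<^sup>2 + \<epsilon>)\<^sup>2 * (x \<bullet> v)) *\<^sub>R x"

lemma has_derivative_hardy_field:
  assumes \<epsilon>: "\<epsilon> > 0" and d: "(\<psi> has_derivative (\<lambda>v. g x \<bullet> v)) (at x)"
  shows "(hardy_field \<psi> \<epsilon> has_derivative hardy_field_deriv \<psi> g \<epsilon> x) (at x)"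
proof -
  have pos: "x \<bullet> x + \<epsilon> \<noteq> 0" using \<epsilon> by (metis add_nonneg_pos inner_ge_zero less_irrefl)
  have 1: "((\<lambda>x. x \<bullet> x + \<epsilon>) has_derivative (\<lambda>v. 2 * (x \<bullet> v))) (at x)"
    by (auto intro!: derivative_eq_intros simp: inner_commute)
  have 2: "((\<lambda>x. (\<psi> x)\<^sup>2) has_derivative (\<lambda>v. 2 * \<psi> x * (g x \<bullet> v))) (at x)"
    using has_derivative_power[OF d, of 2] by (simp add: mult_ac)
  from has_derivative_scaleR[OF has_derivative_divide'[OF 2 1 pos] has_derivative_ident]
  show ?thesis
    unfolding hardy_field_def[abs_def] hardy_field_deriv_def[abs_def] power2_norm_eq_inner
    by (rule has_derivative_eq_rhs)
      (use pos in \<open>simp add: fun_eq_iff power2_eq_square diff_divide_distrib mult_ac\<close>)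
qed

text \<open>The derivative is a multiple of the identity, with tangential trace n, plus maps v
  \<mapsto> (w \<bullet> v) x, whose tangential trace is the inner product of the tangential parts
  of w and x.\<close>

lemma trace_tangent_hardy_field:
  fixes x :: "'a::euclidean_space" and \<epsilon> :: real
  assumes \<nu>: "norm \<nu> = 1"
  defines "\<rho> \<equiv> (norm x)\<^sup>2 + \<epsilon>"
  shows "trace_tangent \<nu> (hardy_field_deriv \<psi> g \<epsilon> x) =
    real (DIM('a) - 1) * (\<psi> x)\<^sup>2 / \<rho> + 2 * \<psi> x * (tangent_proj \<nu> (g x) \<bullet> tangent_proj \<nu> x) / \<rho>
      - 2 * (\<psi> x)\<^sup>2 * (norm (tangent_proj \<nu> x))\<^sup>2 / \<rho>\<^sup>2"
proof -
  define c d e where "c = (\<psi> x)\<^sup>2 / \<rho>" and "d = 2 * \<psi> x / \<rho>" and "e = 2 * (\<psi> x)\<^sup>2 / \<rho>\<^sup>2"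
  have \<nu>\<nu>: "\<nu> \<bullet> \<nu> = 1" using \<nu> by (simp add: norm_eq_1)
  define L where "L v = c *\<^sub>R v + (d * (g x \<bullet> v) - e * (x \<bullet> v)) *\<^sub>R x" for v
  have L: "hardy_field_deriv \<psi> g \<epsilon> x = L"
    by (simp add: fun_eq_iff hardy_field_deriv_def L_def c_def d_def e_def \<rho>_def)
  have lin: "linear L"
    by (rule linearI) (simp_all add: L_def inner_add_right algebra_simps)
  have D: "real (DIM('a) - 1) = real DIM('a) - 1"
    using DIM_positive[where 'a = 'a] by (simp add: of_nat_diff Suc_leI)
  have "(\<Sum>i\<in>Basis. L i \<bullet> i) = (\<Sum>i\<in>(Basis::'a set). c) + d * (\<Sum>i\<in>Basis. (g x \<bullet> i) * (x \<bullet> i)) - e * (\<Sum>i\<in>Basis. (x \<bullet> i) * (x \<bullet> i))"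
    by (simp add: L_def inner_add_left sum.distrib sum_subtractf left_diff_distrib sum_distrib_left mult.assoc)
  also have "\<dots> = c * real DIM('a) + d * (g x \<bullet> x) - e * (x \<bullet> x)"
    unfolding euclidean_inner[of "g x" x] euclidean_inner[of x x] by (simp add: mult.commute)
  finally have sum_L: "(\<Sum>i\<in>Basis. L i \<bullet> i) = c * real DIM('a) + d * (g x \<bullet> x) - e * (x \<bullet> x)" .
  have "L \<nu> \<bullet> \<nu> = c + (d * (g x \<bullet> \<nu>) - e * (x \<bullet> \<nu>)) * (x \<bullet> \<nu>)"
    by (simp add: L_def inner_add_left \<nu>\<nu>)
  with sum_L have tr_L: "trace_tangent \<nu> L = c * real DIM('a) + d * (g x \<bullet> x) - e * (x \<bullet> x)
      - (c + (d * (g x \<bullet> \<nu>) - e * (x \<bullet> \<nu>)) * (x \<bullet> \<nu>))"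
    by (simp only: trace_tangent_eq[OF lin])
  have gen: "c * k + d * p - e * q - (c + (d * r - e * t) * t) =
      c * (k - 1) + d * (p - r * t) - e * (q - t * t)" for k p q r t :: real
    by (simp add: algebra_simps)
  from trans[OF tr_L gen] have "trace_tangent \<nu> L = c * (real DIM('a) - 1) + d * (g x \<bullet> x - (g x \<bullet> \<nu>) * (x \<bullet> \<nu>)) - e * (x \<bullet> x - (x \<bullet> \<nu>) * (x \<bullet> \<nu>))"
    .
  moreover have "tangent_proj \<nu> (g x) \<bullet> tangent_proj \<nu> x = g x \<bullet> x - (g x \<bullet> \<nu>) * (x \<bullet> \<nu>)"
    by (simp add: tangent_proj_def inner_diff_left inner_diff_right \<nu>\<nu> inner_commute[of \<nu> x])
  moreover have "(norm (tangent_proj \<nu> x))\<^sup>2 = x \<bullet> x - (x \<bullet> \<nu>) * (x \<bullet> \<nu>)"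
    unfolding power2_norm_eq_inner
    by (simp add: tangent_proj_def inner_diff_left inner_diff_right \<nu>\<nu> inner_commute[of \<nu> x])
  ultimately show ?thesis
    unfolding L D by (simp add: c_def d_def e_def mult_ac)
qed

lemma (in hausdorff_space) hardy_inequality:
  fixes M :: "'a set"
  assumes O: "oriented_hypersurface M W N DN" and dim: "n \<ge> 3"
    and \<nu>: "\<And>x. x \<in> M \<Longrightarrow> \<nu> x = N x"
    and U: "open U" "M \<subseteq> U" and g: "continuous_on U g"
    and d\<psi>: "\<And>x. x \<in> U \<Longrightarrow> (\<psi> has_derivative (\<lambda>v. g x \<bullet> v)) (at x)"
    and \<psi>: "\<And>x. x \<in> M \<Longrightarrow> \<psi> x = \<phi> x"
    and K: "compact K" "K \<subseteq> M" and \<phi>0: "\<And>x. x \<in> M \<Longrightarrow> x \<notin> K \<Longrightarrow> \<phi> x = 0"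
  shows "ennreal ((real n - 2)\<^sup>2 / 4) * (\<integral>\<^sup>+x\<in>M. ennreal ((\<phi> x)\<^sup>2 / (norm x)\<^sup>2) \<partial>h)
      + ennreal (((real n)\<^sup>2 - 4) / 4) * (\<integral>\<^sup>+x\<in>M. ennreal (((x /\<^sub>R norm x) \<bullet> \<nu> x)\<^sup>2 * (\<phi> x)\<^sup>2 / (norm x)\<^sup>2) \<partial>h)
    \<le> (\<integral>\<^sup>+x\<in>M. ennreal ((norm (tgrad M \<phi> x))\<^sup>2 + (real n - 2) / 2 * \<bar>mean_curv M \<nu> x\<bar> * (\<phi> x)\<^sup>2 / norm x) \<partial>h)"
proof -
  interpret oriented_hypersurface M W N DN by (rule O)
  note [measurable] = borel_M
  define a where "a = (real n - 2) / 2"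
  have a: "a > 0" using dim by (simp add: a_def)
  have n_a: "real n = 2 * a + 2" by (simp add: a_def field_simps)
  have a2: "(real n - 2)\<^sup>2 / 4 = a\<^sup>2" "((real n)\<^sup>2 - 4) / 4 = a * (a + 2)"
    by (simp_all add: n_a power2_eq_square algebra_simps)
  define G where "G x = tangent_proj (N x) (g x)" for x
  define H where "H x = trace_tangent (N x) (DN x)" for x
  have tg: "tgrad M \<phi> x = G x" if "x \<in> M" for x
    unfolding G_def using U(2) that by (intro tgrad_eq[OF that d\<psi>]) (auto simp: \<psi>)
  have mc: "mean_curv M \<nu> x = H x" if "x \<in> M" for x
    unfolding H_def using that \<nu> by (rule mean_curv_eq)
  define R where "R x = indicator M x * ((norm (G x))\<^sup>2 + a * \<bar>H x\<bar> * (\<psi> x)\<^sup>2 / norm x)" for x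
  have R0: "R x \<ge> 0" for x unfolding R_def using a by auto
  have cN: "continuous_on M N"
    using deriv_N MW by (intro continuous_at_imp_continuous_on ballI) (blast intro: has_derivative_continuous)
  have c\<psi>: "continuous_on M \<psi>"
    using d\<psi> U(2) by (intro continuous_at_imp_continuous_on ballI) (blast intro: has_derivative_continuous)
  have cg: "continuous_on M g" by (rule continuous_on_subset[OF g U(2)])
  have cG: "continuous_on M G"
    unfolding G_def tangent_proj_def by (intro continuous_intros cN cg)
  have cDN': "continuous_on M (\<lambda>x. DN x (v x))" if "continuous_on M v" for v
  proof (rule continuous_on_linear_family[OF linear_DN _ that])
    show "continuous_on M (\<lambda>x. DN x i)" if "i \<in> Basis" for i
      using cont_DN[OF that] MW by (rule continuous_on_subset)
  qed
  have cH: "continuous_on M H"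
    unfolding H_def trace_tangent_def tangent_proj_def by (intro continuous_intros cN cDN')
  have mult_ind: "(\<lambda>x. indicator M x * f x) \<in> borel_measurable borel" if "continuous_on M f" for f :: "'a \<Rightarrow> real"
    using borel_measurable_continuous_on_indicator[OF borel_M that] by simp
  have mG: "(\<lambda>x. indicator M x * (norm (G x))\<^sup>2) \<in> borel_measurable borel"
    by (intro mult_ind continuous_intros cG)
  have mH: "(\<lambda>x. indicator M x * (\<bar>H x\<bar> * (\<psi> x)\<^sup>2)) \<in> borel_measurable borel"
    by (intro mult_ind continuous_intros cH c\<psi>)
  have R_meas[measurable]: "R \<in> borel_measurable borel"
  proof -
    have "R x = indicator M x * (norm (G x))\<^sup>2 + a * (indicator M x * (\<bar>H x\<bar> * (\<psi> x)\<^sup>2)) / norm x" for x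
      by (simp add: R_def distrib_left mult_ac)
    then have "R = (\<lambda>x. indicator M x * (norm (G x))\<^sup>2 + a * (indicator M x * (\<bar>H x\<bar> * (\<psi> x)\<^sup>2)) / norm x)" ..
    then show ?thesis using mG mH by simp
  qed
  define I where "I = (\<integral>\<^sup>+x. ennreal (R x) \<partial>h)"
  have rhs: "(\<integral>\<^sup>+x\<in>M. ennreal ((norm (tgrad M \<phi> x))\<^sup>2 + (real n - 2) / 2 * \<bar>mean_curv M \<nu> x\<bar> * (\<phi> x)\<^sup>2 / norm x) \<partial>h) = I"
    unfolding I_def
    by (rule nn_integral_cong) (auto simp: R_def tg mc \<psi> a_def split: split_indicator)
  define f where "f \<epsilon> x = indicator M x * ((\<psi> x)\<^sup>2 * (a\<^sup>2 / ((norm x)\<^sup>2 + \<epsilon>) + a * (a + 2) * (x \<bullet> N x)\<^sup>2 / ((norm x)\<^sup>2 + \<epsilon>)\<^sup>2))" for \<epsilon> x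
  have f0: "f \<epsilon> x \<ge> 0" if "\<epsilon> \<ge> 0" for \<epsilon> x
    unfolding f_def using a that by (intro mult_nonneg_nonneg add_nonneg_nonneg divide_nonneg_nonneg) auto
  have f_meas[measurable]: "f \<epsilon> \<in> borel_measurable borel" for \<epsilon>
  proof -
    have m1: "(\<lambda>x. indicator M x * (\<psi> x)\<^sup>2) \<in> borel_measurable borel"
      by (intro mult_ind continuous_intros c\<psi>)
    have m2: "(\<lambda>x. indicator M x * ((\<psi> x)\<^sup>2 * (x \<bullet> N x)\<^sup>2)) \<in> borel_measurable borel"
      by (intro mult_ind continuous_intros c\<psi> cN)
    have "f \<epsilon> x = (indicator M x * (\<psi> x)\<^sup>2) * (a\<^sup>2 / ((norm x)\<^sup>2 + \<epsilon>)) +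
        (indicator M x * ((\<psi> x)\<^sup>2 * (x \<bullet> N x)\<^sup>2)) * (a * (a + 2) / ((norm x)\<^sup>2 + \<epsilon>)\<^sup>2)" for x
      by (simp add: f_def distrib_left mult_ac)
    then have "f \<epsilon> = (\<lambda>x. (indicator M x * (\<psi> x)\<^sup>2) * (a\<^sup>2 / ((norm x)\<^sup>2 + \<epsilon>)) +
        (indicator M x * ((\<psi> x)\<^sup>2 * (x \<bullet> N x)\<^sup>2)) * (a * (a + 2) / ((norm x)\<^sup>2 + \<epsilon>)\<^sup>2))" ..
    then show ?thesis using m1 m2 by simp
  qed
  have main: "(\<integral>\<^sup>+x. ennreal (f \<epsilon> x) \<partial>h) \<le> I" if \<epsilon>: "\<epsilon> > 0" for \<epsilon>
  \<comment> \<open>If \<open>I\<close> is infinite there is nothing to show. Otherwise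
    \<open>R\<close> is Bochner integrable, and a multiple of the defect, which has integral 0 but
    no sign, can be added to it.\<close>
  proof (cases "I = \<infinity>")
    case False
    have int_R: "integrable h R"
      using False R0 unfolding I_def by (intro integrableI_nonneg) (auto simp: less_top)
    have IR: "I = ennreal (\<integral>x. R x \<partial>h)"
      unfolding I_def using R0 by (intro nn_integral_eq_integral int_R) auto
    define X where "X = hardy_field \<psi> \<epsilon>"
    define DX where "DX = hardy_field_deriv \<psi> g \<epsilon>"
    define E where "E = tangential_divergence_defect N DN X DX"
    have pos: "(norm x)\<^sup>2 + \<epsilon> \<noteq> 0" for x :: 'a
      using \<epsilon> by (metis add_nonneg_pos less_irrefl zero_le_power2)
    have E0: "has_bochner_integral h (\<lambda>x. indicator K x * E x) 0"
      unfolding E_def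
    proof (rule divergence_theorem[OF _ U(1) K(1)])
      show "\<exists>V D \<pi> b \<sigma>. p \<in> V \<and> curved_chart M V D N \<pi> b DN \<sigma>" if "p \<in> K" for p
        using charts K that by blast
      show "K \<subseteq> M \<inter> U" using K U by blast
      show "(X has_derivative DX x) (at x)" if "x \<in> U" for x
        unfolding X_def DX_def using d\<psi>[OF that] by (rule has_derivative_hardy_field[where g = g, OF \<epsilon>])
      show "continuous_on U (\<lambda>x. DX x i)" for i
      proof -
        have c: "continuous_on U \<psi>"
          using d\<psi> by (intro continuous_at_imp_continuous_on ballI) (blast intro: has_derivative_continuous)
        show ?thesis
          unfolding DX_def hardy_field_deriv_def using pos
          by (intro continuous_intros c g) auto
      qed
      show "X x = 0" if "x \<in> M" "x \<notin> K" for x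
        using \<psi>[OF that(1)] \<phi>0[OF that] by (simp add: X_def hardy_field_def)
    qed
    have "has_bochner_integral h (\<lambda>x. R x + a * (indicator K x * E x)) (integral\<^sup>L h R + a * 0)"
      by (intro has_bochner_integral_add has_bochner_integral_mult_right E0 has_bochner_integral_integrable int_R)
    then have int: "has_bochner_integral h (\<lambda>x. R x + a * (indicator K x * E x)) (integral\<^sup>L h R)" by simp
    \<comment> \<open>Off \<open>K\<close> the left side vanishes with \<phi>; on \<open>K\<close>
      this is the pointwise inequality.\<close>
    have le: "f \<epsilon> x \<le> R x + a * (indicator K x * E x)" for x
    proof (cases "x \<in> K")
      case False
      then show ?thesis
        using R0[of x] \<phi>0[of x] \<psi>[of x] by (cases "x \<in> M") (auto simp: f_def)
    next
      case True
      then have xM: "x \<in> M" using K by blast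
      define s t q \<rho> where "s = norm (tangent_proj (N x) x)" and "t = x \<bullet> N x"
        and "q = G x \<bullet> tangent_proj (N x) x" and "\<rho> = (norm x)\<^sup>2 + \<epsilon>"
      have NN: "N x \<bullet> N x = 1" using norm_N[OF xM] by (simp add: norm_eq_1)
      have st: "s\<^sup>2 + t\<^sup>2 = (norm x)\<^sup>2"
        unfolding s_def t_def power2_norm_eq_inner
        by (simp add: tangent_proj_def inner_diff_left inner_diff_right NN inner_commute[of "N x" x] power2_eq_square)
      have q: "\<bar>q\<bar> \<le> norm (G x) * s"
        unfolding q_def s_def by (rule Cauchy_Schwarz_ineq2)
      have Ex: "E x = (2 * a + 2) * (\<psi> x)\<^sup>2 / \<rho> + 2 * \<psi> x * q / \<rho> - 2 * (\<psi> x)\<^sup>2 * s\<^sup>2 / \<rho>\<^sup>2 - H x * (\<psi> x)\<^sup>2 * t / \<rho>"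
        unfolding E_def tangential_divergence_defect_def DX_def
          trace_tangent_hardy_field[OF norm_N[OF xM]] n_def[symmetric] n_a H_def[symmetric]
        by (simp add: X_def hardy_field_def s_def t_def q_def \<rho>_def G_def mult_ac)
      show ?thesis
        using hardy_pointwise[OF a \<epsilon> norm_ge_zero[of x] _ st norm_ge_zero q, of "\<psi> x" "H x"] xM True
        by (simp add: f_def R_def Ex \<rho>_def t_def[symmetric]) (simp add: s_def)
    qed
    \<comment> \<open>Allows the return from the Bochner integral to the nonnegative one.\<close>
    have nonneg: "0 \<le> R x + a * (indicator K x * E x)" for x
      using order_trans[OF f0 le] \<epsilon> by simp
    have "(\<integral>\<^sup>+x. ennreal (f \<epsilon> x) \<partial>h) \<le> (\<integral>\<^sup>+x. ennreal (R x + a * (indicator K x * E x)) \<partial>h)"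
      using le by (intro nn_integral_mono ennreal_leI)
    also have "\<dots> = ennreal (integral\<^sup>L h R)"
      using int nonneg by (subst nn_integral_eq_integral) (auto simp: has_bochner_integral_iff)
    finally show ?thesis unfolding IR .
  qed simp
  define \<epsilon> where "\<epsilon> k = 1 / real (Suc k)" for k
  have \<epsilon>: "\<epsilon> k > 0" for k by (simp add: \<epsilon>_def)
  have \<epsilon>0: "\<epsilon> \<longlonglongrightarrow> 0"
    unfolding \<epsilon>_def using LIMSEQ_inverse_real_of_nat by (simp add: divide_inverse)
  define F where "F x = indicator M x * ((\<psi> x)\<^sup>2 * (a\<^sup>2 / (norm x)\<^sup>2 + a * (a + 2) * (x \<bullet> N x)\<^sup>2 / ((norm x)\<^sup>2)\<^sup>2))" for x
  \<comment> \<open>At the origin \<open>F\<close> is 0 by division by zero, so convergence of the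
    regularised integrands is used only away from it.\<close>
  have F_liminf: "ennreal (F x) \<le> liminf (\<lambda>k. ennreal (f (\<epsilon> k) x))" for x
  proof (cases "x = 0")
    case True
    then show ?thesis by (simp add: F_def)
  next
    case False
    have "(\<lambda>k. f (\<epsilon> k) x) \<longlonglongrightarrow> indicator M x * ((\<psi> x)\<^sup>2 * (a\<^sup>2 / ((norm x)\<^sup>2 + 0) + a * (a + 2) * (x \<bullet> N x)\<^sup>2 / ((norm x)\<^sup>2 + 0)\<^sup>2))"
      unfolding f_def using False by (intro tendsto_intros \<epsilon>0) auto
    then have "(\<lambda>k. ennreal (f (\<epsilon> k) x)) \<longlonglongrightarrow> ennreal (F x)"
      unfolding F_def by (intro tendsto_ennrealI) simp
    then show ?thesis by (simp add: lim_imp_Liminf)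
  qed
  have "ennreal (a\<^sup>2) * (\<integral>\<^sup>+x\<in>M. ennreal ((\<phi> x)\<^sup>2 / (norm x)\<^sup>2) \<partial>h)
      + ennreal (a * (a + 2)) * (\<integral>\<^sup>+x\<in>M. ennreal (((x /\<^sub>R norm x) \<bullet> \<nu> x)\<^sup>2 * (\<phi> x)\<^sup>2 / (norm x)\<^sup>2) \<partial>h)
    = (\<integral>\<^sup>+x. ennreal (F x) \<partial>h)"
  proof -
    define F1 where "F1 x = indicator M x * ((\<psi> x)\<^sup>2 / (norm x)\<^sup>2)" for x
    define F2 where "F2 x = indicator M x * (((\<psi> x)\<^sup>2 * (x \<bullet> N x)\<^sup>2) / ((norm x)\<^sup>2)\<^sup>2)" for x
    have m1: "F1 \<in> borel_measurable borel"
    proof -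
      have "(\<lambda>x. indicator M x * (\<psi> x)\<^sup>2) \<in> borel_measurable borel"
        by (intro mult_ind continuous_intros c\<psi>)
      then have "(\<lambda>x. indicator M x * (\<psi> x)\<^sup>2 / (norm x)\<^sup>2) \<in> borel_measurable borel" by simp
      then show ?thesis by (simp add: F1_def[abs_def])
    qed
    have m2: "F2 \<in> borel_measurable borel"
    proof -
      have "(\<lambda>x. indicator M x * ((\<psi> x)\<^sup>2 * (x \<bullet> N x)\<^sup>2)) \<in> borel_measurable borel"
        by (intro mult_ind continuous_intros c\<psi> cN)
      then have "(\<lambda>x. indicator M x * ((\<psi> x)\<^sup>2 * (x \<bullet> N x)\<^sup>2) / ((norm x)\<^sup>2)\<^sup>2) \<in> borel_measurable borel" by simp
      then show ?thesis by (simp add: F2_def[abs_def])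
    qed
    have pos: "F1 x \<ge> 0" "F2 x \<ge> 0" for x by (auto simp: F1_def F2_def)
    have e1: "(\<integral>\<^sup>+x\<in>M. ennreal ((\<phi> x)\<^sup>2 / (norm x)\<^sup>2) \<partial>h) = (\<integral>\<^sup>+x. ennreal (F1 x) \<partial>h)"
      by (rule nn_integral_cong) (auto simp: F1_def \<psi> split: split_indicator)
    have e2: "(\<integral>\<^sup>+x\<in>M. ennreal (((x /\<^sub>R norm x) \<bullet> \<nu> x)\<^sup>2 * (\<phi> x)\<^sup>2 / (norm x)\<^sup>2) \<partial>h) = (\<integral>\<^sup>+x. ennreal (F2 x) \<partial>h)"
    proof (rule nn_integral_cong)
      fix x
      show "ennreal (((x /\<^sub>R norm x) \<bullet> \<nu> x)\<^sup>2 * (\<phi> x)\<^sup>2 / (norm x)\<^sup>2) * indicator M x = ennreal (F2 x)"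
      proof (cases "x \<in> M")
        case True
        have "((x /\<^sub>R norm x) \<bullet> \<nu> x)\<^sup>2 * (\<phi> x)\<^sup>2 / (norm x)\<^sup>2 = (\<psi> x)\<^sup>2 * (x \<bullet> N x)\<^sup>2 / ((norm x)\<^sup>2)\<^sup>2"
          by (simp add: \<nu>[OF True] \<psi>[OF True] power_mult_distrib power2_eq_square field_simps)
        then show ?thesis using True by (simp add: F2_def)
      qed (simp add: F2_def)
    qed
    have "ennreal (a\<^sup>2) * (\<integral>\<^sup>+x. ennreal (F1 x) \<partial>h) + ennreal (a * (a + 2)) * (\<integral>\<^sup>+x. ennreal (F2 x) \<partial>h) =
        (\<integral>\<^sup>+x. ennreal (a\<^sup>2) * ennreal (F1 x) + ennreal (a * (a + 2)) * ennreal (F2 x) \<partial>h)"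
      using m1 m2 by (subst nn_integral_add) (auto simp: nn_integral_cmult)
    also have "\<dots> = (\<integral>\<^sup>+x. ennreal (F x) \<partial>h)"
    proof (rule nn_integral_cong)
      fix x
      have "F x = a\<^sup>2 * F1 x + a * (a + 2) * F2 x"
        by (simp add: F_def F1_def F2_def distrib_left mult_ac)
      then show "ennreal (a\<^sup>2) * ennreal (F1 x) + ennreal (a * (a + 2)) * ennreal (F2 x) = ennreal (F x)"
        using pos[of x] a by (simp add: ennreal_plus ennreal_mult)
    qed
    finally show ?thesis unfolding e1 e2 .
  qed
  also have "\<dots> \<le> (\<integral>\<^sup>+x. liminf (\<lambda>k. ennreal (f (\<epsilon> k) x)) \<partial>h)"
    by (intro nn_integral_mono F_liminf)
  also have "\<dots> \<le> liminf (\<lambda>k. \<integral>\<^sup>+x. ennreal (f (\<epsilon> k) x) \<partial>h)"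
    by (intro nn_integral_liminf) measurable
  also have "\<dots> \<le> liminf (\<lambda>k::nat. I)"
    by (intro Liminf_mono always_eventually allI main \<epsilon>)
  also have "\<dots> = I" by (simp add: Liminf_const)
  finally show ?thesis unfolding rhs a2 .
qed

theorem theorem1p4:
  fixes M :: "'a::euclidean_space set" and \<nu> :: "'a \<Rightarrow> 'a" and \<phi> :: "'a \<Rightarrow> real"
  assumes "DIM('a) \<ge> 4"
    and "smooth_hypersurface M"
    and "unit_normal_field M \<nu>"
    and "C1c_on M \<phi>"
  shows "ennreal ((real (DIM('a) - 1) - 2)^2 / 4) *
           (\<integral>\<^sup>+x\<in>M. ennreal (\<phi> x ^ 2 / norm x ^ 2) \<partial>hausdorff_measure (real (DIM('a) - 1)))
         + ennreal ((real (DIM('a) - 1) ^ 2 - 4) / 4) *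
           (\<integral>\<^sup>+x\<in>M. ennreal (((x /\<^sub>R norm x) \<bullet> \<nu> x)^2 * \<phi> x ^ 2 / norm x ^ 2)
              \<partial>hausdorff_measure (real (DIM('a) - 1)))
         \<le> (\<integral>\<^sup>+x\<in>M. ennreal (norm (tgrad M \<phi> x) ^ 2
               + (real (DIM('a) - 1) - 2) / 2 * \<bar>mean_curv M \<nu> x\<bar> * \<phi> x ^ 2 / norm x)
              \<partial>hausdorff_measure (real (DIM('a) - 1)))"
proof -
  define n where "n = DIM('a) - 1"
  define h :: "'a measure" where "h = hausdorff_measure (real n)"
  have ss: "sigma_sets UNIV (sets borel) = sets (borel :: 'a measure)"
    using sets.sigma_sets_eq[of "borel :: 'a measure"] by simp
  have sets_h: "sets h = sets borel"
    unfolding h_def hausdorff_measure_def using ss by (subst sets_measure_of) auto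
  have em: "emeasure h A = (if A \<in> sets borel \<and> measure_space UNIV (sets borel) (hausdorff_outer (real n) :: 'a set \<Rightarrow> _)
      then hausdorff_outer (real n) A else 0)" for A
    unfolding h_def hausdorff_measure_def using ss by (subst emeasure_measure_of_conv) simp
  show ?thesis
  proof (cases "measure_space UNIV (sets borel) (hausdorff_outer (real n) :: 'a set \<Rightarrow> ennreal)")
    case False
    text \<open>If the outer measure were not countably additive on Borel sets, \<open>measure_of\<close> would
      yield the zero measure, so no proof of countable additivity is needed.\<close>
    then have "emeasure h (space h) = 0" by (simp add: em)
    then have AE: "AE x in h. False" by (simp add: AE_iff_null null_setsI)
    have "(\<integral>\<^sup>+x. f x \<partial>h) = 0" for f
    proof -
      have "(\<integral>\<^sup>+x. f x \<partial>h) = (\<integral>\<^sup>+x. 0 \<partial>h)" by (rule nn_integral_cong_AE) (use AE in auto)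
      then show ?thesis by simp
    qed
    then show ?thesis unfolding n_def[symmetric] h_def[symmetric] by simp
  next
    case True
    interpret hausdorff_space h n
      using True assms(1) by unfold_locales (simp_all add: sets_h em n_def)
    obtain W N DN where N: "oriented_hypersurface M W N DN" "\<And>x. x \<in> M \<Longrightarrow> \<nu> x = N x"
      using oriented_hypersurfaceI[OF assms(2,3)] by blast
    obtain U \<psi> g where U: "open U" "M \<subseteq> U" "continuous_on U g"
      "\<And>x. x \<in> U \<Longrightarrow> (\<psi> has_derivative (\<lambda>v. g x \<bullet> v)) (at x)" "\<And>x. x \<in> M \<Longrightarrow> \<psi> x = \<phi> x"
      and K: "compact (M \<inter> closure {x\<in>M. \<phi> x \<noteq> 0})"
      using assms(4) unfolding C1c_on_def by blast
    have "\<phi> x = 0" if "x \<in> M" "x \<notin> M \<inter> closure {x\<in>M. \<phi> x \<noteq> 0}" for x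
      using that closure_subset[of "{x\<in>M. \<phi> x \<noteq> 0}"] by blast
    from hardy_inequality[OF N(1) _ N(2) U K _ this] show ?thesis
      unfolding n_def[symmetric] h_def[symmetric] using assms(1) by (simp add: n_def)
  qed
qed

end
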